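(* Let $n\ge1$, $0\le i\le n-1$, and let $\mathbf k$ be $\mathbb Z$ or an arbitrary field. The set $\{\bar c(T,\sigma):(T,\sigma)\in\mathsf{Comb}^2_{n,i}\}$, indexed by the bicolored combs with leaf label set $[n]$ and $i$ red internal nodes, is a basis for $\tilde H^{n-3}((\hat 0,[n]^i);\mathbf k)$.
   Context: Poset. Let $[n]=\{1,\dots,n\}$. A weighted partition of $[n]$ is a set $\{B_1^{v_1},\dots,B_t^{v_t}\}$ where $\{B_1,\dots,B_t\}$ is a partition of $[n]$ and $v_i\in\{0,1,\dots,|B_i|-1\}$. The poset $\Pi_n^w$ is the set of weighted partitions of $[n]$ ordered by: $\{A_1^{w_1},\dots,A_s^{w_s}\}\le\{B_1^{v_1},\dots,B_t^{v_t}\}$ iff $\{A_j\}$ refines $\{B_k\}$ and whenever $B_k=A_{i_1}\cup\cdots\cup A_{i_l}$, then $v_k-(w_{i_1}+\cdots+w_{i_l})\in\{0,\dots,l-1\}$. Its minimum is $\hat 0=\{\{1\}^0,\dots,\{n\}^0\}$ and its maximal elements are $[n]^i:=\{[n]^i\}$, $0\le i\le n-1$. Cohomology. For a finite poset $P$ the reduced cochain module $C_r(P)$ is the free $\mathbf k$-module on chains $\alpha_0<\cdots<\alpha_r$ ($C_{-1}$ is spanned by the empty chain), with $\delta_r(\alpha_0<\cdots<\alpha_r)=\sum_{i=0}^{r+1}(-1)^i\sum_{\alpha\in(\alpha_{i-1},\alpha_i)}(\alpha_0<\cdots<\alpha_{i-1}<\alpha<\alpha_i<\cdots<\alpha_r)$,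 where $\alpha_{-1},\alpha_{r+1}$ are an adjoined minimum and maximum; $\tilde H^r(P)=\ker\delta_r/\operatorname{im}\delta_{r-1}$. Maximal chains are identified with their classes in top cohomology. For a degenerate interval, $\tilde H^r((x,x))=\mathbf k$ if $r=-2$ and $0$ otherwise. Trees. A bicolored binary tree is a complete plane binary tree (every internal node has a left and a right child) with each internal node colored red or blue. $\mathcal{BT}_{n,i}$ is the set of pairs $(T,\sigma)$ with $T$ a bicolored binary tree with $n$ leaves and $i$ red internal nodes and $\sigma\in\mathfrak S_n$, the $j$th leaf from left to right being labeled $\sigma(j)$. Such a tree is normalized if the leftmost leaf of each subtree (rooted at any node) has the smallest label in that subtree. A bicolored comb is a normalized tree such that for each internal node $x$ whose right child $y$ is not a leaf, $x$ is red and $y$ is blue. $\mathsf{Comb}^2_{n,i}$ is the set of bicolored combs in $\mathcal{BT}_{n,i}$. Chains. Put $u(\text{blue})=0$, $u(\text{red})=1$. To $u$-merge two blocks $A^{a},B^{b}$ means to replace them by $(A\cup B)^{a+b+u}$. Postorder lists the internal nodes of the left subtree (recursively in postorder), then those of the right subtree, then the root. For $(T,\sigma)\in\mathcal{BT}_{n,i}$, $c(T,\sigma)$ is the maximal chain of $[\hat 0,[n]^i]$ starting at $\hat 0$ whose rank $k$ element is obtained from its rank $k-1$ element by $u(\mathrm{col}_k)$-merging the blocks whose underlying sets are the leaf label sets of the left and right subtrees of the $k$th internal node in postorder, $\mathrm{col}_k$ being the color of that node. $\bar c(T,\sigma)=c(T,\sigma)\setminus\{\hat 0,[n]^i\}$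 (for $n=1$, read as the generator of $\tilde H^{-2}$). *)

theory Defs
  imports
    "HOL-Library.Poly_Mapping"
    "HOL-Library.Set_Algebras"
    "HOL-Library.Disjoint_Sets"
    "HOL-Combinatorics.Multiset_Permutations"
    "HOL-Algebra.Module"
    "HOL-Algebra.Algebraic_Closure_Type"
begin

section \<open>Quotient modules and bases\<close>

text \<open>
  The free module on a set \<open>S\<close> over \<open>'k\<close> is the set of all \<open>f :: 'b \<Rightarrow>\<^sub>0 'k\<close> with \<open>keys f \<subseteq> S\<close>.
\<close>

definition fscale :: "'k \<Rightarrow> ('b \<Rightarrow>\<^sub>0 'k) \<Rightarrow> ('b \<Rightarrow>\<^sub>0 'k::comm_ring_1)" where
  "fscale a f = Poly_Mapping.map ((*) a) f"

text \<open>
  The quotient \<open>Z / B\<close>, its elements being the cosets of \<open>B\<close>.  A scalar multiple has to be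
  enlarged by \<open>B\<close>, since multiplying a coset pointwise by a non-unit does not give a coset.
  The fields \<open>mult\<close> and \<open>one\<close>, which the record of modules inherits from that of rings, play
  no role for modules.
\<close>

definition quotient_module ::
  "('b \<Rightarrow>\<^sub>0 'k::comm_ring_1) set \<Rightarrow> ('b \<Rightarrow>\<^sub>0 'k) set \<Rightarrow> ('k, ('b \<Rightarrow>\<^sub>0 'k) set) module" where
  "quotient_module Z B =
    \<lparr> carrier = (\<lambda>z. z +o B) ` Z, mult = undefined, one = undefined,
      zero = B, add = (\<lambda>S T. S + T), module.smult = (\<lambda>a S. fscale a ` S + B) \<rparr>"

definition module_basis ::
  "('k, 'r) ring_scheme \<Rightarrow> ('k, 'm, 's) module_scheme \<Rightarrow> 'i set \<Rightarrow> ('i \<Rightarrow> 'm) \<Rightarrow> bool" where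
  "module_basis R M I b \<longleftrightarrow>
     finite I \<and> b \<in> I \<rightarrow> carrier M \<and>
     (\<forall>a \<in> I \<rightarrow> carrier R.
        (\<Oplus>\<^bsub>M\<^esub>j\<in>I. a j \<odot>\<^bsub>M\<^esub> b j) = \<zero>\<^bsub>M\<^esub> \<longrightarrow> (\<forall>j\<in>I. a j = \<zero>\<^bsub>R\<^esub>)) \<and>
     (\<forall>y \<in> carrier M. \<exists>a \<in> I \<rightarrow> carrier R. y = (\<Oplus>\<^bsub>M\<^esub>j\<in>I. a j \<odot>\<^bsub>M\<^esub> b j))"

lemma lookup_fscale [simp]: "Poly_Mapping.lookup (fscale a f) x = a * Poly_Mapping.lookup f x"
  by (simp add: fscale_def Poly_Mapping.map.rep_eq when_def)

lemma quotient_module_module: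
  fixes Z B :: "('b \<Rightarrow>\<^sub>0 'k::comm_ring_1) set"
  assumes Z: "0 \<in> Z" "\<And>x y. x \<in> Z \<Longrightarrow> y \<in> Z \<Longrightarrow> x + y \<in> Z" "\<And>a x. x \<in> Z \<Longrightarrow> fscale a x \<in> Z"
    and B: "0 \<in> B" "\<And>x y. x \<in> B \<Longrightarrow> y \<in> B \<Longrightarrow> x + y \<in> B" "\<And>a x. x \<in> B \<Longrightarrow> fscale a x \<in> B"
  shows "module (ring_of_type_algebra :: 'k ring) (quotient_module Z B)"
proof -
  have BB: "B + B = B"
    using B(2) set_zero_plus2[OF B(1), of B] by (auto elim!: set_plus_elim)
  have add: "(x +o B) + (y +o B) = (x + y) +o B" for x y
    by (simp only: set_plus_rearrange BB)
  have sc_add: "fscale a (x + y) = fscale a x + fscale a y" for a and x y :: "'b \<Rightarrow>\<^sub>0 'k"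
    by (rule poly_mapping_eqI) (simp add: lookup_add algebra_simps)
  have add_sc: "fscale (a + b) x = fscale a x + fscale b x" for a b and x :: "'b \<Rightarrow>\<^sub>0 'k"
    by (rule poly_mapping_eqI) (simp add: lookup_add algebra_simps)
  have mult_sc: "fscale (a * b) x = fscale a (fscale b x)" for a b and x :: "'b \<Rightarrow>\<^sub>0 'k"
    by (rule poly_mapping_eqI) (simp add: algebra_simps)
  have one_sc: "fscale 1 x = x" for x :: "'b \<Rightarrow>\<^sub>0 'k"
    by (rule poly_mapping_eqI) simp
  have neg: "fscale (- 1) x + x = 0" for x :: "'b \<Rightarrow>\<^sub>0 'k"
    by (rule poly_mapping_eqI) (simp add: lookup_add)
  have fscale_0: "fscale a 0 = (0 :: 'b \<Rightarrow>\<^sub>0 'k)" for a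
    by (rule poly_mapping_eqI) simp
  have scB: "fscale a ` B + B = B" for a
    using B set_zero_plus2[of "fscale a ` B" B] image_eqI[of 0 "fscale a" 0 B]
    by (auto elim!: set_plus_elim simp: fscale_0)
  have sc: "fscale a ` (x +o B) + B = fscale a x +o B" for a x
  proof -
    have "fscale a ` (x +o B) = fscale a x +o fscale a ` B"
      by (fastforce simp: elt_set_plus_def image_iff sc_add)
    then show ?thesis
      by (simp only: set_plus_rearrange3 scB)
  qed
  define Q where "Q = quotient_module Z B"
  have carrier: "carrier Q = (\<lambda>z. z +o B) ` Z" and Qadd: "S \<oplus>\<^bsub>Q\<^esub> T = S + T"
    and Qzero: "\<zero>\<^bsub>Q\<^esub> = B" and Qsmult: "a \<odot>\<^bsub>Q\<^esub> S = fscale a ` S + B" for S T a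
    by (simp_all add: Q_def quotient_module_def)
  have elim: thesis if "S \<in> carrier Q" "\<And>x. x \<in> Z \<Longrightarrow> S = x +o B \<Longrightarrow> thesis" for S thesis
    using that by (auto simp only: carrier)
  have mem: "x +o B \<in> carrier Q" if "x \<in> Z" for x
    unfolding carrier using that by (rule imageI)
  have "abelian_group Q"
  proof (rule abelian_groupI)
    fix S T assume "S \<in> carrier Q" "T \<in> carrier Q"
    then show "S \<oplus>\<^bsub>Q\<^esub> T \<in> carrier Q"
      by (elim elim) (simp only: Qadd add mem Z)
  next
    show "\<zero>\<^bsub>Q\<^esub> \<in> carrier Q"
      using mem[OF Z(1)] by (simp only: Qzero set_zero_plus)
  next
    fix S assume "S \<in> carrier Q"
    then obtain x where x: "x \<in> Z" "S = x +o B"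
      by (rule elim)
    show "\<zero>\<^bsub>Q\<^esub> \<oplus>\<^bsub>Q\<^esub> S = S"
      using add[of 0 x] by (simp only: Qadd Qzero x set_zero_plus add_0)
    have "(fscale (- 1) x +o B) \<oplus>\<^bsub>Q\<^esub> S = \<zero>\<^bsub>Q\<^esub>"
      by (simp only: Qadd Qzero x add neg set_zero_plus)
    then show "\<exists>T\<in>carrier Q. T \<oplus>\<^bsub>Q\<^esub> S = \<zero>\<^bsub>Q\<^esub>"
      using mem[OF Z(3)[OF x(1)]] by blast
  qed (simp_all only: Qadd ac_simps)
  moreover have "cring (ring_of_type_algebra :: 'k ring)"
    by (rule cring_from_type_algebra)
  moreover have "a \<odot>\<^bsub>Q\<^esub> S \<in> carrier Q" "\<one>\<^bsub>ring_of_type_algebra\<^esub> \<odot>\<^bsub>Q\<^esub> S = S"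
      "(a \<oplus>\<^bsub>ring_of_type_algebra\<^esub> b) \<odot>\<^bsub>Q\<^esub> S = a \<odot>\<^bsub>Q\<^esub> S \<oplus>\<^bsub>Q\<^esub> b \<odot>\<^bsub>Q\<^esub> S"
      "(a \<otimes>\<^bsub>ring_of_type_algebra\<^esub> b) \<odot>\<^bsub>Q\<^esub> S = a \<odot>\<^bsub>Q\<^esub> (b \<odot>\<^bsub>Q\<^esub> S)"
    if "S \<in> carrier Q" for a b S
    by (rule elim[OF that];
        simp only: Qadd Qsmult sc add mem Z add_sc mult_sc one_sc ring_of_type_algebra_def
          ring.simps monoid.simps)+
  moreover have "a \<odot>\<^bsub>Q\<^esub> (S \<oplus>\<^bsub>Q\<^esub> T) = a \<odot>\<^bsub>Q\<^esub> S \<oplus>\<^bsub>Q\<^esub> a \<odot>\<^bsub>Q\<^esub> T"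
    if "S \<in> carrier Q" "T \<in> carrier Q" for a S T
    by (rule elim[OF that(1)]; rule elim[OF that(2)]; simp only: Qadd Qsmult sc add sc_add)
  ultimately show ?thesis
    unfolding Q_def by (intro moduleI) simp_all
qed

section \<open>Reduced cohomology of finite posets\<close>

text \<open>
  A poset is given by its underlying set \<open>P\<close> and its strict order \<open>lt\<close>.  The chain
  \<open>\<alpha>\<^sub>0 < \<dots> < \<alpha>\<^sub>r\<close> is the list \<open>[\<alpha>\<^sub>0, \<dots>, \<alpha>\<^sub>r]\<close>; the empty list has degree \<open>- 1\<close>.
\<close>

definition chains :: "'a set \<Rightarrow> ('a \<Rightarrow> 'a \<Rightarrow> bool) \<Rightarrow> int \<Rightarrow> 'a list set" where
  "chains P lt r = {c. set c \<subseteq> P \<and> sorted_wrt lt c \<and> int (length c) = r + 1}"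

definition cochains ::
  "'a set \<Rightarrow> ('a \<Rightarrow> 'a \<Rightarrow> bool) \<Rightarrow> int \<Rightarrow> ('a list \<Rightarrow>\<^sub>0 'k::comm_ring_1) set" where
  "cochains P lt r = {f. Poly_Mapping.keys f \<subseteq> chains P lt r}"

text \<open>
  The elements of \<open>P\<close> strictly between the neighbours \<open>\<alpha>\<^sub>i\<^sub>-\<^sub>1\<close> and \<open>\<alpha>\<^sub>i\<close> of position \<open>i\<close>, where
  \<open>\<alpha>\<^sub>-\<^sub>1\<close> and \<open>\<alpha>\<^sub>r\<^sub>+\<^sub>1\<close> are an adjoined minimum and maximum.
\<close>

definition gap :: "'a set \<Rightarrow> ('a \<Rightarrow> 'a \<Rightarrow> bool) \<Rightarrow> 'a list \<Rightarrow> nat \<Rightarrow> 'a set" where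
  "gap P lt c i =
     {\<alpha> \<in> P. (0 < i \<longrightarrow> lt (c ! (i - 1)) \<alpha>) \<and> (i < length c \<longrightarrow> lt \<alpha> (c ! i))}"

text \<open>All the \<open>\<delta>\<^sub>r\<close> at once: the linear extension of the formula on chains.\<close>

definition coboundary ::
  "'a set \<Rightarrow> ('a \<Rightarrow> 'a \<Rightarrow> bool) \<Rightarrow> ('a list \<Rightarrow>\<^sub>0 'k::comm_ring_1) \<Rightarrow> ('a list \<Rightarrow>\<^sub>0 'k)" where
  "coboundary P lt f =
     (\<Sum>c\<in>Poly_Mapping.keys f. \<Sum>i\<le>length c. \<Sum>\<alpha>\<in>gap P lt c i.
        Poly_Mapping.single (take i c @ \<alpha> # drop i c) ((- 1) ^ i * Poly_Mapping.lookup f c))"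

definition reduced_cohomology ::
  "'a set \<Rightarrow> ('a \<Rightarrow> 'a \<Rightarrow> bool) \<Rightarrow> int \<Rightarrow> ('k::comm_ring_1, ('a list \<Rightarrow>\<^sub>0 'k) set) module" where
  "reduced_cohomology P lt r =
     quotient_module {f \<in> cochains P lt r. coboundary P lt f = 0}
                     (coboundary P lt ` cochains P lt (r - 1))"

text \<open>
  Cohomology of the open interval \<open>(x, y)\<close>.  For the degenerate interval \<open>(x, x)\<close> the only
  nonzero module, in degree \<open>- 2\<close>, is realised as the free module on the empty list, so that
  its generator is again given by the list of elements of a maximal chain of \<open>[x, x]\<close> other than
  its endpoints.
\<close>

definition interval_cohomology ::
  "'a set \<Rightarrow> ('a \<Rightarrow> 'a \<Rightarrow> bool) \<Rightarrow> 'a \<Rightarrow> 'a \<Rightarrow> int \<Rightarrow>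
     ('k::comm_ring_1, ('a list \<Rightarrow>\<^sub>0 'k) set) module" where
  "interval_cohomology P lt x y r =
     (if x = y
      then quotient_module (if r = - 2 then {f. Poly_Mapping.keys f \<subseteq> {[]}} else {0}) {0}
      else reduced_cohomology {z \<in> P. lt x z \<and> lt z y} lt r)"

text \<open>The class of the chain \<open>c\<close>; note that the zero of a quotient \<open>Z / B\<close> is \<open>B\<close>.\<close>

definition chain_class ::
  "('k::comm_ring_1, ('a list \<Rightarrow>\<^sub>0 'k) set) module \<Rightarrow> 'a list \<Rightarrow> ('a list \<Rightarrow>\<^sub>0 'k) set" where
  "chain_class H c = Poly_Mapping.single c 1 +o \<zero>\<^bsub>H\<^esub>"

section \<open>Weighted partitions\<close>

text \<open>The weighted block \<open>B\<^sup>v\<close> is the pair \<open>(B, v)\<close>.\<close>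

type_synonym wpartition = "(nat set \<times> nat) set"

definition wpartitions :: "nat \<Rightarrow> wpartition set" where
  "wpartitions n =
     {\<alpha>. partition_on {1..n} (fst ` \<alpha>) \<and> inj_on fst \<alpha> \<and> (\<forall>(B, v)\<in>\<alpha>. v \<in> {0..card B - 1})}"

definition wp_le :: "nat \<Rightarrow> wpartition \<Rightarrow> wpartition \<Rightarrow> bool" where
  "wp_le n \<alpha> \<beta> \<longleftrightarrow>
     refines {1..n} (fst ` \<alpha>) (fst ` \<beta>) \<and>
     (\<forall>(B, v)\<in>\<beta>. let L = {(A, w)\<in>\<alpha>. A \<subseteq> B} in
        int v - (\<Sum>(A, w)\<in>L. int w) \<in> {0..int (card L) - 1})"

definition wp_less :: "nat \<Rightarrow> wpartition \<Rightarrow> wpartition \<Rightarrow> bool" where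
  "wp_less n \<alpha> \<beta> \<longleftrightarrow> wp_le n \<alpha> \<beta> \<and> \<alpha> \<noteq> \<beta>"

definition wp_bot :: "nat \<Rightarrow> wpartition" where
  "wp_bot n = (\<lambda>j. ({j}, 0)) ` {1..n}"

definition wp_top :: "nat \<Rightarrow> nat \<Rightarrow> wpartition" where
  "wp_top n i = {({1..n}, i)}"

section \<open>Bicolored binary trees\<close>

datatype color = Blue | Red

datatype bctree = Leaf nat | Node color bctree bctree

fun leaves :: "bctree \<Rightarrow> nat list" where
  "leaves (Leaf a) = [a]"
| "leaves (Node c l r) = leaves l @ leaves r"

abbreviation labels :: "bctree \<Rightarrow> nat set" where
  "labels t \<equiv> set (leaves t)"

fun red_nodes :: "bctree \<Rightarrow> nat" where
  "red_nodes (Leaf a) = 0"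
| "red_nodes (Node c l r) = (if c = Red then 1 else 0) + red_nodes l + red_nodes r"

fun subtrees :: "bctree \<Rightarrow> bctree set" where
  "subtrees (Leaf a) = {Leaf a}"
| "subtrees (Node c l r) = insert (Node c l r) (subtrees l \<union> subtrees r)"

text \<open>
  A pair \<open>(T, \<sigma>)\<close> is encoded as a single tree, the shape \<open>T\<close> with its \<open>j\<close>-th leaf carrying the label
  \<open>\<sigma>(j)\<close>.  Thus \<open>leaves\<close> is the word \<open>\<sigma>(1) \<dots> \<sigma>(n)\<close>.
\<close>

definition BT :: "nat \<Rightarrow> nat \<Rightarrow> bctree set" where
  "BT n i = {t. leaves t \<in> permutations_of_set {1..n} \<and> red_nodes t = i}"

definition normalized :: "bctree \<Rightarrow> bool" where
  "normalized t \<longleftrightarrow> (\<forall>s\<in>subtrees t. hd (leaves s) = Min (labels s))"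

definition bicolored_comb :: "bctree \<Rightarrow> bool" where
  "bicolored_comb t \<longleftrightarrow> normalized t \<and>
     (\<forall>c l c' l' r'. Node c l (Node c' l' r') \<in> subtrees t \<longrightarrow> c = Red \<and> c' = Blue)"

definition Comb2 :: "nat \<Rightarrow> nat \<Rightarrow> bctree set" where
  "Comb2 n i = {t \<in> BT n i. bicolored_comb t}"

section \<open>The maximal chain of a tree\<close>

fun u :: "color \<Rightarrow> nat" where
  "u Blue = 0"
| "u Red = 1"

definition weight :: "wpartition \<Rightarrow> nat set \<Rightarrow> nat" where
  "weight \<alpha> A = (THE w. (A, w) \<in> \<alpha>)"

text \<open>The \<open>k\<close>-merge of the blocks of \<open>\<alpha>\<close> with underlying sets \<open>A\<close> and \<open>B\<close>.\<close>

definition merge :: "nat \<Rightarrow> nat set \<Rightarrow> nat set \<Rightarrow> wpartition \<Rightarrow> wpartition" where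
  "merge k A B \<alpha> =
     {(S, w)\<in>\<alpha>. S \<noteq> A \<and> S \<noteq> B} \<union> {(A \<union> B, weight \<alpha> A + weight \<alpha> B + k)}"

text \<open>
  Each internal node is listed as its color together with the label sets of its left and right
  subtrees.
\<close>

fun postorder :: "bctree \<Rightarrow> (color \<times> nat set \<times> nat set) list" where
  "postorder (Leaf a) = []"
| "postorder (Node c l r) = postorder l @ postorder r @ [(c, labels l, labels r)]"

fun merge_chain :: "wpartition \<Rightarrow> (color \<times> nat set \<times> nat set) list \<Rightarrow> wpartition list" where
  "merge_chain \<alpha> [] = [\<alpha>]"
| "merge_chain \<alpha> ((c, A, B) # ms) = \<alpha> # merge_chain (merge (u c) A B \<alpha>) ms"

definition tree_chain :: "nat \<Rightarrow> bctree \<Rightarrow> wpartition list" where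
  "tree_chain n t = merge_chain (wp_bot n) (postorder t)"

definition open_tree_chain :: "nat \<Rightarrow> nat \<Rightarrow> bctree \<Rightarrow> wpartition list" where
  "open_tree_chain n i t = filter (\<lambda>\<alpha>. \<alpha> \<notin> {wp_bot n, wp_top n i}) (tree_chain n t)"

section \<open>The cohomology of the maximal intervals\<close>

definition wp_cohomology ::
  "nat \<Rightarrow> nat \<Rightarrow> int \<Rightarrow> ('k::comm_ring_1, (wpartition list \<Rightarrow>\<^sub>0 'k) set) module" where
  "wp_cohomology n i r =
     interval_cohomology (wpartitions n) (wp_less n) (wp_bot n) (wp_top n i) r"

end

theory Submission
  imports Defs
begin

text \<open>
  Since the intervals \<open>[\<zero>, [n]\<^sup>i]\<close> are graded, the top cohomology is spanned by the maximal chains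
  subject to the relations given by the rank two intervals.  A maximal chain is a sequence of
  merges; commuting two disjoint merges changes its sign, so up to sign the class of a chain
  depends only on a binary tree.  Merging three blocks in a different order gives Jacobi
  relations, which rewrite a tree whose right child is not a leaf, unless its root is red and the
  right child is blue: for the color pairs (blue, blue) and (red, red) the right subtree becomes
  smaller, and (blue, red) is exchanged for (red, blue).  Hence the combs span.

  For independence, fix a word \<open>w\<close> in \<open>[n]\<close>, a linear order of the labels (the list \<open>\<pi>\<close>, its first
  element being the strongest) and a set \<open>R\<close> of \<open>i\<close> labels.  The partitions of \<open>w\<close> into segments,
  a segment \<open>B\<close> having as weight the number of elements of \<open>R\<close> in \<open>B\<close> other than its strongest
  label, form a Boolean sublattice of the interval.  Its fundamental cycle is a functional on
  cohomology which takes the value \<open>\<plusminus>1\<close> on the trees that are planar with respect to \<open>w\<close> and in which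
  a node is red iff the weaker of the leaders of its two subtrees is in \<open>R\<close>, and \<open>0\<close> on all others.
  For every comb one can choose \<open>(w, \<pi>, R)\<close> so that the matrix of these values on the combs is
  triangular with \<open>\<plusminus>1\<close> on the diagonal.
\<close>

section \<open>Trees with a prescribed leaf word\<close>

text \<open>Spanning is stated as a closure property, so that signs never have to be tracked:
  \<open>M\<close> is any submodule containing the coboundaries, and a relation says that a chain
  lies in \<open>M\<close> once all other chains through the same rank two interval do. Deleting one
  element of a maximal chain leaves a single gap, so all terms of that coboundary carry the same
  sign. For independence, a nonzero value of the cycle on a comb makes the label set of every
  subtree a segment of \<open>w\<close>. Each subtree starts with its minimum, so the word of the
  comb is \<open>w\<close> or lexicographically smaller. Hence words are compared before shapes, and
  only combs with the same word have to be told apart by \<open>\<pi>\<close> and \<open>R\<close>.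
  The chosen data may still admit several of these, so shapes need an order as well. A leader is
  exempt from the weight so that a merge raises the total by one exactly if the loser lies in
  \<open>R\<close>: weights become colors of nodes. Values are integers until the end and the
  diagonal consists of signs, so every commutative ring will do.\<close>

fun comb_shape :: "bctree \<Rightarrow> bool" where
  "comb_shape (Leaf a) \<longleftrightarrow> True"
| "comb_shape (Node c l (Leaf b)) \<longleftrightarrow> comb_shape l"
| "comb_shape (Node c l (Node c' l' r')) \<longleftrightarrow>
     comb_shape l \<and> comb_shape (Node c' l' r') \<and> c = Red \<and> c' = Blue"

fun node_colors :: "bctree \<Rightarrow> color list" where
  "node_colors (Leaf a) = []"
| "node_colors (Node c l r) = node_colors l @ c # node_colors r"

fun right_sizes :: "bctree \<Rightarrow> nat list" where
  "right_sizes (Leaf a) = []"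
| "right_sizes (Node c l r) = right_sizes l @ length (leaves r) # right_sizes r"

text \<open>Every tree is \<open>graft (Leaf a) es\<close>, where \<open>es\<close> lists the colors and right subtrees along its
  leftmost path from the bottom up.\<close>

definition graft :: "bctree \<Rightarrow> (color \<times> bctree) list \<Rightarrow> bctree" where
  "graft t es = foldl (\<lambda>l (c, r). Node c l r) t es"

lemma graft_Nil [simp]: "graft t [] = t"
  and graft_Cons: "graft t ((c, r) # es) = graft (Node c t r) es"
  and graft_append: "graft t (es @ fs) = graft (graft t es) fs"
  and graft_snoc [simp]: "graft t (es @ [(c, r)]) = Node c (graft t es) r"
  by (simp_all add: graft_def)

fun item_leaves :: "(color \<times> bctree) list \<Rightarrow> nat list" where
  "item_leaves [] = []"
| "item_leaves ((c, r) # es) = leaves r @ item_leaves es"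

fun item_colors :: "(color \<times> bctree) list \<Rightarrow> color list" where
  "item_colors [] = []"
| "item_colors ((c, r) # es) = c # node_colors r @ item_colors es"

fun item_sizes :: "(color \<times> bctree) list \<Rightarrow> nat list" where
  "item_sizes [] = []"
| "item_sizes ((c, r) # es) = length (leaves r) # right_sizes r @ item_sizes es"

lemma item_append [simp]:
  "item_leaves (es @ fs) = item_leaves es @ item_leaves fs"
  "item_colors (es @ fs) = item_colors es @ item_colors fs"
  "item_sizes (es @ fs) = item_sizes es @ item_sizes fs"
  by (induction es) auto

lemma labels_item: "(c, r) \<in> set es \<Longrightarrow> labels r \<subseteq> set (item_leaves es)"
  by (induction es) auto

lemma in_item_leaves: "y \<in> set (item_leaves es) \<Longrightarrow> \<exists>c r. (c, r) \<in> set es \<and> y \<in> labels r"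
  by (induction es rule: item_leaves.induct) fastforce+

lemma leaves_graft: "leaves (graft t es) = leaves t @ item_leaves es"
  by (induction es rule: rev_induct) auto

lemma node_colors_graft:
  "node_colors (graft t es) = node_colors t @ item_colors es"
  by (induction es rule: rev_induct) auto

lemma right_sizes_graft:
  "right_sizes (graft t es) = right_sizes t @ item_sizes es"
  by (induction es rule: rev_induct) auto

text \<open>The comb condition at a node concerns its color and its right child only, so any leaf
  can stand in for the left child.\<close>

definition item_ok :: "color \<times> bctree \<Rightarrow> bool" where
  "item_ok e \<longleftrightarrow> comb_shape (Node (fst e) (Leaf 0) (snd e))"

lemma item_ok_iff:
  "item_ok (c, r) \<longleftrightarrow> comb_shape r \<and> (\<forall>c' l' r'. r = Node c' l' r' \<longrightarrow> c = Red \<and> c' = Blue)"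
  by (cases r) (auto simp: item_ok_def)

lemma comb_shape_Node: "comb_shape (Node c l r) \<longleftrightarrow> comb_shape l \<and> item_ok (c, r)"
  by (cases r) (auto simp: item_ok_def)

lemma comb_shape_graft: "comb_shape (graft t es) \<longleftrightarrow> comb_shape t \<and> (\<forall>e\<in>set es. item_ok e)"
  by (induction es rule: rev_induct) (auto simp: comb_shape_Node)

lemma graft_Leaf_inject [simp]: "graft (Leaf a) es = graft (Leaf b) fs \<longleftrightarrow> a = b \<and> es = fs"
proof (induction es arbitrary: fs rule: rev_induct)
  case Nil
  show ?case by (cases fs rule: rev_cases) auto
next
  case (snoc e es)
  show ?case
    by (cases fs rule: rev_cases; cases e) (auto simp: snoc)
qed

lemma spine_cases:
  obtains a es where "t = graft (Leaf a) es"
proof -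
  have "\<exists>a es. t = graft (Leaf a) es"
  proof (induction t)
    case (Leaf a)
    then show ?case by (metis graft_Nil)
  next
    case (Node c l r)
    then show ?case by (metis graft_snoc)
  qed
  then show ?thesis using that by blast
qed

lemma leaves_nonempty [simp]: "leaves t \<noteq> []"
  by (induction t) auto

lemma hd_leaves_in_labels: "hd (leaves t) \<in> labels t"
  by simp

lemma length_node_colors: "Suc (length (node_colors t)) = length (leaves t)"
  by (induction t) auto

lemma length_right_sizes: "Suc (length (right_sizes t)) = length (leaves t)"
  by (induction t) auto

section \<open>Leaders of label sets and the coloring rule\<close>

definition leader :: "nat list \<Rightarrow> nat set \<Rightarrow> nat" where
  "leader \<pi> B = hd (filter (\<lambda>x. x \<in> B) \<pi>)"

definition loser :: "nat list \<Rightarrow> nat set \<Rightarrow> nat set \<Rightarrow> nat" where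
  "loser \<pi> A B = (if leader \<pi> (A \<union> B) = leader \<pi> A then leader \<pi> B else leader \<pi> A)"

lemma leader_Cons: "leader (x # \<pi>) B = (if x \<in> B then x else leader \<pi> B)"
  by (simp add: leader_def)

lemma leader_in: "B \<subseteq> set \<pi> \<Longrightarrow> B \<noteq> {} \<Longrightarrow> leader \<pi> B \<in> B"
  by (induction \<pi> arbitrary: B) (auto simp: leader_Cons subset_insert)

lemma leader_mono:
  "B \<subseteq> B' \<Longrightarrow> leader \<pi> B' \<in> B \<Longrightarrow> B \<subseteq> set \<pi> \<Longrightarrow> leader \<pi> B = leader \<pi> B'"
proof (induction \<pi> arbitrary: B B')
  case (Cons x \<pi>)
  then show ?case
    by (auto simp: leader_Cons subset_insert_iff split: if_splits)
qed (auto simp: leader_def)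

fun obeys :: "nat list \<Rightarrow> nat set \<Rightarrow> bctree \<Rightarrow> bool" where
  "obeys \<pi> R (Leaf a) \<longleftrightarrow> True"
| "obeys \<pi> R (Node c l r) \<longleftrightarrow>
     obeys \<pi> R l \<and> obeys \<pi> R r \<and> (c = Red \<longleftrightarrow> loser \<pi> (labels l) (labels r) \<in> R)"

lemma loser_in:
  assumes "A \<noteq> {}" "B \<noteq> {}" "A \<union> B \<subseteq> set \<pi>"
  shows "loser \<pi> A B \<in> A \<union> B"
  using leader_in[of A \<pi>] leader_in[of B \<pi>] assms by (auto simp: loser_def)

lemma obeys_cong:
  assumes "\<And>B. B \<subseteq> labels t \<Longrightarrow> B \<noteq> {} \<Longrightarrow> leader \<pi> B = leader \<pi>' B"
    and "\<And>z. z \<in> labels t \<Longrightarrow> z \<in> R \<longleftrightarrow> z \<in> R'" and "labels t \<subseteq> set \<pi>"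
  shows "obeys \<pi> R t \<longleftrightarrow> obeys \<pi>' R' t"
  using assms
proof (induction t)
  case (Node c l r)
  have "leader \<pi> (labels l) = leader \<pi>' (labels l)" "leader \<pi> (labels r) = leader \<pi>' (labels r)"
    "leader \<pi> (labels l \<union> labels r) = leader \<pi>' (labels l \<union> labels r)"
    using Node.prems(1) by (auto simp: Un_commute)
  then have "loser \<pi> (labels l) (labels r) = loser \<pi>' (labels l) (labels r)"
    by (simp add: loser_def)
  moreover have "loser \<pi> (labels l) (labels r) \<in> labels l \<union> labels r"
    using Node.prems(3) by (intro loser_in) auto
  moreover have "obeys \<pi> R l \<longleftrightarrow> obeys \<pi>' R' l" "obeys \<pi> R r \<longleftrightarrow> obeys \<pi>' R' r"
    using Node.prems by (intro Node.IH; simp add: le_supI1 le_supI2)+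
  ultimately show ?case using Node.prems(2) by auto
qed auto

text \<open>The overall leader lies in the bottom tree \<open>t\<close>, so it also leads every left
  subtree further up; the loser at each spine node is therefore the leader of the right subtree. The
  conditions on the items become independent of each other, and items can be regrouped
  freely.\<close>

lemma obeys_graft:
  assumes "leader \<pi> (labels (graft t es)) \<in> labels t" "labels (graft t es) \<subseteq> set \<pi>"
  shows "obeys \<pi> R (graft t es) \<longleftrightarrow>
    obeys \<pi> R t \<and> (\<forall>(c, r)\<in>set es. obeys \<pi> R r \<and> (c = Red \<longleftrightarrow> leader \<pi> (labels r) \<in> R))"
  using assms
proof (induction es rule: rev_induct)
  case (snoc e es)
  obtain c r where e: "e = (c, r)" by (cases e)
  have sub: "labels t \<subseteq> labels (graft t es)" by (auto simp: leaves_graft)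
  have *: "leader \<pi> (labels (graft t es)) = leader \<pi> (labels (graft t es) \<union> labels r)"
    using snoc.prems sub by (intro leader_mono) (auto simp: e)
  then have "loser \<pi> (labels (graft t es)) (labels r) = leader \<pi> (labels r)"
    by (simp add: loser_def)
  then show ?case
    using snoc * by (auto simp: e)
qed auto

section \<open>The order on tree shapes\<close>

definition blue_red :: "(color \<times> color) set" where
  "blue_red = {(Blue, Red)}"

text \<open>Not well-founded on its own; in \<open>comb_less\<close> the number of leaves serves as
  a bound for the sizes.\<close>

definition nat_greater :: "(nat \<times> nat) set" where
  "nat_greater = {(x, y). y < x}"

text \<open>Both lists are indexed by the gaps between consecutive leaves.  The sizes are compared from
  the right, and larger sizes come first.\<close>

definition shape_less :: "(bctree \<times> bctree) set" where
  "shape_less = {(s, t). (node_colors s, node_colors t) \<in> lex blue_red \<or>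
     node_colors s = node_colors t \<and> (rev (right_sizes s), rev (right_sizes t)) \<in> lex nat_greater}"

lemma lex_lengthD: "(xs, ys) \<in> lex r \<Longrightarrow> length xs = length ys"
  by (auto simp: lex_def dest: lexn_length)

lemma lex_append_iff:
  "length us = length us' \<Longrightarrow>
    (us @ vs, us' @ vs') \<in> lex r \<longleftrightarrow>
    (us, us') \<in> lex r \<and> length vs = length vs' \<or> us = us' \<and> (vs, vs') \<in> lex r"
  by (induction us us' rule: list_induct2) (auto dest: lex_lengthD)

text \<open>Needed when a deleted leaf is put back: it contributes the same entry at the same place
  to both lists.\<close>

lemma lex_insert:
  assumes "(us @ vs, us' @ vs') \<in> lex r" "length us = length us'"
  shows "(us @ xs @ vs, us' @ xs @ vs') \<in> lex r"
proof -
  have "length vs = length vs'" using lex_lengthD[OF assms(1)] assms(2) by auto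
  then show ?thesis
    using assms by (auto simp: lex_append_iff lex_append_iff[OF refl])
qed

lemma item_leaves_eq_Nil [simp]: "item_leaves es = [] \<longleftrightarrow> es = []"
  by (cases es rule: item_leaves.cases) auto

lemma length_item_colors: "length (item_colors es) = length (item_leaves es)"
  by (induction es) (auto simp flip: length_node_colors)

lemma length_item_sizes: "length (item_sizes es) = length (item_leaves es)"
  by (induction es) (auto simp flip: length_right_sizes)

text \<open>Two prefixes of one list are comparable, and every item has at least one leaf, so a
  longer prefix would have a longer word.\<close>

lemma item_leaves_prefix_eq:
  assumes "es @ es' = fs @ fs'" "item_leaves es = item_leaves fs"
  shows "es = fs \<and> es' = fs'"
proof -
  obtain us where us: "es = fs @ us \<or> fs = es @ us"
    using assms(1) by (auto simp: append_eq_append_conv2)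
  then have "us = []" using assms(2) by auto
  then show ?thesis using us assms(1) by auto
qed

lemma leaves_eq_singleton: "leaves s = [a] \<Longrightarrow> s = Leaf a"
  by (cases s) (auto simp: append_eq_Cons_conv)

lemma items_obey_cong:
  assumes "\<forall>(c, r)\<in>set es. \<forall>B\<subseteq>labels r. B \<noteq> {} \<longrightarrow> leader \<pi> B = leader \<pi>' B"
    and "set (item_leaves es) \<subseteq> set \<pi>"
    and "\<And>z. z \<in> set (item_leaves es) \<Longrightarrow> z \<in> R \<longleftrightarrow> z \<in> R'"
  shows "(\<forall>(c, r)\<in>set es. obeys \<pi> R r \<and> (c = Red \<longleftrightarrow> leader \<pi> (labels r) \<in> R)) \<longleftrightarrow>
    (\<forall>(c, r)\<in>set es. obeys \<pi>' R' r \<and> (c = Red \<longleftrightarrow> leader \<pi>' (labels r) \<in> R'))"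
proof (intro ball_cong refl, clarify)
  fix c r assume cr: "(c, r) \<in> set es"
  then have sub: "labels r \<subseteq> set (item_leaves es)" by (rule labels_item)
  have "obeys \<pi> R r \<longleftrightarrow> obeys \<pi>' R' r"
  proof (rule obeys_cong)
    show "leader \<pi> B = leader \<pi>' B" if "B \<subseteq> labels r" "B \<noteq> {}" for B
      using cr assms(1) that by auto
    show "z \<in> R \<longleftrightarrow> z \<in> R'" if "z \<in> labels r" for z
      using assms(3) sub that by blast
    show "labels r \<subseteq> set \<pi>" using sub assms(2) by blast
  qed
  moreover have "leader \<pi> (labels r) = leader \<pi>' (labels r)"
    using cr assms(1) by auto
  moreover have "leader \<pi> (labels r) \<in> labels r"
    using sub assms(2) by (intro leader_in) auto
  ultimately show "(obeys \<pi> R r \<and> (c = Red \<longleftrightarrow> leader \<pi> (labels r) \<in> R)) \<longleftrightarrow>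
      (obeys \<pi>' R' r \<and> (c = Red \<longleftrightarrow> leader \<pi>' (labels r) \<in> R'))"
    using sub assms(3)[of "leader \<pi>' (labels r)"] by auto
qed

text \<open>In the smaller tree \<open>x\<close> is the strongest label and hence never a loser. Its
  membership in \<open>R'\<close> is therefore free to encode the color of the node that joins
  \<open>a\<close>, where \<open>x\<close> loses against \<open>a\<close>.\<close>

lemma obeys_drop_first:
  assumes "hd \<pi> = x" "set \<pi> = set (x # item_leaves (fs @ es))"
    and "distinct (a # x # item_leaves (fs @ es))"
    and "\<And>z. z \<noteq> x \<Longrightarrow> z \<in> R' \<longleftrightarrow> z \<in> R"
  shows "obeys (a # \<pi>) R' (graft (Leaf a) ((c, graft (Leaf x) fs) # es)) \<longleftrightarrow>
    obeys \<pi> R (graft (Leaf x) (fs @ es)) \<and> (c = Red \<longleftrightarrow> x \<in> R')"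
proof -
  obtain \<pi>0 where \<pi>: "\<pi> = x # \<pi>0" using assms(1,2) by (cases \<pi>) auto
  have lead_x: "leader (a # \<pi>) (labels (graft (Leaf x) fs)) = x"
    using assms(3) by (simp add: leader_Cons \<pi> leaves_graft)
  have "obeys (a # \<pi>) R' (graft (Leaf a) ((c, graft (Leaf x) fs) # es)) \<longleftrightarrow>
      (\<forall>(c, r)\<in>set ((c, graft (Leaf x) fs) # es).
        obeys (a # \<pi>) R' r \<and> (c = Red \<longleftrightarrow> leader (a # \<pi>) (labels r) \<in> R'))"
    using assms(2) by (subst obeys_graft) (auto simp: leader_Cons leaves_graft)
  also have "\<dots> \<longleftrightarrow> obeys (a # \<pi>) R' (graft (Leaf x) fs) \<and> (c = Red \<longleftrightarrow> x \<in> R') \<and>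
      (\<forall>(c, r)\<in>set es. obeys (a # \<pi>) R' r \<and> (c = Red \<longleftrightarrow> leader (a # \<pi>) (labels r) \<in> R'))"
    by (auto simp: lead_x)
  also have "obeys (a # \<pi>) R' (graft (Leaf x) fs) \<longleftrightarrow>
      (\<forall>(c, r)\<in>set fs. obeys (a # \<pi>) R' r \<and> (c = Red \<longleftrightarrow> leader (a # \<pi>) (labels r) \<in> R'))"
  proof (subst obeys_graft)
    show "leader (a # \<pi>) (labels (graft (Leaf x) fs)) \<in> labels (Leaf x)"
      using lead_x by simp
  qed (use assms(2) in \<open>auto simp: leaves_graft\<close>)
  finally have 1: "obeys (a # \<pi>) R' (graft (Leaf a) ((c, graft (Leaf x) fs) # es)) \<longleftrightarrow>
      (\<forall>(c, r)\<in>set (fs @ es). obeys (a # \<pi>) R' r \<and>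
         (c = Red \<longleftrightarrow> leader (a # \<pi>) (labels r) \<in> R')) \<and> (c = Red \<longleftrightarrow> x \<in> R')"
    by auto
  have 2: "obeys \<pi> R (graft (Leaf x) (fs @ es)) \<longleftrightarrow>
      (\<forall>(c, r)\<in>set (fs @ es). obeys \<pi> R r \<and> (c = Red \<longleftrightarrow> leader \<pi> (labels r) \<in> R))"
    using assms(2) by (subst obeys_graft) (auto simp: \<pi> leader_Cons leaves_graft)
  have 3: "(\<forall>(c, r)\<in>set (fs @ es). obeys (a # \<pi>) R' r \<and>
         (c = Red \<longleftrightarrow> leader (a # \<pi>) (labels r) \<in> R')) \<longleftrightarrow>
      (\<forall>(c, r)\<in>set (fs @ es). obeys \<pi> R r \<and> (c = Red \<longleftrightarrow> leader \<pi> (labels r) \<in> R))"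
  proof (rule items_obey_cong)
    show "\<forall>(c, r)\<in>set (fs @ es). \<forall>B\<subseteq>labels r. B \<noteq> {} \<longrightarrow> leader (a # \<pi>) B = leader \<pi> B"
    proof (intro ballI, clarify)
      fix c r B assume cr: "(c, r) \<in> set (fs @ es)" and B: "B \<subseteq> labels r" "B \<noteq> {}"
      have "B \<subseteq> set (item_leaves (fs @ es))" using B(1) labels_item[OF cr] by blast
      then show "leader (a # \<pi>) B = leader \<pi> B" using assms(3) by (auto simp: leader_Cons)
    qed
    show "z \<in> R' \<longleftrightarrow> z \<in> R" if "z \<in> set (item_leaves (fs @ es))" for z
      using that assms(3,4) by (metis distinct.simps(2))
  qed (use assms(2) in auto)
  show ?thesis unfolding 1 2 3 ..
qed

text \<open>Ahead of \<open>x\<close> in the order, \<open>y\<close> leads the whole right subtree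
  next to \<open>a\<close> and, being in the label set, makes the node at \<open>a\<close> red.
  Where \<open>y\<close> joins, \<open>x\<close> loses, and as \<open>x \<notin> R\<close> that node
  is blue. At all other nodes the loser is the leader of the right subtree, before and after the
  deletion.\<close>

lemma obeys_drop_pair:
  assumes "hd \<pi> = x" "set \<pi> = set (x # item_leaves (fs @ gs @ es))"
    and "distinct (a # x # item_leaves fs @ y # item_leaves (gs @ es))" and "x \<notin> R"
  shows "obeys (a # y # \<pi>) (insert y R)
      (graft (Leaf a) ((Red, graft (Leaf x) (fs @ (Blue, Leaf y) # gs)) # es)) \<longleftrightarrow>
    obeys \<pi> R (graft (Leaf x) (fs @ gs @ es))"
proof -
  obtain \<pi>0 where \<pi>: "\<pi> = x # \<pi>0" using assms(1,2) by (cases \<pi>) auto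
  let ?\<pi> = "a # y # \<pi>" and ?R = "insert y R"
  let ?r = "graft (Leaf x) (fs @ (Blue, Leaf y) # gs)"
  let ?all = "\<lambda>\<pi> R es. \<forall>(c, r)\<in>set es. obeys \<pi> R r \<and> (c = Red \<longleftrightarrow> leader \<pi> (labels r) \<in> R)"
  have ne: "a \<noteq> x" "a \<noteq> y" "x \<noteq> y" "y \<notin> set (item_leaves fs)" "a \<notin> set (item_leaves fs)"
    "a \<notin> set (item_leaves gs)"
    using assms(3) by auto
  have lead_y: "leader ?\<pi> (labels ?r) = y"
    using ne by (simp add: leader_Cons leaves_graft)
  have lead_x: "leader ?\<pi> (labels (graft (Leaf x) fs)) = x"
    using ne by (simp add: leader_Cons \<pi> leaves_graft)
  have r: "?r = graft (Node Blue (graft (Leaf x) fs) (Leaf y)) gs"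
    by (simp add: graft_append graft_Cons)
  have "obeys ?\<pi> ?R (graft (Leaf a) ((Red, ?r) # es)) \<longleftrightarrow> ?all ?\<pi> ?R ((Red, ?r) # es)"
    using assms(2) by (subst obeys_graft) (auto simp: leader_Cons leaves_graft)
  also have "\<dots> \<longleftrightarrow> obeys ?\<pi> ?R ?r \<and> ?all ?\<pi> ?R es"
    by (simp add: lead_y)
  also have "obeys ?\<pi> ?R ?r \<longleftrightarrow> obeys ?\<pi> ?R (Node Blue (graft (Leaf x) fs) (Leaf y)) \<and> ?all ?\<pi> ?R gs"
    unfolding r
  proof (rule obeys_graft)
    show "leader ?\<pi> (labels (graft (Node Blue (graft (Leaf x) fs) (Leaf y)) gs))
        \<in> labels (Node Blue (graft (Leaf x) fs) (Leaf y))"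
      using lead_y unfolding r by simp
  qed (use assms(2) in \<open>auto simp: leaves_graft\<close>)
  also have "obeys ?\<pi> ?R (Node Blue (graft (Leaf x) fs) (Leaf y)) \<longleftrightarrow>
      obeys ?\<pi> ?R (graft (Leaf x) fs)"
  proof -
    have "loser ?\<pi> (labels (graft (Leaf x) fs)) {y} = x"
      using ne lead_x by (simp add: loser_def) (simp add: leader_Cons leaves_graft)
    then show ?thesis using ne assms(4) by simp
  qed
  also have "obeys ?\<pi> ?R (graft (Leaf x) fs) \<longleftrightarrow> ?all ?\<pi> ?R fs"
  proof (subst obeys_graft)
    show "leader ?\<pi> (labels (graft (Leaf x) fs)) \<in> labels (Leaf x)"
      using lead_x by simp
  qed (use assms(2) in \<open>auto simp: leaves_graft\<close>)
  finally have 1: "obeys ?\<pi> ?R (graft (Leaf a) ((Red, ?r) # es)) \<longleftrightarrow> ?all ?\<pi> ?R (fs @ gs @ es)"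
    by auto
  have 2: "obeys \<pi> R (graft (Leaf x) (fs @ gs @ es)) \<longleftrightarrow> ?all \<pi> R (fs @ gs @ es)"
    using assms(2) by (subst obeys_graft) (auto simp: \<pi> leader_Cons leaves_graft)
  have 3: "?all ?\<pi> ?R (fs @ gs @ es) \<longleftrightarrow> ?all \<pi> R (fs @ gs @ es)"
  proof (rule items_obey_cong)
    show "\<forall>(c, r)\<in>set (fs @ gs @ es). \<forall>B\<subseteq>labels r. B \<noteq> {} \<longrightarrow> leader ?\<pi> B = leader \<pi> B"
    proof (intro ballI, clarify)
      fix c r B assume cr: "(c, r) \<in> set (fs @ gs @ es)" and B: "B \<subseteq> labels r" "B \<noteq> {}"
      have "B \<subseteq> set (item_leaves (fs @ gs @ es))" using B(1) labels_item[OF cr] by blast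
      then show "leader ?\<pi> B = leader \<pi> B" using assms(3) by (auto simp: leader_Cons)
    qed
    show "z \<in> ?R \<longleftrightarrow> z \<in> R" if "z \<in> set (item_leaves (fs @ gs @ es))" for z
      using that assms(3) by auto
  qed (use assms(2) in auto)
  show ?thesis unfolding 1 2 3 ..
qed

text \<open>Induction on the number of leaves.  Let \<open>a, x, \<dots>\<close> be the leaf word and let \<open>r\<close> be the right
  subtree next to \<open>a\<close>.  If \<open>r\<close> is the leaf \<open>x\<close>, delete \<open>a\<close> and put it at the front of \<open>\<pi>\<close>.  Otherwise
  the root of \<open>r\<close> is blue and its right child is a leaf \<open>y\<close>; delete \<open>a\<close> and \<open>y\<close>, put \<open>a\<close> and \<open>y\<close> at the
  front of \<open>\<pi>\<close>, put \<open>y\<close> in \<open>R\<close> and keep \<open>x\<close> out of it.  The two labels record that \<open>r\<close> extends at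
  least up to \<open>y\<close>.\<close>

lemma exists_separating:
  assumes "comb_shape t" "distinct (leaves t)"
  shows "\<exists>\<pi> R. set \<pi> = labels t \<and> hd \<pi> = hd (leaves t) \<and> R \<subseteq> labels t - {hd (leaves t)} \<and>
    obeys \<pi> R t \<and>
    (\<forall>s. comb_shape s \<longrightarrow> leaves s = leaves t \<longrightarrow> obeys \<pi> R s \<longrightarrow> s = t \<or> (s, t) \<in> shape_less)"
  using assms
proof (induction "length (leaves t)" arbitrary: t rule: less_induct)
  case less
  obtain a es where t: "t = graft (Leaf a) es" by (rule spine_cases)
  show ?case
  proof (cases es)
    case Nil
    then show ?thesis
      by (intro exI[of _ "[a]"] exI[of _ "{}"]) (auto simp: t dest: leaves_eq_singleton)
  next
    case (Cons e es1)
    obtain c r where e: "e = (c, r)" by (cases e)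
    obtain x f where r: "r = graft (Leaf x) f" by (rule spine_cases)
    have t': "t = graft (Leaf a) ((c, graft (Leaf x) f) # es1)"
      by (simp add: t Cons e r)
    have lt: "leaves t = a # x # item_leaves (f @ es1)"
      by (simp add: t' leaves_graft)
    have dist: "distinct (a # x # item_leaves (f @ es1))"
      using less.prems(2) lt by simp
    have ok: "item_ok (c, graft (Leaf x) f)" "\<forall>e\<in>set f. item_ok e" "\<forall>e\<in>set es1. item_ok e"
      using less.prems(1) by (auto simp: t' comb_shape_graft item_ok_iff)
    have s_form: "\<exists>c' f' es'. s = graft (Leaf a) ((c', graft (Leaf x) f') # es') \<and>
        item_leaves (f' @ es') = item_leaves (f @ es1) \<and> item_ok (c', graft (Leaf x) f') \<and>
        (\<forall>e\<in>set (f' @ es'). item_ok e)"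
      if s: "comb_shape s" "leaves s = leaves t" for s
    proof -
      obtain a' fs where s1: "s = graft (Leaf a') fs" by (rule spine_cases)
      with s(2) lt have fs: "a' = a" "item_leaves fs = x # item_leaves (f @ es1)"
        by (auto simp: leaves_graft)
      then obtain c' r' es' where fs': "fs = (c', r') # es'" by (cases fs) auto
      obtain x' f' where r': "r' = graft (Leaf x') f'" by (rule spine_cases)
      have "x' = x" "item_leaves (f' @ es') = item_leaves (f @ es1)"
        using fs(2) by (auto simp: fs' r' leaves_graft)
      moreover have "item_ok (c', r')" "\<forall>e\<in>set (f' @ es'). item_ok e"
        using s(1) by (auto simp: s1 fs' r' comb_shape_graft item_ok_iff)
      ultimately show ?thesis using s1 fs(1) fs' r' by blast
    qed
    show ?thesis
    proof (cases f rule: rev_cases)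
      case Nil
      let ?t2 = "graft (Leaf x) es1"
      have lt2: "leaves ?t2 = x # item_leaves es1" by (simp add: leaves_graft)
      have "length (leaves ?t2) < length (leaves t)" by (simp add: lt lt2 Nil)
      moreover have "comb_shape ?t2" using ok(3) by (simp add: comb_shape_graft)
      moreover have "distinct (leaves ?t2)" using dist by (simp add: lt2 Nil)
      ultimately obtain \<pi> R where \<pi>: "set \<pi> = labels ?t2" "hd \<pi> = x" "R \<subseteq> labels ?t2 - {x}"
        "obeys \<pi> R ?t2"
        and sep: "\<And>s. comb_shape s \<Longrightarrow> leaves s = leaves ?t2 \<Longrightarrow> obeys \<pi> R s \<Longrightarrow>
          s = ?t2 \<or> (s, ?t2) \<in> shape_less"
        using less.hyps[of ?t2] unfolding lt2 list.sel by blast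
      define R' where "R' = R \<union> (if c = Red then {x} else {})"
      have xR': "x \<in> R' \<longleftrightarrow> c = Red" using \<pi>(3) by (auto simp: R'_def)
      have drop: "obeys (a # \<pi>) R' (graft (Leaf a) ((c', graft (Leaf x) f') # es')) \<longleftrightarrow>
          obeys \<pi> R (graft (Leaf x) (f' @ es')) \<and> c' = c"
        if "item_leaves (f' @ es') = item_leaves es1" for c' f' es'
      proof -
        have "obeys (a # \<pi>) R' (graft (Leaf a) ((c', graft (Leaf x) f') # es')) \<longleftrightarrow>
          obeys \<pi> R (graft (Leaf x) (f' @ es')) \<and> (c' = Red \<longleftrightarrow> x \<in> R')"
        proof (rule obeys_drop_first)
          show "set \<pi> = set (x # item_leaves (f' @ es'))"
            unfolding that using \<pi>(1) lt2 by simp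
          show "distinct (a # x # item_leaves (f' @ es'))"
            unfolding that using dist by (simp add: Nil)
        qed (auto simp: \<pi>(2) R'_def)
        moreover have "(c' = Red \<longleftrightarrow> x \<in> R') \<longleftrightarrow> c' = c"
          unfolding xR' by (cases c; cases c') auto
        ultimately show ?thesis by simp
      qed
      show ?thesis
      proof (intro exI[of _ "a # \<pi>"] exI[of _ R'] conjI allI impI)
        show "set (a # \<pi>) = labels t" using \<pi>(1) lt2 by (simp add: lt Nil)
        show "hd (a # \<pi>) = hd (leaves t)" by (simp add: lt)
        show "R' \<subseteq> labels t - {hd (leaves t)}"
          using \<pi>(3) lt2 dist by (auto simp: R'_def lt Nil)
        show "obeys (a # \<pi>) R' t" using drop[of "[]" es1 c] \<pi>(4) by (simp add: t' Nil)
      next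
        fix s assume s: "comb_shape s" "leaves s = leaves t" "obeys (a # \<pi>) R' s"
        obtain c' f' es' where s': "s = graft (Leaf a) ((c', graft (Leaf x) f') # es')"
          "item_leaves (f' @ es') = item_leaves (f @ es1)" "item_ok (c', graft (Leaf x) f')"
          "\<forall>e\<in>set (f' @ es'). item_ok e"
          using s_form[OF s(1,2)] by blast
        let ?s2 = "graft (Leaf x) (f' @ es')"
        have le: "item_leaves (f' @ es') = item_leaves es1" using s'(2) Nil by simp
        have c': "c' = c" and ob: "obeys \<pi> R ?s2"
          using drop[OF le] s(3) by (auto simp: s'(1))
        have "?s2 = ?t2 \<or> (?s2, ?t2) \<in> shape_less"
        proof (rule sep)
          show "comb_shape ?s2" using s'(4) by (simp add: comb_shape_graft)
          show "leaves ?s2 = leaves ?t2" using le by (simp add: leaves_graft)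
        qed (rule ob)
        then show "s = t \<or> (s, t) \<in> shape_less"
        proof
          assume "?s2 = ?t2"
          then have eq: "f' @ es' = es1" by simp
          show ?thesis
          proof (cases f')
            case Nil
            then show ?thesis using eq by (simp add: s'(1) t' \<open>f = []\<close> c')
          next
            case Cons
            then have "item_leaves f' \<noteq> []" by simp
            \<comment> \<open>The other items agree, but in \<open>s\<close> the right subtree next
              to \<open>a\<close> has swallowed the items of \<open>f'\<close>. It is larger, so
              \<open>s\<close> comes first.\<close>
            then have "(rev (right_sizes s), rev (right_sizes t)) \<in> lex nat_greater"
              by (simp add: s'(1) t' right_sizes_graft leaves_graft \<open>f = []\<close> flip: eq)
                (simp add: lex_append_iff nat_greater_def)
            moreover have "node_colors s = node_colors t"
              by (simp add: s'(1) t' node_colors_graft c' \<open>f = []\<close> flip: eq)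
            ultimately show ?thesis by (simp add: shape_less_def)
          qed
        next
          assume less: "(?s2, ?t2) \<in> shape_less"
          have "length (rev (right_sizes ?s2)) = length (rev (right_sizes ?t2))"
            using le by (simp add: right_sizes_graft length_item_sizes flip: item_append)
          \<comment> \<open>The node at \<open>a\<close> puts the same color in front of both color
            lists. Its size stands last in the reversed lists, where it cannot override a difference
            found in the smaller trees; this is why sizes are read from the right.\<close>
          then have "(s, t) \<in> shape_less"
            using less by (auto simp: shape_less_def s'(1) t' \<open>f = []\<close> c' node_colors_graft
                right_sizes_graft lex_append_iff simp flip: append_assoc)
          then show ?thesis ..
        qed
      qed
    next
      case (snoc f0 e')
      obtain d q where e': "e' = (d, q)" by (cases e')
      have "c = Red" "d = Blue" using ok(1) by (auto simp: snoc e' item_ok_iff)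
      moreover have "item_ok (d, q)" using ok(2) by (auto simp: snoc e')
      ultimately obtain y where q: "q = Leaf y" by (cases q) (auto simp: item_ok_iff)
      have f: "f = f0 @ [(Blue, Leaf y)]" by (simp add: snoc e' q \<open>d = Blue\<close>)
      let ?t3 = "graft (Leaf x) (f0 @ es1)"
      have lt3: "leaves ?t3 = x # item_leaves (f0 @ es1)" by (simp add: leaves_graft)
      have "length (leaves ?t3) < length (leaves t)" by (simp add: lt lt3 f)
      moreover have "comb_shape ?t3" using ok(2,3) by (auto simp: comb_shape_graft f)
      moreover have "distinct (leaves ?t3)" using dist by (auto simp: lt3 f)
      ultimately obtain \<pi> R where \<pi>: "set \<pi> = labels ?t3" "hd \<pi> = x" "R \<subseteq> labels ?t3 - {x}"
        "obeys \<pi> R ?t3"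
        and sep: "\<And>s. comb_shape s \<Longrightarrow> leaves s = leaves ?t3 \<Longrightarrow> obeys \<pi> R s \<Longrightarrow>
          s = ?t3 \<or> (s, ?t3) \<in> shape_less"
        using less.hyps[of ?t3] unfolding lt3 list.sel by blast
      have xR: "x \<notin> R" using \<pi>(3) by auto
      let ?\<pi> = "a # y # \<pi>" and ?R = "insert y R"
      have drop: "obeys ?\<pi> ?R (graft (Leaf a)
            ((Red, graft (Leaf x) (fs @ (Blue, Leaf y) # gs)) # es')) \<longleftrightarrow>
          obeys \<pi> R (graft (Leaf x) (fs @ gs @ es'))"
        if "item_leaves fs = item_leaves f0" "item_leaves (gs @ es') = item_leaves es1"
        for fs gs es'
      proof (rule obeys_drop_pair)
        show "set \<pi> = set (x # item_leaves (fs @ gs @ es'))"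
          using \<pi>(1) lt3 that by simp
        show "distinct (a # x # item_leaves fs @ y # item_leaves (gs @ es'))"
          unfolding that using dist by (simp add: f)
      qed (auto simp: \<pi>(2) xR)
      show ?thesis
      proof (intro exI[of _ ?\<pi>] exI[of _ ?R] conjI allI impI)
        show "set ?\<pi> = labels t" using \<pi>(1) lt3 by (auto simp: lt f)
        show "hd ?\<pi> = hd (leaves t)" by (simp add: lt)
        show "?R \<subseteq> labels t - {hd (leaves t)}"
          using \<pi>(3) lt3 dist by (auto simp: lt f)
        show "obeys ?\<pi> ?R t"
          using drop[of f0 "[]" es1] \<pi>(4) by (simp add: t' f \<open>c = Red\<close>)
      next
        fix s assume s: "comb_shape s" "leaves s = leaves t" "obeys ?\<pi> ?R s"
        obtain c' f' es' where s': "s = graft (Leaf a) ((c', graft (Leaf x) f') # es')"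
          "item_leaves (f' @ es') = item_leaves (f @ es1)" "item_ok (c', graft (Leaf x) f')"
          "\<forall>e\<in>set (f' @ es'). item_ok e"
          using s_form[OF s(1,2)] by blast
        have ne: "a \<noteq> x" "a \<noteq> y" "x \<noteq> y" using dist by (auto simp: f)
        have sub: "labels s \<subseteq> set ?\<pi>" using \<pi>(1) lt3 s(2) by (auto simp: lt f)
        show "s = t \<or> (s, t) \<in> shape_less"
        proof (cases c')
          case Blue
          \<comment> \<open>The color of the node at \<open>a\<close> is the first entry, and it is
            red in \<open>t\<close>. Such competitors are not excluded, only placed before
            \<open>t\<close>.\<close>
          then have "(node_colors s, node_colors t) \<in> lex blue_red"
            using s(2) length_node_colors[of s] length_node_colors[of t]
            by (auto simp: s'(1) t' \<open>c = Red\<close> node_colors_graft blue_red_def)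
          then show ?thesis by (simp add: shape_less_def)
        next
          case Red
          have a_notin: "a \<notin> labels (graft (Leaf x) f')"
            using dist unfolding s'(2)[symmetric] by (simp add: leaves_graft)
          obtain \<pi>0 where \<pi>0: "\<pi> = x # \<pi>0" using \<pi>(1,2) lt3 by (cases \<pi>) auto
          have "obeys ?\<pi> ?R (graft (Leaf x) f') \<and> leader ?\<pi> (labels (graft (Leaf x) f')) \<in> ?R"
            using s(3) sub unfolding s'(1)
            by (subst (asm) obeys_graft) (auto simp: leader_Cons leaves_graft Red)
          then have ob: "obeys ?\<pi> ?R (graft (Leaf x) f')"
            and lead: "leader ?\<pi> (labels (graft (Leaf x) f')) \<in> ?R" by auto
          \<comment> \<open>Otherwise \<open>x\<close> would lead this subtree and the node at
            \<open>a\<close> would be blue, since \<open>x \<notin> R\<close>.\<close>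
          have "y \<in> labels (graft (Leaf x) f')"
          proof (rule ccontr)
            assume "y \<notin> labels (graft (Leaf x) f')"
            then have "leader ?\<pi> (labels (graft (Leaf x) f')) = x"
              using a_notin by (simp add: leader_Cons \<pi>0 leaves_graft)
            then show False using lead ne xR by simp
          qed
          then have "y \<in> set (item_leaves f')" using ne by (simp add: leaves_graft)
          then obtain cy ry where ry: "(cy, ry) \<in> set f'" "y \<in> labels ry"
            using in_item_leaves by blast
          then obtain f1 f2 where f': "f' = f1 @ (cy, ry) # f2" by (meson split_list)
          have dist': "distinct (a # x # item_leaves (f' @ es'))"
            unfolding s'(2) by (rule dist)
          have y_f1: "y \<notin> set (item_leaves f1)" using dist' ry(2) by (auto simp: f')
          have sub': "labels (graft (Leaf x) f') \<subseteq> set ?\<pi>"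
            using sub by (auto simp: s'(1) leaves_graft)
          have split: "graft (Leaf x) f' = graft (Node cy (graft (Leaf x) f1) ry) f2"
            by (simp add: f' graft_append graft_Cons)
          have "leader ?\<pi> (labels (graft (Leaf x) f')) = y"
            using a_notin \<open>y \<in> labels (graft (Leaf x) f')\<close> by (simp add: leader_Cons)
          then have "obeys ?\<pi> ?R (Node cy (graft (Leaf x) f1) ry)"
            using ob sub' ry(2) unfolding split by (subst (asm) obeys_graft) auto
          then have cy: "cy = Red \<longleftrightarrow> loser ?\<pi> (labels (graft (Leaf x) f1)) (labels ry) \<in> ?R"
            by simp
          have "leader ?\<pi> (labels (graft (Leaf x) f1)) = x"
            using y_f1 a_notin ne by (simp add: leader_Cons \<pi>0 leaves_graft f')
          moreover have "leader ?\<pi> (labels (graft (Leaf x) f1) \<union> labels ry) = y"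
            using ry(2) a_notin by (simp add: leader_Cons leaves_graft f')
          \<comment> \<open>Where \<open>y\<close> joins, \<open>x\<close> loses, so the node is
            blue, and below a blue node the comb condition admits only a leaf on the right. Thus
            \<open>y\<close> sits in \<open>s\<close> as it does in \<open>t\<close> and can be
            deleted from both.\<close>
          ultimately have "loser ?\<pi> (labels (graft (Leaf x) f1)) (labels ry) = x"
            using ne by (simp add: loser_def)
          then have cy': "cy = Blue" using cy ne xR by (cases cy) auto
          moreover have "item_ok (cy, ry)" using s'(4) by (auto simp: f')
          ultimately have ry': "ry = Leaf y" using ry(2) by (cases ry) (auto simp: item_ok_iff)
          have "item_leaves f1 @ y # item_leaves (f2 @ es') = item_leaves f0 @ y # item_leaves es1"
            using s'(2) by (simp add: f' f ry')
          moreover have "y \<notin> set (item_leaves f0)" "y \<notin> set (item_leaves es1)"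
            using dist by (auto simp: f)
          ultimately have w: "item_leaves f1 = item_leaves f0"
            "item_leaves (f2 @ es') = item_leaves es1"
            using append_Cons_eq_iff[of y "item_leaves f0" "item_leaves es1"] by metis+
          let ?s3 = "graft (Leaf x) (f1 @ f2 @ es')"
          have ob3: "obeys \<pi> R ?s3"
            using s(3) drop[OF w] by (simp add: s'(1) f' cy' ry' Red)
          have "?s3 = ?t3 \<or> (?s3, ?t3) \<in> shape_less"
          proof (rule sep)
            show "comb_shape ?s3" using s'(4) by (auto simp: comb_shape_graft f')
            show "leaves ?s3 = leaves ?t3" using w by (simp add: leaves_graft)
          qed (rule ob3)
          then show ?thesis
          proof
            assume "?s3 = ?t3"
            then have "f1 @ f2 @ es' = f0 @ es1" by simp
            with w(1) have eq: "f1 = f0" "f2 @ es' = es1"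
              using item_leaves_prefix_eq by blast+
            show ?thesis
            proof (cases f2)
              case Nil
              then show ?thesis using eq by (simp add: s'(1) t' f f' cy' ry' Red \<open>c = Red\<close>)
            next
              case Cons
              then have "item_leaves f2 \<noteq> []" by simp
              then have "(rev (right_sizes s), rev (right_sizes t)) \<in> lex nat_greater"
                by (simp add: s'(1) t' right_sizes_graft leaves_graft f f' ry' eq(1) flip: eq(2))
                  (simp add: lex_append_iff nat_greater_def)
              moreover have "node_colors s = node_colors t"
                by (simp add: s'(1) t' node_colors_graft Red \<open>c = Red\<close> f f' cy' ry' eq(1)
                    flip: eq(2))
              ultimately show ?thesis by (simp add: shape_less_def)
            qed
          next
            assume less: "(?s3, ?t3) \<in> shape_less"
            have cs: "node_colors s = Red # item_colors f1 @ [Blue] @ item_colors (f2 @ es')"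
              "node_colors t = Red # item_colors f0 @ [Blue] @ item_colors es1"
              by (simp_all add: s'(1) t' node_colors_graft Red \<open>c = Red\<close> f f' cy' ry')
            have ss: "rev (right_sizes s) =
                (rev (item_sizes (f2 @ es')) @ [1] @ rev (item_sizes f1)) @
                [length (leaves (graft (Leaf x) f'))]"
              "rev (right_sizes t) = (rev (item_sizes es1) @ [1] @ rev (item_sizes f0)) @
                [length (leaves (graft (Leaf x) f))]"
              by (simp_all add: s'(1) t' right_sizes_graft leaves_graft f f' ry')
            have len: "length (item_colors f1) = length (item_colors f0)"
              "length (rev (item_sizes (f2 @ es'))) = length (rev (item_sizes es1))"
              "length (item_sizes f1) = length (item_sizes f0)"
              using w by (simp_all add: length_item_colors length_item_sizes flip: item_append)
            from less consider "(node_colors ?s3, node_colors ?t3) \<in> lex blue_red"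
              | "node_colors ?s3 = node_colors ?t3"
                "(rev (right_sizes ?s3), rev (right_sizes ?t3)) \<in> lex nat_greater"
              by (auto simp: shape_less_def)
            then show ?thesis
            proof cases
              case 1
              then have "(item_colors f1 @ item_colors (f2 @ es'), item_colors f0 @ item_colors es1)
                  \<in> lex blue_red"
                by (simp add: node_colors_graft)
              then have "(item_colors f1 @ [Blue] @ item_colors (f2 @ es'),
                  item_colors f0 @ [Blue] @ item_colors es1) \<in> lex blue_red"
                using len(1) by (rule lex_insert)
              then show ?thesis by (simp add: shape_less_def cs)
            next
              case 2
              have "item_colors f1 @ item_colors (f2 @ es') = item_colors f0 @ item_colors es1"
                using 2(1) by (simp add: node_colors_graft)
              then have "node_colors s = node_colors t"
                using len(1) by (simp add: cs)
              moreover have "(rev (item_sizes (f2 @ es')) @ rev (item_sizes f1),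
                  rev (item_sizes es1) @ rev (item_sizes f0)) \<in> lex nat_greater"
                using 2(2) by (simp add: right_sizes_graft)
              then have "(rev (item_sizes (f2 @ es')) @ [1] @ rev (item_sizes f1),
                  rev (item_sizes es1) @ [1] @ rev (item_sizes f0)) \<in> lex nat_greater"
                using len(2) by (rule lex_insert)
              then have "(rev (right_sizes s), rev (right_sizes t)) \<in> lex nat_greater"
                unfolding ss using len by (subst lex_append_iff) simp_all
              ultimately show ?thesis by (simp add: shape_less_def)
            qed
          qed
        qed
      qed
    qed
  qed
qed

section \<open>The order on weighted partitions\<close>

definition blocks :: "wpartition \<Rightarrow> nat set set" where
  "blocks \<alpha> = fst ` \<alpha>"

lemma blocksI: "(A, w) \<in> \<alpha> \<Longrightarrow> A \<in> blocks \<alpha>"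
  by (force simp: blocks_def)

definition subblocks :: "wpartition \<Rightarrow> nat set \<Rightarrow> nat set set" where
  "subblocks \<alpha> B = {A \<in> blocks \<alpha>. A \<subseteq> B}"

lemma weight_eq: "inj_on fst \<alpha> \<Longrightarrow> (A, w) \<in> \<alpha> \<Longrightarrow> weight \<alpha> A = w"
  unfolding weight_def by (rule the_equality) (metis Pair_inject fst_conv inj_onD)+

lemma mem_wpartition_iff: "inj_on fst \<alpha> \<Longrightarrow> (A, w) \<in> \<alpha> \<longleftrightarrow> A \<in> blocks \<alpha> \<and> w = weight \<alpha> A"
proof safe
  assume inj: "inj_on fst \<alpha>" and "A \<in> blocks \<alpha>"
  then obtain w' where w': "(A, w') \<in> \<alpha>" by (auto simp: blocks_def)
  then show "(A, weight \<alpha> A) \<in> \<alpha>" using weight_eq[OF inj w'] by simp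
qed (simp_all add: weight_eq blocksI)

lemma wpartition_eqI:
  assumes "inj_on fst \<alpha>" "inj_on fst \<beta>" "blocks \<alpha> = blocks \<beta>"
    and "\<And>A. A \<in> blocks \<beta> \<Longrightarrow> weight \<alpha> A = weight \<beta> A"
  shows "\<alpha> = \<beta>"
  using assms by (auto simp: mem_wpartition_iff)

lemma wpartitionsD:
  assumes "\<alpha> \<in> wpartitions n"
  shows "partition_on {1..n} (blocks \<alpha>)" "inj_on fst \<alpha>" "finite \<alpha>"
    "\<And>A. A \<in> blocks \<alpha> \<Longrightarrow> finite A" "\<And>A. A \<in> blocks \<alpha> \<Longrightarrow> A \<noteq> {}"
proof -
  show part: "partition_on {1..n} (blocks \<alpha>)" and inj: "inj_on fst \<alpha>"
    using assms by (auto simp: wpartitions_def blocks_def)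
  have "finite (blocks \<alpha>)" using part by (rule finite_elements[rotated]) simp
  then show "finite \<alpha>" unfolding blocks_def using inj by (rule finite_imageD)
  show "finite A" if "A \<in> blocks \<alpha>" for A
    using Union_upper[OF that] partition_onD1[OF part] by (metis finite_atLeastAtMost finite_subset)
  show "A \<noteq> {}" if "A \<in> blocks \<alpha>" for A
    using that part by (metis partition_onD3)
qed

lemma card_blocks: "\<alpha> \<in> wpartitions n \<Longrightarrow> card (blocks \<alpha>) = card \<alpha>"
  unfolding blocks_def by (rule card_image) (rule wpartitionsD)

lemma wpartitionsI:
  assumes "partition_on {1..n} (blocks \<alpha>)" "inj_on fst \<alpha>"
    and "\<And>A. A \<in> blocks \<alpha> \<Longrightarrow> weight \<alpha> A < card A"
  shows "\<alpha> \<in> wpartitions n"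
proof -
  have "v \<le> card B - 1" if "(B, v) \<in> \<alpha>" for B v
    using assms(3)[OF blocksI[OF that]] weight_eq[OF assms(2) that] by simp
  then show ?thesis using assms(1,2) by (auto simp: wpartitions_def blocks_def)
qed

lemma weight_less:
  assumes "\<alpha> \<in> wpartitions n" "A \<in> blocks \<alpha>"
  shows "weight \<alpha> A < card A"
proof -
  have "(A, weight \<alpha> A) \<in> \<alpha>" using assms wpartitionsD(2) by (simp add: mem_wpartition_iff)
  then have "weight \<alpha> A \<le> card A - 1" using assms(1) by (auto simp: wpartitions_def)
  moreover have "card A > 0"
    using wpartitionsD(4,5)[OF assms] by (simp add: card_gt_0_iff)
  ultimately show ?thesis by simp
qed

text \<open>Separates the refinement of the underlying partitions from the arithmetic of weights,
  which takes place in the natural numbers without subtraction.\<close>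

lemma wp_le_iff:
  assumes "\<alpha> \<in> wpartitions n" "\<beta> \<in> wpartitions n"
  shows "wp_le n \<alpha> \<beta> \<longleftrightarrow> refines {1..n} (blocks \<alpha>) (blocks \<beta>) \<and>
    (\<forall>B\<in>blocks \<beta>. (\<Sum>A\<in>subblocks \<alpha> B. weight \<alpha> A) \<le> weight \<beta> B \<and>
      weight \<beta> B < (\<Sum>A\<in>subblocks \<alpha> B. weight \<alpha> A) + card (subblocks \<alpha> B))"
proof -
  have inj: "inj_on fst \<alpha>" "inj_on fst \<beta>" using assms wpartitionsD(2) by auto
  have L: "{(A, w)\<in>\<alpha>. A \<subseteq> B} = (\<lambda>A. (A, weight \<alpha> A)) ` subblocks \<alpha> B" for B
    using inj(1) by (auto simp: subblocks_def mem_wpartition_iff image_iff)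
  have inj': "inj_on (\<lambda>A. (A, weight \<alpha> A)) S" for S by (auto intro: inj_onI)
  have s: "(\<Sum>(A, w)\<in>{(A, w)\<in>\<alpha>. A \<subseteq> B}. int w) = int (\<Sum>A\<in>subblocks \<alpha> B. weight \<alpha> A)"
    "card {(A, w)\<in>\<alpha>. A \<subseteq> B} = card (subblocks \<alpha> B)" for B
    unfolding L by (simp_all add: sum.reindex[OF inj'] card_image[OF inj'])
  have b: "(\<forall>(B, v)\<in>\<beta>. Q B v) \<longleftrightarrow> (\<forall>B\<in>blocks \<beta>. Q B (weight \<beta> B))" for Q
    using inj(2) by (auto simp: mem_wpartition_iff)
  show ?thesis
    unfolding wp_le_def Let_def s b blocks_def[symmetric] by (auto simp del: of_nat_sum)
qed

lemma partition_on_subblocks: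
  "refines {1..n} (blocks \<alpha>) (blocks \<beta>) \<Longrightarrow> B \<in> blocks \<beta> \<Longrightarrow> partition_on B (subblocks \<alpha> B)"
  unfolding subblocks_def by (rule refines_obtains_subset)

lemma subblocks_disjoint:
  assumes "refines {1..n} (blocks \<alpha>) (blocks \<beta>)" "B \<in> blocks \<beta>" "C \<in> blocks \<beta>" "B \<noteq> C"
  shows "subblocks \<alpha> B \<inter> subblocks \<alpha> C = {}"
proof -
  have "B \<inter> C = {}" using assms by (auto simp: refines_def partition_on_def disjoint_def)
  moreover have "{} \<notin> blocks \<alpha>" using assms(1) by (auto simp: refines_def partition_on_def)
  ultimately show ?thesis
    unfolding subblocks_def by (metis (mono_tags, lifting) Int_emptyI Int_greatest mem_Collect_eq subset_empty)
qed

lemma subblocks_nonempty: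
  assumes "refines {1..n} (blocks \<alpha>) (blocks \<beta>)" "B \<in> blocks \<beta>"
  shows "subblocks \<alpha> B \<noteq> {}"
proof
  assume e: "subblocks \<alpha> B = {}"
  have "partition_on B (subblocks \<alpha> B)" by (rule partition_on_subblocks[OF assms])
  then have "B = {}" by (simp add: e partition_on_def)
  then show False using assms by (auto simp: refines_def partition_on_def)
qed

lemma finite_subblocks: "\<alpha> \<in> wpartitions n \<Longrightarrow> finite (subblocks \<alpha> B)"
  using wpartitionsD(3) by (auto simp: subblocks_def blocks_def)

lemma UN_subblocks:
  assumes "refines {1..n} (blocks \<alpha>) (blocks \<beta>)"
  shows "(\<Union>B\<in>blocks \<beta>. subblocks \<alpha> B) = blocks \<alpha>"
  using assms by (auto simp: refines_def subblocks_def)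

lemma partition_on_block_eq:
  "partition_on A P \<Longrightarrow> B \<in> P \<Longrightarrow> C \<in> P \<Longrightarrow> x \<in> B \<Longrightarrow> x \<in> C \<Longrightarrow> B = C"
  using disjointD[OF partition_onD2, of A P B C] by blast

lemma partition_on_merge:
  assumes P: "partition_on S Q" and AB: "A \<in> Q" "B \<in> Q"
  shows "partition_on S (insert (A \<union> B) (Q - {A, B}))"
proof (rule partition_onI)
  show "\<Union>(insert (A \<union> B) (Q - {A, B})) = S"
    using partition_onD1[OF P] AB by auto
  show "{} \<notin> insert (A \<union> B) (Q - {A, B})"
    using partition_onD3[OF P] AB by auto
  have dis: "p \<inter> q = {}" if "p \<in> Q" "q \<in> Q" "p \<noteq> q" for p q
    using disjointD[OF partition_onD2[OF P] that] .
  have dis': "p \<inter> (A \<union> B) = {}" if "p \<in> Q" "p \<noteq> A" "p \<noteq> B" for p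
    using dis[OF that(1) AB(1) that(2)] dis[OF that(1) AB(2) that(3)] by (simp add: Int_Un_distrib)
  show "disjnt p q" if pq: "p \<in> insert (A \<union> B) (Q - {A, B})" "q \<in> insert (A \<union> B) (Q - {A, B})" "p \<noteq> q" for p q
  proof -
    consider "p = A \<union> B" "q \<in> Q" "q \<noteq> A" "q \<noteq> B"
      | "q = A \<union> B" "p \<in> Q" "p \<noteq> A" "p \<noteq> B" | "p \<in> Q" "q \<in> Q"
      using pq by fast
    then show ?thesis
      using dis'[of p] dis'[of q] dis[OF _ _ pq(3)] unfolding disjnt_def
      by cases (simp_all add: Int_commute)
  qed
qed

text \<open>The bounds telescope: summed over the blocks of \<open>\<beta>\<close> inside a block
  \<open>C\<close> of \<open>\<gamma>\<close>, the admissible increases \<open>l - 1\<close> add up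
  to the number of \<open>\<alpha>\<close>-blocks minus the number of \<open>\<beta>\<close>-blocks
  in \<open>C\<close>, and the step from \<open>\<beta>\<close> to \<open>\<gamma>\<close>
  contributes the rest.\<close>

lemma wp_le_trans:
  assumes in_wp: "\<alpha> \<in> wpartitions n" "\<beta> \<in> wpartitions n" "\<gamma> \<in> wpartitions n"
    and le: "wp_le n \<alpha> \<beta>" "wp_le n \<beta> \<gamma>"
  shows "wp_le n \<alpha> \<gamma>"
proof -
  have ref: "refines {1..n} (blocks \<alpha>) (blocks \<beta>)" "refines {1..n} (blocks \<beta>) (blocks \<gamma>)"
    using le in_wp by (simp_all add: wp_le_iff)
  have ref': "refines {1..n} (blocks \<alpha>) (blocks \<gamma>)"
    using ref by (rule refines_trans)
  have "(\<Sum>A\<in>subblocks \<alpha> C. weight \<alpha> A) \<le> weight \<gamma> C \<and>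
      weight \<gamma> C < (\<Sum>A\<in>subblocks \<alpha> C. weight \<alpha> A) + card (subblocks \<alpha> C)"
    if C: "C \<in> blocks \<gamma>" for C
  proof -
    have S: "subblocks \<alpha> C = (\<Union>B\<in>subblocks \<beta> C. subblocks \<alpha> B)"
    proof
      show "subblocks \<alpha> C \<subseteq> (\<Union>B\<in>subblocks \<beta> C. subblocks \<alpha> B)"
      proof
        fix A assume A: "A \<in> subblocks \<alpha> C"
        then obtain B where B: "B \<in> blocks \<beta>" "A \<subseteq> B"
          using ref(1) by (auto simp: refines_def subblocks_def)
        obtain C' where C': "C' \<in> blocks \<gamma>" "B \<subseteq> C'"
          using ref(2) B by (auto simp: refines_def)
        have "A \<noteq> {}" "A \<subseteq> C" using A in_wp(1) wpartitionsD(5) by (auto simp: subblocks_def)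
        then have "C' = C"
          using partition_on_block_eq[of "{1..n}" "blocks \<gamma>" C' C] C C' B ref(2)
          unfolding refines_def by blast
        then show "A \<in> (\<Union>B\<in>subblocks \<beta> C. subblocks \<alpha> B)"
          using A B C' by (auto simp: subblocks_def)
      qed
    qed (auto simp: subblocks_def)
    have fin: "finite (subblocks \<beta> C)" "\<forall>B\<in>subblocks \<beta> C. finite (subblocks \<alpha> B)"
      using in_wp finite_subblocks by auto
    have dis: "\<forall>B\<in>subblocks \<beta> C. \<forall>B'\<in>subblocks \<beta> C. B \<noteq> B' \<longrightarrow>
        subblocks \<alpha> B \<inter> subblocks \<alpha> B' = {}"
      using subblocks_disjoint[OF ref(1)] by (auto simp: subblocks_def[of \<beta>])
    let ?w = "\<lambda>B. \<Sum>A\<in>subblocks \<alpha> B. weight \<alpha> A" and ?c = "\<lambda>B. card (subblocks \<alpha> B)"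
    have w: "?w C = (\<Sum>B\<in>subblocks \<beta> C. ?w B)" "?c C = (\<Sum>B\<in>subblocks \<beta> C. ?c B)"
      unfolding S using fin dis by (simp_all add: sum.UNION_disjoint card_UN_disjoint)
    have each: "?w B \<le> weight \<beta> B" "weight \<beta> B + 1 \<le> ?w B + ?c B" if "B \<in> subblocks \<beta> C" for B
      using le(1) in_wp that by (auto simp: wp_le_iff subblocks_def[of \<beta>] Suc_le_eq)
    have "?w C \<le> (\<Sum>B\<in>subblocks \<beta> C. weight \<beta> B)"
      unfolding w using each by (intro sum_mono)
    moreover have "(\<Sum>B\<in>subblocks \<beta> C. weight \<beta> B) + card (subblocks \<beta> C) \<le> ?w C + ?c C"
    proof -
      have "(\<Sum>B\<in>subblocks \<beta> C. weight \<beta> B + 1) \<le> (\<Sum>B\<in>subblocks \<beta> C. ?w B + ?c B)"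
        using each by (intro sum_mono)
      then show ?thesis unfolding w by (simp add: sum.distrib sum_Suc)
    qed
    ultimately show ?thesis
      using le(2) in_wp C by (auto simp: wp_le_iff)
  qed
  then show ?thesis using ref' in_wp by (simp add: wp_le_iff)
qed

text \<open>If the number of blocks did not drop, every block of \<open>\<beta>\<close> would be a
  single block of \<open>\<alpha>\<close>, and then \<open>l = 1\<close> permits no increase of
  weight. The number of blocks thus serves as a rank function.\<close>

lemma card_less_of_wp_less:
  assumes in_wp: "\<alpha> \<in> wpartitions n" "\<beta> \<in> wpartitions n" and less: "wp_less n \<alpha> \<beta>"
  shows "card \<beta> < card \<alpha>"
proof -
  have le: "wp_le n \<alpha> \<beta>" and ne: "\<alpha> \<noteq> \<beta>" using less by (auto simp: wp_less_def)
  have ref: "refines {1..n} (blocks \<alpha>) (blocks \<beta>)"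
    using le in_wp by (simp add: wp_le_iff)
  have fin: "finite (blocks \<beta>)" "finite (blocks \<alpha>)" using in_wp wpartitionsD(3) by (auto simp: blocks_def)
  have "card (blocks \<alpha>) = (\<Sum>B\<in>blocks \<beta>. card (subblocks \<alpha> B))"
    unfolding UN_subblocks[OF ref, symmetric]
    using fin in_wp(1) finite_subblocks subblocks_disjoint[OF ref]
    by (intro card_UN_disjoint) auto
  moreover have ge: "1 \<le> card (subblocks \<alpha> B)" if "B \<in> blocks \<beta>" for B
    using subblocks_nonempty[OF ref that] finite_subblocks[OF in_wp(1)]
    by (simp add: Suc_le_eq card_gt_0_iff)
  ultimately have "card (blocks \<beta>) \<le> card (blocks \<alpha>)"
    using sum_mono[of "blocks \<beta>" "\<lambda>_. 1" "\<lambda>B. card (subblocks \<alpha> B)"] by simp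
  moreover have "card (blocks \<beta>) \<noteq> card (blocks \<alpha>)"
  proof
    assume eq: "card (blocks \<beta>) = card (blocks \<alpha>)"
    have one: "card (subblocks \<alpha> B) = 1" if B: "B \<in> blocks \<beta>" for B
    proof (rule ccontr)
      assume "card (subblocks \<alpha> B) \<noteq> 1"
      then have "1 < card (subblocks \<alpha> B)" using ge[OF B] by simp
      then have "(\<Sum>B\<in>blocks \<beta>. 1) < (\<Sum>B\<in>blocks \<beta>. card (subblocks \<alpha> B))"
        using ge B fin by (intro sum_strict_mono_ex1) auto
      then show False
        using eq \<open>card (blocks \<alpha>) = _\<close> by simp
    qed
    have sing: "subblocks \<alpha> B = {B}" if B: "B \<in> blocks \<beta>" for B
    proof -
      obtain A where A: "subblocks \<alpha> B = {A}" using one[OF B] by (auto simp: card_1_singleton_iff)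
      moreover have "\<Union>(subblocks \<alpha> B) = B"
        using partition_on_subblocks[OF ref B] by (simp add: partition_on_def)
      ultimately show ?thesis by simp
    qed
    then have "blocks \<beta> \<subseteq> blocks \<alpha>" by (auto simp: subblocks_def)
    then have "blocks \<beta> = blocks \<alpha>" using eq fin by (simp add: card_subset_eq)
    moreover have "weight \<alpha> B = weight \<beta> B" if "B \<in> blocks \<beta>" for B
      using le in_wp that by (auto simp: wp_le_iff sing)
    ultimately have "\<alpha> = \<beta>"
      using in_wp wpartitionsD(2) by (intro wpartition_eqI) auto
    with ne show False ..
  qed
  ultimately show ?thesis
    using in_wp by (simp add: card_blocks)
qed

lemma wp_less_trans:
  assumes in_wp: "\<alpha> \<in> wpartitions n" "\<beta> \<in> wpartitions n" "\<gamma> \<in> wpartitions n"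
    and "wp_less n \<alpha> \<beta>" "wp_less n \<beta> \<gamma>"
  shows "wp_less n \<alpha> \<gamma>"
  using wp_le_trans[OF in_wp] card_less_of_wp_less[OF in_wp(1,2)] card_less_of_wp_less[OF in_wp(2,3)]
    assms(4,5) by (auto simp: wp_less_def)

section \<open>Merging two blocks\<close>

lemma blocks_merge [simp]: "blocks (merge k A B \<alpha>) = insert (A \<union> B) (blocks \<alpha> - {A, B})"
  by (force simp: merge_def blocks_def)

lemma merge_commute: "merge k A B \<alpha> = merge k B A \<alpha>"
  by (auto simp: merge_def Un_commute add.commute)

locale two_blocks =
  fixes n :: nat and \<alpha> :: wpartition and A B :: "nat set"
  assumes wp: "\<alpha> \<in> wpartitions n" and AB: "A \<in> blocks \<alpha>" "B \<in> blocks \<alpha>" "A \<noteq> B"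
begin

lemma disj: "A \<inter> B = {}"
  using wpartitionsD(1)[OF wp] AB by (auto simp: partition_on_def disjoint_def)

lemma union_notin: "S \<in> blocks \<alpha> \<Longrightarrow> S \<noteq> A \<Longrightarrow> S \<noteq> B \<Longrightarrow> S \<noteq> A \<union> B"
  using wpartitionsD(1)[OF wp] AB(1) wpartitionsD(5)[OF wp AB(1)]
  by (metis Int_absorb2 Un_upper1 partition_onD2 disjointD)

lemma inj_merge: "inj_on fst (merge k A B \<alpha>)"
proof (rule inj_onI)
  fix x y assume "x \<in> merge k A B \<alpha>" "y \<in> merge k A B \<alpha>" "fst x = fst y"
  then obtain S v w where xy: "x = (S, v)" "y = (S, w)"
    "(S, v) \<in> merge k A B \<alpha>" "(S, w) \<in> merge k A B \<alpha>"
    by (cases x; cases y) auto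
  show "x = y"
  proof (cases "S = A \<union> B")
    case True
    then show ?thesis using xy union_notin blocksI by (auto simp: merge_def)
  next
    case False
    then have "(S, v) \<in> \<alpha>" "(S, w) \<in> \<alpha>" using xy by (auto simp: merge_def)
    then show ?thesis using weight_eq[OF wpartitionsD(2)[OF wp]] xy by metis
  qed
qed

lemma weight_merge:
  "weight (merge k A B \<alpha>) (A \<union> B) = weight \<alpha> A + weight \<alpha> B + k"
  "S \<in> blocks \<alpha> \<Longrightarrow> S \<noteq> A \<Longrightarrow> S \<noteq> B \<Longrightarrow> weight (merge k A B \<alpha>) S = weight \<alpha> S"
proof -
  show "weight (merge k A B \<alpha>) (A \<union> B) = weight \<alpha> A + weight \<alpha> B + k"
    by (rule weight_eq[OF inj_merge]) (simp add: merge_def)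
  show "weight (merge k A B \<alpha>) S = weight \<alpha> S" if "S \<in> blocks \<alpha>" "S \<noteq> A" "S \<noteq> B"
    using that wpartitionsD(2)[OF wp]
    by (intro weight_eq[OF inj_merge]) (auto simp: merge_def mem_wpartition_iff)
qed

lemma refines_merge: "refines {1..n} (blocks \<alpha>) (blocks (merge k A B \<alpha>))"
proof -
  have P: "partition_on {1..n} (blocks \<alpha>)" using wpartitionsD(1)[OF wp] .
  have "partition_on {1..n} (insert (A \<union> B) (blocks \<alpha> - {A, B}))"
    using P AB(1,2) by (rule partition_on_merge)
  moreover have "\<exists>T\<in>insert (A \<union> B) (blocks \<alpha> - {A, B}). S \<subseteq> T" if "S \<in> blocks \<alpha>" for S
    using that by (cases "S = A \<or> S = B") auto
  ultimately show ?thesis using P by (simp add: refines_def)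
qed

lemma subblocks_merge:
  "subblocks \<alpha> (A \<union> B) = {A, B}"
  "S \<in> blocks \<alpha> \<Longrightarrow> S \<noteq> A \<Longrightarrow> S \<noteq> B \<Longrightarrow> subblocks \<alpha> S = {S}"
proof -
  have P: "partition_on {1..n} (blocks \<alpha>)" using wpartitionsD(1)[OF wp] .
  have *: "Y = S" if "Y \<in> blocks \<alpha>" "S \<in> blocks \<alpha>" "Y \<inter> S \<noteq> {}" for S Y
    using partition_on_block_eq[OF P that(1,2)] that(3) by blast
  have ne: "Y \<noteq> {}" if "Y \<in> blocks \<alpha>" for Y using wpartitionsD(5)[OF wp that] .
  show "subblocks \<alpha> (A \<union> B) = {A, B}"
  proof
    show "subblocks \<alpha> (A \<union> B) \<subseteq> {A, B}"
    proof
      fix Y assume "Y \<in> subblocks \<alpha> (A \<union> B)"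
      then have Y: "Y \<in> blocks \<alpha>" "Y \<subseteq> A \<union> B" by (auto simp: subblocks_def)
      then have "Y \<inter> A \<noteq> {} \<or> Y \<inter> B \<noteq> {}" using ne[OF Y(1)] by auto
      then show "Y \<in> {A, B}" using * Y(1) AB by blast
    qed
  qed (use AB in \<open>auto simp: subblocks_def\<close>)
  show "subblocks \<alpha> S = {S}" if S: "S \<in> blocks \<alpha>"
  proof
    show "subblocks \<alpha> S \<subseteq> {S}"
    proof
      fix Y assume "Y \<in> subblocks \<alpha> S"
      then have Y: "Y \<in> blocks \<alpha>" "Y \<subseteq> S" by (auto simp: subblocks_def)
      then show "Y \<in> {S}" using * S ne[OF Y(1)] by blast
    qed
  qed (use S in \<open>auto simp: subblocks_def\<close>)
qed

lemma merge_in: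
  assumes "k \<le> 1"
  shows "merge k A B \<alpha> \<in> wpartitions n"
proof (rule wpartitionsI)
  show "partition_on {1..n} (blocks (merge k A B \<alpha>))" using refines_merge by (simp add: refines_def)
  show "inj_on fst (merge k A B \<alpha>)" by (rule inj_merge)
  fix S assume "S \<in> blocks (merge k A B \<alpha>)"
  then consider "S = A \<union> B" | "S \<in> blocks \<alpha>" "S \<noteq> A" "S \<noteq> B" by auto
  then show "weight (merge k A B \<alpha>) S < card S"
  proof cases
    case 1
    have "card (A \<union> B) = card A + card B"
      using disj wpartitionsD(4)[OF wp] AB by (intro card_Un_disjoint) auto
    then show ?thesis
      using 1 assms weight_less[OF wp AB(1)] weight_less[OF wp AB(2)] by (simp add: weight_merge)
  next
    case 2
    then show ?thesis using weight_less[OF wp] by (simp add: weight_merge)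
  qed
qed

lemma card_merge: "card (merge k A B \<alpha>) + 1 = card \<alpha>"
proof -
  have fin: "finite (blocks \<alpha>)" using wpartitionsD(3)[OF wp] by (simp add: blocks_def)
  have "card (merge k A B \<alpha>) = card (blocks (merge k A B \<alpha>))"
    using inj_merge by (simp only: card_image blocks_def)
  also have "\<dots> = card (insert (A \<union> B) (blocks \<alpha> - {A, B}))"
    by simp
  also have "\<dots> = Suc (card (blocks \<alpha> - {A, B}))"
    using fin union_notin[of "A \<union> B"] by (intro card_insert_disjoint[OF finite_Diff]) auto
  also have "card (blocks \<alpha> - {A, B}) = card (blocks \<alpha>) - 2"
    using AB fin by (subst card_Diff_subset) auto
  finally show ?thesis
    using card_blocks[OF wp] card_mono[of "blocks \<alpha>" "{A, B}"] fin AB by auto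
qed

lemma wp_less_merge:
  assumes "k \<le> 1"
  shows "wp_less n \<alpha> (merge k A B \<alpha>)"
proof -
  have "wp_le n \<alpha> (merge k A B \<alpha>)"
    unfolding wp_le_iff[OF wp merge_in[OF assms]]
  proof (intro conjI ballI refines_merge)
    fix S assume "S \<in> blocks (merge k A B \<alpha>)"
    then consider "S = A \<union> B" | "S \<in> blocks \<alpha>" "S \<noteq> A" "S \<noteq> B" by auto
    then show "(\<Sum>A\<in>subblocks \<alpha> S. weight \<alpha> A) \<le> weight (merge k A B \<alpha>) S"
      "weight (merge k A B \<alpha>) S < (\<Sum>A\<in>subblocks \<alpha> S. weight \<alpha> A) + card (subblocks \<alpha> S)"
      using AB(3) assms by (cases; simp add: subblocks_merge weight_merge)+
  qed
  moreover have "\<alpha> \<noteq> merge k A B \<alpha>" using card_merge[of k] by auto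
  ultimately show ?thesis by (simp add: wp_less_def)
qed

end

section \<open>Maximal chains as sequences of merges\<close>

text \<open>The surpluses \<open>card (subblocks \<alpha> B) - 1\<close> over the blocks
  \<open>B\<close> of \<open>\<gamma>\<close> add up to one, so exactly one block splits, and into
  two parts. For \<open>l = 2\<close> the increase of weight is 0 or 1, and this is the
  color.\<close>

lemma covering_is_merge:
  assumes in_wp: "\<alpha> \<in> wpartitions n" "\<gamma> \<in> wpartitions n"
    and less: "wp_less n \<alpha> \<gamma>" and card: "card \<alpha> = card \<gamma> + 1"
  obtains c A B where "A \<in> blocks \<alpha>" "B \<in> blocks \<alpha>" "A \<noteq> B" "\<gamma> = merge (u c) A B \<alpha>"
proof -
  have le: "wp_le n \<alpha> \<gamma>" using less by (simp add: wp_less_def)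
  have ref: "refines {1..n} (blocks \<alpha>) (blocks \<gamma>)"
    using le in_wp by (simp add: wp_le_iff)
  have leD: "(\<Sum>A\<in>subblocks \<alpha> B. weight \<alpha> A) \<le> weight \<gamma> B"
    "weight \<gamma> B < (\<Sum>A\<in>subblocks \<alpha> B. weight \<alpha> A) + card (subblocks \<alpha> B)"
    if "B \<in> blocks \<gamma>" for B
    using le that unfolding wp_le_iff[OF in_wp] by simp_all
  have fin: "finite (blocks \<gamma>)" using wpartitionsD(3)[OF in_wp(2)] by (simp add: blocks_def)
  let ?c = "\<lambda>B. card (subblocks \<alpha> B)"
  have ge: "1 \<le> ?c B" if "B \<in> blocks \<gamma>" for B
    using subblocks_nonempty[OF ref that] finite_subblocks[OF in_wp(1)]
    by (simp add: Suc_le_eq card_gt_0_iff)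
  have "(\<Sum>B\<in>blocks \<gamma>. ?c B) = card (blocks \<alpha>)"
    unfolding UN_subblocks[OF ref, symmetric]
    using fin finite_subblocks[OF in_wp(1)] subblocks_disjoint[OF ref]
    by (intro card_UN_disjoint[symmetric]) auto
  then have "(\<Sum>B\<in>blocks \<gamma>. ?c B) = (\<Sum>B\<in>blocks \<gamma>. 1) + 1"
    using card in_wp by (simp add: card_blocks)
  moreover have "(\<Sum>B\<in>blocks \<gamma>. ?c B) = (\<Sum>B\<in>blocks \<gamma>. 1) + (\<Sum>B\<in>blocks \<gamma>. ?c B - 1)"
    unfolding sum.distrib[symmetric] by (intro sum.cong refl) (metis ge le_add_diff_inverse)
  ultimately have sum1: "(\<Sum>B\<in>blocks \<gamma>. ?c B - 1) = 1" by simp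
  then obtain T where T: "T \<in> blocks \<gamma>" "?c T - 1 = 1"
    "\<And>B. B \<in> blocks \<gamma> \<Longrightarrow> B \<noteq> T \<Longrightarrow> ?c B - 1 = 0"
    using sum_eq_1_iff[OF fin, of "\<lambda>B. ?c B - 1"] by auto
  then have "?c T = 2" by simp
  then obtain A B where sub: "subblocks \<alpha> T = {A, B}" "A \<noteq> B" by (auto simp: card_2_iff)
  have T_eq: "T = A \<union> B"
    using partition_onD1[OF partition_on_subblocks[OF ref T(1)]] sub(1) by simp
  have sing: "subblocks \<alpha> S = {S}" if S: "S \<in> blocks \<gamma>" "S \<noteq> T" for S
  proof -
    have "?c S = 1" using T(3)[OF S] ge[OF S(1)] by simp
    then obtain A' where A': "subblocks \<alpha> S = {A'}" by (auto simp: card_1_singleton_iff)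
    then show ?thesis
      using partition_onD1[OF partition_on_subblocks[OF ref S(1)]] by simp
  qed
  have in_\<alpha>: "A \<in> blocks \<alpha>" "B \<in> blocks \<alpha>" using sub(1) by (auto simp: subblocks_def)
  interpret two_blocks n \<alpha> A B
    using in_wp in_\<alpha> sub by unfold_locales
  have "weight \<alpha> A + weight \<alpha> B \<le> weight \<gamma> T \<and> weight \<gamma> T < weight \<alpha> A + weight \<alpha> B + 2"
    using leD[OF T(1)] sub by simp
  then have "weight \<gamma> T = weight \<alpha> A + weight \<alpha> B + u Blue \<or>
      weight \<gamma> T = weight \<alpha> A + weight \<alpha> B + u Red" by auto
  then obtain c where c: "weight \<gamma> T = weight \<alpha> A + weight \<alpha> B + u c" by blast
  have "u c \<le> 1" by (cases c) auto
  have bl: "blocks \<gamma> = blocks (merge (u c) A B \<alpha>)"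
  proof -
    have "S \<in> blocks \<alpha> \<and> S \<noteq> A \<and> S \<noteq> B" if S: "S \<in> blocks \<gamma>" "S \<noteq> T" for S
    proof -
      have "S \<in> subblocks \<alpha> S" using sing[OF S] by simp
      moreover have "subblocks \<alpha> S \<inter> subblocks \<alpha> T = {}"
        by (rule subblocks_disjoint[OF ref S(1) T(1) S(2)])
      ultimately show ?thesis using sub(1) sing[OF S] by (auto simp: subblocks_def)
    qed
    moreover have "S \<in> blocks \<gamma>" if S: "S \<in> blocks \<alpha>" "S \<noteq> A" "S \<noteq> B" for S
    proof -
      obtain D where D: "D \<in> blocks \<gamma>" "S \<in> subblocks \<alpha> D"
        using UN_subblocks[OF ref] S(1) by blast
      then have "D \<noteq> T" using sub(1) S by auto
      then show ?thesis using sing[OF D(1)] D by auto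
    qed
    ultimately show ?thesis using T(1) T_eq by auto
  qed
  have "\<gamma> = merge (u c) A B \<alpha>"
  proof (rule wpartition_eqI[OF wpartitionsD(2)[OF in_wp(2)] inj_merge bl])
    fix S assume S: "S \<in> blocks (merge (u c) A B \<alpha>)"
    show "weight \<gamma> S = weight (merge (u c) A B \<alpha>) S"
    proof (cases "S = T")
      case True
      then show ?thesis using c T_eq by (simp add: weight_merge)
    next
      case False
      then have "S \<in> blocks \<gamma>" "S \<in> blocks \<alpha>" "S \<noteq> A" "S \<noteq> B"
        using S T_eq unfolding bl[symmetric] by (auto simp: bl)
      moreover have "weight \<gamma> S = weight \<alpha> S"
        using leD[OF \<open>S \<in> blocks \<gamma>\<close>] sing[OF \<open>S \<in> blocks \<gamma>\<close> False] by simp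
      ultimately show ?thesis by (simp add: weight_merge)
    qed
  qed
  with in_\<alpha> sub(2) show ?thesis by (rule that)
qed

section \<open>Merge sequences\<close>

type_synonym step = "color \<times> nat set \<times> nat set"

text \<open>The effect of a step on the underlying partition. Whether a merge sequence is possible
  depends on the blocks alone, so weights are kept apart in \<open>wrun\<close>.\<close>

fun pmerge :: "step \<Rightarrow> nat set set \<Rightarrow> nat set set" where
  "pmerge (c, A, B) Q = insert (A \<union> B) (Q - {A, B})"

fun run :: "nat set set \<Rightarrow> step list \<Rightarrow> nat set set" where
  "run Q [] = Q"
| "run Q (m # ms) = run (pmerge m Q) ms"

fun valid :: "nat set set \<Rightarrow> step list \<Rightarrow> bool" where
  "valid Q [] \<longleftrightarrow> True"
| "valid Q ((c, A, B) # ms) \<longleftrightarrow> A \<in> Q \<and> B \<in> Q \<and> A \<noteq> B \<and> valid (pmerge (c, A, B) Q) ms"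

fun wrun :: "wpartition \<Rightarrow> step list \<Rightarrow> wpartition" where
  "wrun \<alpha> [] = \<alpha>"
| "wrun \<alpha> ((c, A, B) # ms) = wrun (merge (u c) A B \<alpha>) ms"

definition reds :: "step list \<Rightarrow> nat" where
  "reds ms = (\<Sum>m\<leftarrow>ms. u (fst m))"

lemma reds_simps [simp]: "reds [] = 0" "reds (m # ms) = u (fst m) + reds ms"
  "reds (ms @ ms') = reds ms + reds ms'"
  by (simp_all add: reds_def)

lemma run_append [simp]: "run Q (ms @ ms') = run (run Q ms) ms'"
  by (induction ms arbitrary: Q) auto

lemma valid_append [simp]: "valid Q (ms @ ms') \<longleftrightarrow> valid Q ms \<and> valid (run Q ms) ms'"
  by (induction Q ms rule: valid.induct) auto

lemma wrun_append [simp]: "wrun \<alpha> (ms @ ms') = wrun (wrun \<alpha> ms) ms'"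
  by (induction \<alpha> ms rule: wrun.induct) auto

lemma blocks_wrun: "blocks (wrun \<alpha> ms) = run (blocks \<alpha>) ms"
  by (induction \<alpha> ms rule: wrun.induct) auto

lemma merge_chain_nonempty [simp]: "merge_chain \<alpha> ms \<noteq> []"
  by (cases "(\<alpha>, ms)" rule: merge_chain.cases) auto

lemma merge_chain_append:
  "merge_chain \<alpha> (ms @ ms') = butlast (merge_chain \<alpha> ms) @ merge_chain (wrun \<alpha> ms) ms'"
  by (induction \<alpha> ms rule: wrun.induct) auto

lemma last_merge_chain: "last (merge_chain \<alpha> ms) = wrun \<alpha> ms"
  by (induction \<alpha> ms rule: wrun.induct) auto

lemma hd_merge_chain [simp]: "hd (merge_chain \<alpha> ms) = \<alpha>"
  by (cases "(\<alpha>, ms)" rule: merge_chain.cases) auto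

lemma length_merge_chain [simp]: "length (merge_chain \<alpha> ms) = Suc (length ms)"
  by (induction \<alpha> ms rule: merge_chain.induct) auto

lemma merge_chain_Cons: "merge_chain \<alpha> ms = \<alpha> # tl (merge_chain \<alpha> ms)"
  by (cases "(\<alpha>, ms)" rule: merge_chain.cases) auto

lemma merge_chain_nth: "k \<le> length ms \<Longrightarrow> merge_chain \<alpha> ms ! k = wrun \<alpha> (take k ms)"
proof (induction \<alpha> ms arbitrary: k rule: merge_chain.induct)
  case (2 \<alpha> c A B ms)
  then show ?case by (cases k) auto
qed auto

lemma u_le_1 [simp]: "u c \<le> 1"
  by (cases c) auto

lemma two_blocksI: "\<alpha> \<in> wpartitions n \<Longrightarrow> valid (blocks \<alpha>) ((c, A, B) # ms) \<Longrightarrow> two_blocks n \<alpha> A B"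
  by unfold_locales auto

lemma wrun_in:
  "\<alpha> \<in> wpartitions n \<Longrightarrow> valid (blocks \<alpha>) ms \<Longrightarrow> wrun \<alpha> ms \<in> wpartitions n"
proof (induction \<alpha> ms rule: wrun.induct)
  case (2 \<alpha> c A B ms)
  interpret two_blocks n \<alpha> A B using 2 by (intro two_blocksI)
  show ?case using 2 merge_in[OF u_le_1] by auto
qed auto

lemma card_wrun:
  "\<alpha> \<in> wpartitions n \<Longrightarrow> valid (blocks \<alpha>) ms \<Longrightarrow> card (wrun \<alpha> ms) + length ms = card \<alpha>"
proof (induction \<alpha> ms rule: wrun.induct)
  case (2 \<alpha> c A B ms)
  interpret two_blocks n \<alpha> A B using 2 by (intro two_blocksI)
  show ?case using 2 merge_in[OF u_le_1] card_merge[of "u c"] by auto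
qed auto

definition total_weight :: "wpartition \<Rightarrow> nat" where
  "total_weight \<alpha> = (\<Sum>A\<in>blocks \<alpha>. weight \<alpha> A)"

text \<open>Each merge adds its \<open>u\<close> to the total. Once a single block is left, its
  weight therefore counts the red steps.\<close>

lemma total_weight_wrun:
  "\<alpha> \<in> wpartitions n \<Longrightarrow> valid (blocks \<alpha>) ms \<Longrightarrow>
    total_weight (wrun \<alpha> ms) = total_weight \<alpha> + reds ms"
proof (induction \<alpha> ms rule: wrun.induct)
  case (2 \<alpha> c A B ms)
  interpret two_blocks n \<alpha> A B using 2 by (intro two_blocksI)
  have fin: "finite (blocks \<alpha>)" using wpartitionsD(3)[OF wp] by (simp add: blocks_def)
  have "A \<union> B \<notin> blocks \<alpha> - {A, B}" using union_notin by auto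
  then have "total_weight (merge (u c) A B \<alpha>) =
      weight \<alpha> A + weight \<alpha> B + u c + (\<Sum>S\<in>blocks \<alpha> - {A, B}. weight (merge (u c) A B \<alpha>) S)"
    using fin by (simp add: total_weight_def weight_merge)
  also have "(\<Sum>S\<in>blocks \<alpha> - {A, B}. weight (merge (u c) A B \<alpha>) S) =
      (\<Sum>S\<in>blocks \<alpha> - {A, B}. weight \<alpha> S)"
    by (intro sum.cong) (auto simp: weight_merge)
  also have "weight \<alpha> A + weight \<alpha> B + u c + \<dots> = total_weight \<alpha> + u c"
    using sum.subset_diff[of "{A, B}" "blocks \<alpha>" "weight \<alpha>"] fin AB
    by (simp add: total_weight_def)
  finally show ?case using 2 merge_in[OF u_le_1] by auto
qed auto

lemma sorted_merge_chain:
  "\<alpha> \<in> wpartitions n \<Longrightarrow> valid (blocks \<alpha>) ms \<Longrightarrow>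
    sorted_wrt (wp_less n) (merge_chain \<alpha> ms) \<and> set (merge_chain \<alpha> ms) \<subseteq> wpartitions n"
proof (induction \<alpha> ms rule: merge_chain.induct)
  case (2 \<alpha> c A B ms)
  interpret two_blocks n \<alpha> A B using 2 by (intro two_blocksI)
  let ?\<beta> = "merge (u c) A B \<alpha>"
  have \<beta>: "?\<beta> \<in> wpartitions n" "wp_less n \<alpha> ?\<beta>"
    using merge_in[OF u_le_1] wp_less_merge[OF u_le_1] .
  have IH: "sorted_wrt (wp_less n) (merge_chain ?\<beta> ms)" "set (merge_chain ?\<beta> ms) \<subseteq> wpartitions n"
    using 2 \<beta> by auto
  have "wp_less n \<alpha> \<gamma>" if "\<gamma> \<in> set (merge_chain ?\<beta> ms)" for \<gamma>
  proof (cases "\<gamma> = ?\<beta>")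
    case False
    have "wp_less n ?\<beta> \<gamma>"
      using IH(1) that False merge_chain_Cons[of ?\<beta> ms] by (metis set_ConsD sorted_wrt.simps(2))
    then show ?thesis using wp_less_trans[OF wp \<beta>(1) _ \<beta>(2)] IH(2) that by blast
  qed (use \<beta> in simp)
  then show ?case using IH wp by simp
qed auto

lemma sorted_card:
  assumes "sorted_wrt (wp_less n) xs" "set xs \<subseteq> wpartitions n" "i \<le> j" "j < length xs"
  shows "card (xs ! j) + (j - i) \<le> card (xs ! i)"
  using assms(3,4)
proof (induction rule: dec_induct)
  case (step j)
  have "wp_less n (xs ! j) (xs ! Suc j)"
    using assms(1) step by (simp add: sorted_wrt_iff_nth_less)
  then have "card (xs ! Suc j) < card (xs ! j)"
    using assms(2) step by (intro card_less_of_wp_less) (auto simp: subset_iff)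
  then show ?case using step by simp
qed simp

text \<open>Neighbours whose numbers of blocks differ by one are single merges by
  \<open>covering_is_merge\<close>.\<close>

lemma ex_merge_chain:
  assumes "sorted_wrt (wp_less n) (\<alpha> # cs)" "set (\<alpha> # cs) \<subseteq> wpartitions n"
    and "\<And>k. k < length cs \<Longrightarrow> card ((\<alpha> # cs) ! k) = card ((\<alpha> # cs) ! Suc k) + 1"
  shows "\<exists>ms. valid (blocks \<alpha>) ms \<and> merge_chain \<alpha> ms = \<alpha> # cs"
  using assms
proof (induction cs arbitrary: \<alpha>)
  case Nil
  then show ?case by (intro exI[of _ "[]"]) auto
next
  case (Cons \<gamma> cs)
  obtain c A B where AB: "A \<in> blocks \<alpha>" "B \<in> blocks \<alpha>" "A \<noteq> B" "\<gamma> = merge (u c) A B \<alpha>"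
  proof (rule covering_is_merge)
    show "wp_less n \<alpha> \<gamma>" "card \<alpha> = card \<gamma> + 1" "\<alpha> \<in> wpartitions n" "\<gamma> \<in> wpartitions n"
      using Cons.prems(1,2) Cons.prems(3)[of 0] by auto
  qed
  obtain ms where "valid (blocks \<gamma>) ms" "merge_chain \<gamma> ms = \<gamma> # cs"
  proof -
    have "card ((\<gamma> # cs) ! k) = card ((\<gamma> # cs) ! Suc k) + 1" if "k < length cs" for k
      using Cons.prems(3)[of "Suc k"] that by simp
    then show ?thesis using Cons.IH[of \<gamma>] Cons.prems(1,2) that by auto
  qed
  then show ?case using AB by (intro exI[of _ "(c, A, B) # ms"]) auto
qed

section \<open>Straightening trees to combs\<close>

definition singles :: "nat \<Rightarrow> nat set set" where
  "singles n = (\<lambda>j. {j}) ` {1..n}"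

text \<open>The sequences that encode the maximal chains ending in \<open>wp_top n i\<close>,
  described without weights; see \<open>wrun_eq_top_iff\<close>.\<close>

definition full :: "nat \<Rightarrow> nat \<Rightarrow> step list \<Rightarrow> bool" where
  "full n i ms \<longleftrightarrow> valid (singles n) ms \<and> run (singles n) ms = {{1..n}} \<and> reds ms = i"

definition touched :: "step list \<Rightarrow> nat set" where
  "touched ms = (\<Union>(c, A, B)\<in>set ms. A \<union> B)"

lemma touched_simps [simp]:
  "touched [] = {}" "touched ((c, A, B) # ms) = A \<union> B \<union> touched ms"
  "touched (ms @ ms') = touched ms \<union> touched ms'"
  by (auto simp: touched_def)

lemma touched_postorder: "touched (postorder t) \<subseteq> labels t"
  by (induction t) auto

lemma reds_postorder [simp]: "reds (postorder t) = red_nodes t"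
proof (induction t)
  case (Node c l r)
  then show ?case by (cases c) auto
qed auto

lemma partition_on_pmerge:
  "partition_on S Q \<Longrightarrow> A \<in> Q \<Longrightarrow> B \<in> Q \<Longrightarrow> partition_on S (pmerge (c, A, B) Q)"
  by (simp add: partition_on_merge)

lemma partition_on_run: "partition_on S Q \<Longrightarrow> valid Q ms \<Longrightarrow> partition_on S (run Q ms)"
  by (induction Q ms rule: valid.induct) (auto simp del: pmerge.simps simp: partition_on_pmerge)

lemma partition_on_singles: "partition_on {1..n} (singles n)"
  unfolding singles_def by (rule partition_on_singletons)

definition ready :: "nat set set \<Rightarrow> bctree \<Rightarrow> bool" where
  "ready Q t \<longleftrightarrow> distinct (leaves t) \<and> (\<forall>a\<in>labels t. {a} \<in> Q)"

lemma run_postorder: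
  assumes "partition_on S Q" "ready Q t"
  shows "valid Q (postorder t) \<and> run Q (postorder t) = insert (labels t) {B \<in> Q. B \<inter> labels t = {}}"
  using assms
proof (induction t arbitrary: Q)
  case (Leaf a)
  have "B = {a}" if "B \<in> Q" "a \<in> B" for B
    using partition_on_block_eq[OF Leaf(1), of B "{a}" a] that Leaf(2) by (simp add: ready_def)
  then have "Q \<subseteq> insert {a} {B \<in> Q. B \<inter> {a} = {}}" by blast
  moreover have "{a} \<in> Q" using Leaf(2) by (simp add: ready_def)
  ultimately have "Q = insert {a} {B \<in> Q. B \<inter> {a} = {}}" by blast
  then show ?case by simp
next
  case (Node c l r)
  let ?L = "labels l" and ?R = "labels r"
  have dis: "?L \<inter> ?R = {}" and rd: "ready Q l" "ready Q r"
    using Node.prems(2) by (auto simp: ready_def)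
  let ?Q1 = "insert ?L {B \<in> Q. B \<inter> ?L = {}}"
  have 1: "valid Q (postorder l)" "run Q (postorder l) = ?Q1"
    using Node.IH(1)[OF Node.prems(1) rd(1)] by auto
  have "partition_on S ?Q1" using partition_on_run[OF Node.prems(1) 1(1)] 1(2) by simp
  moreover have "ready ?Q1 r" using rd(2) dis by (auto simp: ready_def)
  ultimately have 2: "valid ?Q1 (postorder r)"
    "run ?Q1 (postorder r) = insert ?R {B \<in> ?Q1. B \<inter> ?R = {}}"
    using Node.IH(2) by auto
  have ne: "?L \<noteq> {}" "?R \<noteq> {}" by simp_all
  have LR: "?L \<noteq> ?R" using dis ne by auto
  have "insert ?R {B \<in> ?Q1. B \<inter> ?R = {}} - {?L, ?R} = {B \<in> Q. B \<inter> (?L \<union> ?R) = {}}"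
    using ne by auto
  then show ?case using 1 2 LR dis by simp
qed

definition combs :: "nat set \<Rightarrow> nat \<Rightarrow> bctree set" where
  "combs S k = {t. distinct (leaves t) \<and> labels t = S \<and> red_nodes t = k \<and>
     comb_shape t \<and> normalized t}"

lemma normalized_Leaf [simp]: "normalized (Leaf a)"
  by (simp add: normalized_def)

lemma normalized_Node:
  "normalized (Node c l r) \<longleftrightarrow>
    normalized l \<and> normalized r \<and> hd (leaves l) = Min (labels l \<union> labels r)"
  by (auto simp: normalized_def)

lemma hd_leaves_normalized: "normalized t \<Longrightarrow> hd (leaves t) = Min (labels t)"
  by (cases t) (auto simp: normalized_Node)

lemma normalized_Node_less:
  assumes "normalized l" "normalized r"
  shows "normalized (Node c l r) \<longleftrightarrow> hd (leaves l) \<le> hd (leaves r)"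
  using assms hd_leaves_normalized[OF assms(1)] hd_leaves_normalized[OF assms(2)]
  by (auto simp: normalized_Node Min_Un min_def)

lemma bicolored_comb_iff: "bicolored_comb t \<longleftrightarrow> normalized t \<and> comb_shape t"
proof -
  define bad where "bad s \<longleftrightarrow>
    (\<exists>c l c' l' r'. s = Node c l (Node c' l' r') \<and> \<not> (c = Red \<and> c' = Blue))" for s
  have "(\<forall>s\<in>subtrees t. \<not> bad s) \<longleftrightarrow> comb_shape t"
  proof (induction t rule: comb_shape.induct)
    case (3 c l c' l' r')
    have "subtrees (Node c l (Node c' l' r')) =
        insert (Node c l (Node c' l' r')) (subtrees l \<union> subtrees (Node c' l' r'))" by simp
    then have "(\<forall>s\<in>subtrees (Node c l (Node c' l' r')). \<not> bad s) \<longleftrightarrow>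
        \<not> bad (Node c l (Node c' l' r')) \<and> (\<forall>s\<in>subtrees l. \<not> bad s) \<and>
        (\<forall>s\<in>subtrees (Node c' l' r'). \<not> bad s)"
      by (simp only: ball_simps ball_Un)
    moreover have "bad (Node c l (Node c' l' r')) \<longleftrightarrow> \<not> (c = Red \<and> c' = Blue)"
      by (simp add: bad_def)
    ultimately show ?case using 3 by auto
  qed (simp_all add: bad_def)
  then show ?thesis unfolding bicolored_comb_def bad_def by blast
qed

section \<open>Rewriting merge sequences by the rank two relations\<close>

lemma insert_Diff_swap:
  assumes "E \<noteq> C" "E \<noteq> D" "G \<noteq> A" "G \<noteq> B"
  shows "insert G (insert E (Q - {A, B}) - {C, D}) = insert E (insert G (Q - {C, D}) - {A, B})"
  using assms by auto

text \<open>\<open>P ms\<close> will mean that the class of the chain of \<open>ms\<close> lies in a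
  given submodule, so the relations turn into closure rules free of signs and coefficients. The
  premise of \<open>jacobi\<close> runs over the other middle elements of a rank two interval that
  joins three blocks: three choices for the pair merged first, and every distribution of the same
  total color.\<close>

locale closed_under_relations =
  fixes n i :: nat and P :: "step list \<Rightarrow> bool"
  assumes sym: "P (pre @ (c, B, A) # post) \<Longrightarrow> P (pre @ (c, A, B) # post)"
    and comm: "full n i (pre @ (c, A, B) # (d, C, D) # post) \<Longrightarrow> (A \<union> B) \<inter> (C \<union> D) = {} \<Longrightarrow>
      P (pre @ (d, C, D) # (c, A, B) # post) \<Longrightarrow> P (pre @ (c, A, B) # (d, C, D) # post)"
    and jacobi: "full n i (pre @ (c, A, B) # (d, A \<union> B, C) # post) \<Longrightarrow> C \<inter> (A \<union> B) = {} \<Longrightarrow>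
      (\<And>c' d' E F G. (E, F, G) \<in> {(A, B, C), (A, C, B), (B, C, A)} \<Longrightarrow> u c' + u d' = u c + u d \<Longrightarrow>
         (c', E, F) \<noteq> (c, A, B) \<Longrightarrow> P (pre @ (c', E, F) # (d', E \<union> F, G) # post)) \<Longrightarrow>
      P (pre @ (c, A, B) # (d, A \<union> B, C) # post)"
begin

abbreviation F :: "step list \<Rightarrow> bool" where "F \<equiv> full n i"

text \<open>The relations are available only inside complete chains. Hence \<open>P\<close> is
  compared only on full sequences, and fullness has to be transported along.\<close>

definition eqv :: "step list \<Rightarrow> step list \<Rightarrow> bool" where
  "eqv ms ms' \<longleftrightarrow> (F ms \<longleftrightarrow> F ms') \<and> (F ms \<longrightarrow> (P ms \<longleftrightarrow> P ms'))"

lemma eqv_refl [simp]: "eqv ms ms"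
  and eqv_sym: "eqv ms ms' \<Longrightarrow> eqv ms' ms"
  and eqv_trans [trans]: "eqv ms ms' \<Longrightarrow> eqv ms' ms'' \<Longrightarrow> eqv ms ms''"
  by (auto simp: eqv_def)

lemma eqvD: "eqv ms ms' \<Longrightarrow> F ms' \<Longrightarrow> P ms' \<Longrightarrow> P ms"
  by (auto simp: eqv_def)

lemma eqv_flip: "eqv (pre @ (c, A, B) # post) (pre @ (c, B, A) # post)"
proof -
  have "pmerge (c, A, B) Q = pmerge (c, B, A) Q" for Q
    by (simp add: Un_commute insert_commute)
  then have "F (pre @ (c, A, B) # post) \<longleftrightarrow> F (pre @ (c, B, A) # post)"
    by (auto simp: full_def simp del: pmerge.simps)
  then show ?thesis using sym by (auto simp: eqv_def)
qed

lemma full_comm: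
  assumes F: "F (pre @ (c, A, B) # (d, C, D) # post)" and dis: "(A \<union> B) \<inter> (C \<union> D) = {}"
  shows "F (pre @ (d, C, D) # (c, A, B) # post)"
proof -
  let ?Q = "run (singles n) pre"
  have v: "valid (singles n) pre" using F by (simp add: full_def)
  have P: "partition_on {1..n} ?Q" by (rule partition_on_run[OF partition_on_singles v])
  have AB: "A \<in> ?Q" "B \<in> ?Q" "A \<noteq> B" "C \<in> pmerge (c, A, B) ?Q" "D \<in> pmerge (c, A, B) ?Q" "C \<noteq> D"
    using F by (auto simp: full_def simp del: pmerge.simps)
  have "partition_on {1..n} (pmerge (c, A, B) ?Q)" by (rule partition_on_pmerge[OF P AB(1,2)])
  then have ne: "A \<noteq> {}" "B \<noteq> {}" "C \<noteq> {}" "D \<noteq> {}"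
    using partition_onD3 P AB by metis+
  have d: "A \<noteq> C" "A \<noteq> D" "B \<noteq> C" "B \<noteq> D" "A \<union> B \<noteq> C" "A \<union> B \<noteq> D" "C \<union> D \<noteq> A" "C \<union> D \<noteq> B"
    using ne dis by blast+
  have CD: "C \<in> ?Q" "D \<in> ?Q" using AB d by auto
  have "pmerge (d, C, D) (pmerge (c, A, B) ?Q) = pmerge (c, A, B) (pmerge (d, C, D) ?Q)"
    unfolding pmerge.simps using d by (intro insert_Diff_swap)
  moreover have "A \<in> pmerge (d, C, D) ?Q" "B \<in> pmerge (d, C, D) ?Q"
    using AB d by simp_all
  ultimately show ?thesis
    using F AB CD by (simp add: full_def del: pmerge.simps)
qed

lemma eqv_comm:
  assumes "(A \<union> B) \<inter> (C \<union> D) = {}"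
  shows "eqv (pre @ (c, A, B) # (d, C, D) # post) (pre @ (d, C, D) # (c, A, B) # post)"
proof -
  have assms': "(C \<union> D) \<inter> (A \<union> B) = {}" using assms by auto
  show ?thesis
    using full_comm[OF _ assms] full_comm[OF _ assms'] comm[OF _ assms] comm[OF _ assms']
    unfolding eqv_def by blast
qed

lemma eqv_past:
  assumes "(A \<union> B) \<inter> touched ms = {}"
  shows "eqv (pre @ (c, A, B) # ms @ post) (pre @ ms @ (c, A, B) # post)"
  using assms
proof (induction ms arbitrary: pre)
  case (Cons m ms)
  obtain d C D where m: "m = (d, C, D)" by (cases m)
  have "eqv (pre @ (c, A, B) # (d, C, D) # ms @ post) (pre @ (d, C, D) # (c, A, B) # ms @ post)"
    using Cons.prems by (intro eqv_comm) (auto simp: m)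
  also have "eqv ((pre @ [(d, C, D)]) @ (c, A, B) # ms @ post)
      ((pre @ [(d, C, D)]) @ ms @ (c, A, B) # post)"
    using Cons.prems by (intro Cons.IH) (auto simp: m)
  then have "eqv (pre @ (d, C, D) # (c, A, B) # ms @ post)
      (pre @ (d, C, D) # ms @ (c, A, B) # post)" by simp
  finally show ?case by (simp add: m)
qed simp

lemma eqv_swap:
  assumes "touched ms \<inter> touched ms' = {}"
  shows "eqv (pre @ ms @ ms' @ post) (pre @ ms' @ ms @ post)"
  using assms
proof (induction ms arbitrary: pre)
  case (Cons m ms)
  obtain c A B where m: "m = (c, A, B)" by (cases m)
  have "eqv ((pre @ [m]) @ ms @ ms' @ post) ((pre @ [m]) @ ms' @ ms @ post)"
    using Cons.prems by (intro Cons.IH) (auto simp: m)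
  also have "eqv (pre @ (c, A, B) # ms' @ (ms @ post)) (pre @ ms' @ (c, A, B) # (ms @ post))"
    using Cons.prems by (intro eqv_past) (auto simp: m)
  then have "eqv ((pre @ [m]) @ ms' @ ms @ post) (pre @ ms' @ m # ms @ post)"
    by (simp add: m)
  finally show ?case by simp
qed simp

lemma full_tree_cong:
  assumes "F (pre @ postorder s @ post)" "ready (run (singles n) pre) s"
    and "distinct (leaves t)" "labels t = labels s" "red_nodes t = red_nodes s"
  shows "F (pre @ postorder t @ post)"
proof -
  have P: "partition_on {1..n} (run (singles n) pre)"
    using assms(1) by (intro partition_on_run partition_on_singles) (simp add: full_def)
  have "ready (run (singles n) pre) t" using assms(2-4) by (simp add: ready_def)
  then show ?thesis
    using run_postorder[OF P assms(2)] run_postorder[OF P, of t] assms(1,4,5)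
    by (simp add: full_def)
qed

text \<open>The subtrees touch disjoint label sets, so their steps can be exchanged as a whole, and
  the merge at the root is symmetric.\<close>

lemma eqv_swap_children:
  assumes "labels l \<inter> labels r = {}"
  shows "eqv (pre @ postorder (Node c l r) @ post) (pre @ postorder (Node c r l) @ post)"
proof -
  have t: "touched (postorder l) \<inter> touched (postorder r) = {}"
    using assms touched_postorder by blast
  have "eqv (pre @ postorder l @ postorder r @ (c, labels l, labels r) # post)
      (pre @ postorder r @ postorder l @ (c, labels l, labels r) # post)"
    by (rule eqv_swap[OF t])
  also have "eqv ((pre @ postorder r @ postorder l) @ (c, labels l, labels r) # post)
      ((pre @ postorder r @ postorder l) @ (c, labels r, labels l) # post)"
    by (rule eqv_flip)
  then have "eqv (pre @ postorder r @ postorder l @ (c, labels l, labels r) # post)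
      (pre @ postorder r @ postorder l @ (c, labels r, labels l) # post)" by simp
  finally show ?thesis by simp
qed

text \<open>Up to commutations all trees involved first build \<open>l\<close>, \<open>a\<close> and
  \<open>b\<close> and then join these three blocks by two merges, which is where
  \<open>jacobi\<close> applies. The third group of alternatives keeps the bracketing and
  redistributes the colors.\<close>

lemma jacobi_tree:
  assumes F: "F (pre @ postorder (Node c l (Node e a b)) @ post)"
    and rd: "ready (run (singles n) pre) (Node c l (Node e a b))"
    and others: "\<And>c' d'. u c' + u d' = u e + u c \<Longrightarrow>
        P (pre @ postorder (Node d' (Node c' l a) b) @ post)"
      "\<And>c' d'. u c' + u d' = u e + u c \<Longrightarrow>
        P (pre @ postorder (Node d' (Node c' l b) a) @ post)"
      "\<And>c' d'. u c' + u d' = u e + u c \<Longrightarrow> (c', d') \<noteq> (e, c) \<Longrightarrow>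
        P (pre @ postorder (Node d' l (Node c' a b)) @ post)"
  shows "P (pre @ postorder (Node c l (Node e a b)) @ post)"
proof -
  let ?L = "labels l" and ?A = "labels a" and ?B = "labels b"
  let ?pre = "pre @ postorder l @ postorder a @ postorder b"
  have dis: "?L \<inter> ?A = {}" "?L \<inter> ?B = {}" "?A \<inter> ?B = {}"
    using rd by (auto simp: ready_def)
  have ne: "?L \<noteq> {}" "?A \<noteq> {}" "?B \<noteq> {}" by simp_all
  have reds: "red_nodes (Node d x (Node c y z)) = u c + u d + red_nodes x + red_nodes y + red_nodes z"
    "red_nodes (Node d (Node c x y) z) = u c + u d + red_nodes x + red_nodes y + red_nodes z"
    for c d x y z by (cases c; cases d; simp)+
  have tF: "F (pre @ postorder t @ post)"
    if "t \<in> {Node d' (Node c' l a) b, Node d' (Node c' l b) a, Node d' l (Node c' a b)}"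
      "u c' + u d' = u e + u c" for t c' d'
  proof (rule full_tree_cong[OF F rd])
    show "distinct (leaves t)" using that rd by (auto simp: ready_def)
    show "labels t = labels (Node c l (Node e a b))" using that by auto
    show "red_nodes t = red_nodes (Node c l (Node e a b))"
      using that by (auto simp: reds simp del: red_nodes.simps)
  qed
  have e0: "eqv (?pre @ (e', ?A, ?B) # (d', ?A \<union> ?B, ?L) # post)
      (pre @ postorder (Node d' l (Node e' a b)) @ post)" for e' d'
    using eqv_flip[of "?pre @ [(e', ?A, ?B)]" d' "?A \<union> ?B" ?L post] by simp
  have e1: "eqv (?pre @ (c', ?A, ?L) # (d', ?A \<union> ?L, ?B) # post)
      (pre @ postorder (Node d' (Node c' l a) b) @ post)" for c' d'
  proof -
    have "eqv (?pre @ (c', ?A, ?L) # (d', ?A \<union> ?L, ?B) # post)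
        (?pre @ (c', ?L, ?A) # (d', ?A \<union> ?L, ?B) # post)"
      by (rule eqv_flip)
    also have "eqv (?pre @ (c', ?L, ?A) # (d', ?A \<union> ?L, ?B) # post)
        ((pre @ postorder l @ postorder a) @ (c', ?L, ?A) # postorder b @ (d', ?A \<union> ?L, ?B) # post)"
      using eqv_sym[OF eqv_past[of ?L ?A "postorder b" "pre @ postorder l @ postorder a" c'
            "(d', ?A \<union> ?L, ?B) # post"]] touched_postorder[of b] dis by auto
    finally show ?thesis by (simp add: Un_commute)
  qed
  have e2: "eqv (?pre @ (c', ?B, ?L) # (d', ?B \<union> ?L, ?A) # post)
      (pre @ postorder (Node d' (Node c' l b) a) @ post)" for c' d'
  proof -
    have "eqv (?pre @ (c', ?B, ?L) # (d', ?B \<union> ?L, ?A) # post)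
        (?pre @ (c', ?L, ?B) # (d', ?B \<union> ?L, ?A) # post)"
      by (rule eqv_flip)
    \<comment> \<open>In \<open>Node d' (Node c' l b) a\<close> the merge of \<open>l\<close> and
      \<open>b\<close> precedes all of \<open>a\<close>, so it is carried past
      \<open>postorder a\<close> together with \<open>postorder b\<close>.\<close>
    also have "touched (postorder a) \<inter> touched (postorder b @ [(c', ?L, ?B)]) = {}"
      using touched_postorder[of b] touched_postorder[of a] dis by auto
    then have "eqv (?pre @ (c', ?L, ?B) # (d', ?B \<union> ?L, ?A) # post)
        ((pre @ postorder l) @ (postorder b @ [(c', ?L, ?B)]) @ postorder a @
          (d', ?B \<union> ?L, ?A) # post)"
      using eqv_swap[of "postorder a" "postorder b @ [(c', ?L, ?B)]" "pre @ postorder l"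
          "(d', ?B \<union> ?L, ?A) # post"] by simp
    finally show ?thesis by (simp add: Un_commute)
  qed
  have "P (?pre @ (e, ?A, ?B) # (c, ?A \<union> ?B, ?L) # post)"
  proof (rule jacobi)
    show "F (?pre @ (e, ?A, ?B) # (c, ?A \<union> ?B, ?L) # post)"
      using e0[of e c] F by (auto simp: eqv_def)
    show "?L \<inter> (?A \<union> ?B) = {}" using dis by auto
  next
    fix c' d' E G H
    assume in3: "(E, G, H) \<in> {(?A, ?B, ?L), (?A, ?L, ?B), (?B, ?L, ?A)}"
      and sum: "u c' + u d' = u e + u c" and ne': "(c', E, G) \<noteq> (e, ?A, ?B)"
    from in3 consider "E = ?A" "G = ?B" "H = ?L" | "E = ?A" "G = ?L" "H = ?B"
      | "E = ?B" "G = ?L" "H = ?A" by auto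
    then show "P (?pre @ (c', E, G) # (d', E \<union> G, H) # post)"
    proof cases
      case 1
      then have "(c', d') \<noteq> (e, c)" using ne' by auto
      then show ?thesis
        using eqvD[OF e0 tF[OF _ sum] others(3)[OF sum]] 1 by simp
    next
      case 2
      then show ?thesis using eqvD[OF e1 tF[OF _ sum] others(1)[OF sum]] by simp
    next
      case 3
      then show ?thesis using eqvD[OF e2 tF[OF _ sum] others(2)[OF sum]] by simp
    qed
  qed
  then show ?thesis
    using eqv_sym[OF e0[of e c]] e0[of e c] F by (auto simp: eqv_def)
qed

text \<open>The left subtree has fewer labels, so the induction hypothesis applies to it once all
  later steps are counted as part of \<open>post\<close>.\<close>

lemma straighten_node:
  assumes IHl: "\<And>l'. l' \<in> combs (labels l) (red_nodes l) \<Longrightarrow> P (pre @ postorder (Node c l' r) @ post)"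
    and F: "F (pre @ postorder (Node c l r) @ post)"
    and rd: "ready (run (singles n) pre) (Node c l r)"
    and IH: "\<And>pre post t. card (labels t) < card (labels (Node c l r)) \<Longrightarrow>
      F (pre @ postorder t @ post) \<Longrightarrow> ready (run (singles n) pre) t \<Longrightarrow>
      (\<And>w. w \<in> combs (labels t) (red_nodes t) \<Longrightarrow> P (pre @ postorder w @ post)) \<Longrightarrow>
      P (pre @ postorder t @ post)"
  shows "P (pre @ postorder (Node c l r) @ post)"
proof -
  have "hd (leaves r) \<in> labels r - labels l"
    using rd hd_leaves_in_labels[of r] unfolding ready_def leaves.simps distinct_append by blast
  then have "labels l \<subset> labels (Node c l r)" unfolding leaves.simps set_append by blast
  then have less: "card (labels l) < card (labels (Node c l r))"
    by (rule psubset_card_mono[rotated]) simp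
  have rdl: "ready (run (singles n) pre) l" using rd by (auto simp: ready_def)
  have "P (pre @ postorder l @ (postorder r @ (c, labels l, labels r) # post))"
  proof (rule IH[OF less _ rdl])
    show "F (pre @ postorder l @ (postorder r @ (c, labels l, labels r) # post))"
      using F by simp
    show "P (pre @ postorder w @ (postorder r @ (c, labels l, labels r) # post))"
      if "w \<in> combs (labels l) (red_nodes l)" for w
      using IHl[OF that] that by (simp add: combs_def)
  qed
  then show ?thesis by simp
qed

text \<open>Here the steps of the left subtree go into \<open>pre\<close>; they leave the leaves of
  \<open>r\<close> as singleton blocks, so \<open>r\<close> is still ready to be built.\<close>

lemma straighten_node_right:
  assumes IHr: "\<And>r'. r' \<in> combs (labels r) (red_nodes r) \<Longrightarrow> P (pre @ postorder (Node c l r') @ post)"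
    and F: "F (pre @ postorder (Node c l r) @ post)"
    and rd: "ready (run (singles n) pre) (Node c l r)"
    and IH: "\<And>pre post t. card (labels t) < card (labels (Node c l r)) \<Longrightarrow>
      F (pre @ postorder t @ post) \<Longrightarrow> ready (run (singles n) pre) t \<Longrightarrow>
      (\<And>w. w \<in> combs (labels t) (red_nodes t) \<Longrightarrow> P (pre @ postorder w @ post)) \<Longrightarrow>
      P (pre @ postorder t @ post)"
  shows "P (pre @ postorder (Node c l r) @ post)"
proof -
  have part: "partition_on {1..n} (run (singles n) pre)"
    using F by (intro partition_on_run partition_on_singles) (simp add: full_def)
  have rdl: "ready (run (singles n) pre) l" using rd by (auto simp: ready_def)
  have "hd (leaves l) \<in> labels l - labels r"
    using rd hd_leaves_in_labels[of l] unfolding ready_def leaves.simps distinct_append by blast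
  then have "labels r \<subset> labels (Node c l r)" unfolding leaves.simps set_append by blast
  then have less: "card (labels r) < card (labels (Node c l r))"
    by (rule psubset_card_mono[rotated]) simp
  have rdr: "ready (run (singles n) (pre @ postorder l)) r"
  proof -
    have dis: "labels l \<inter> labels r = {}" and "distinct (leaves r)"
      and sing: "\<forall>a\<in>labels r. {a} \<in> run (singles n) pre"
      using rd by (auto simp: ready_def)
    moreover have "{a} \<inter> labels l = {}" if "a \<in> labels r" for a using dis that by blast
    ultimately show ?thesis
      using run_postorder[OF part rdl] by (simp add: ready_def)
  qed
  have "P ((pre @ postorder l) @ postorder r @ ((c, labels l, labels r) # post))"
  proof (rule IH[OF less _ rdr])
    show "F ((pre @ postorder l) @ postorder r @ ((c, labels l, labels r) # post))"
      using F by simp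
    show "P ((pre @ postorder l) @ postorder w @ ((c, labels l, labels r) # post))"
      if "w \<in> combs (labels r) (red_nodes r)" for w
      using IHr[OF that] that by (simp add: combs_def)
  qed
  then show ?thesis by simp
qed

text \<open>Inner induction on the size of the right child. A Jacobi step at
  \<open>Node c l (Node e a b)\<close> leads to trees with right child \<open>a\<close> or
  \<open>b\<close>, which is smaller; their left child need not be a comb, but it has fewer labels
  than \<open>S\<close> and is straightened by \<open>IH\<close>. The remaining alternatives, with
  the same bracketing and other colors, occur only for a blue root over a red one, and there they
  lead to a red root, from which no further exchange arises.\<close>

lemma straighten_combs:
  assumes IH: "\<And>pre post t. card (labels t) < card S \<Longrightarrow>
      F (pre @ postorder t @ post) \<Longrightarrow> ready (run (singles n) pre) t \<Longrightarrow>
      (\<And>w. w \<in> combs (labels t) (red_nodes t) \<Longrightarrow> P (pre @ postorder w @ post)) \<Longrightarrow>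
      P (pre @ postorder t @ post)"
    and H: "\<And>w. w \<in> combs S k \<Longrightarrow> P (pre @ postorder w @ post)"
    and F: "\<And>t. distinct (leaves t) \<Longrightarrow> labels t = S \<Longrightarrow> red_nodes t = k \<Longrightarrow>
      F (pre @ postorder t @ post)"
    and rd: "\<And>a. a \<in> S \<Longrightarrow> {a} \<in> run (singles n) pre"
    and t: "distinct (leaves (Node c l r))" "labels (Node c l r) = S" "red_nodes (Node c l r) = k"
    and lr: "comb_shape l" "normalized l" "comb_shape r" "normalized r" "hd (leaves l) < hd (leaves r)"
  shows "P (pre @ postorder (Node c l r) @ post)"
  using t lr
proof (induction "length (leaves r)" arbitrary: c l r rule: less_induct)
  case less
  have rd': "ready (run (singles n) pre) t" if "distinct (leaves t)" "labels t = S" for t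
    using rd that by (simp add: ready_def)
  have reds: "red_nodes (Node d x (Node c y z)) = u c + u d + red_nodes x + red_nodes y + red_nodes z"
    "red_nodes (Node d (Node c x y) z) = u c + u d + red_nodes x + red_nodes y + red_nodes z"
    for c d x y z by (cases c; cases d; simp)+
  have nest: "P (pre @ postorder (Node d' (Node c' l y) z) @ post)"
    if z: "comb_shape z" "normalized z" "length (leaves z) < length (leaves r)"
        "hd (leaves l) < hd (leaves z)"
      and tr: "distinct (leaves (Node d' (Node c' l y) z))" "labels (Node d' (Node c' l y) z) = S"
        "red_nodes (Node d' (Node c' l y) z) = k" for d' c' l y z
  proof (rule straighten_node)
    fix l' assume l': "l' \<in> combs (labels (Node c' l y)) (red_nodes (Node c' l y))"
    show "P (pre @ postorder (Node d' l' z) @ post)"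
    proof (rule less.hyps[OF z(3)])
      \<comment> \<open>The new left child starts with the minimum of a set containing the first
        leaf of \<open>l\<close>, so the order of the two children at the root is kept.\<close>
      have "hd (leaves l') = Min (labels (Node c' l y))"
        using l' hd_leaves_normalized[of l'] by (auto simp: combs_def)
      also have "\<dots> \<le> hd (leaves l)" by (rule Min_le) auto
      finally show "hd (leaves l') < hd (leaves z)" using z(4) by simp
    qed (use l' tr z in \<open>auto simp: combs_def\<close>)
  next
    show "F (pre @ postorder (Node d' (Node c' l y) z) @ post)" by (rule F[OF tr])
    show "ready (run (singles n) pre) (Node d' (Node c' l y) z)" by (rule rd'[OF tr(1,2)])
  qed (rule IH, simp only: tr(2))
  have step: "P (pre @ postorder (Node c l (Node e a b)) @ post)"
    if tr: "distinct (leaves (Node c l (Node e a b)))" "labels (Node c l (Node e a b)) = S"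
        "red_nodes (Node c l (Node e a b)) = k"
      and sh: "comb_shape (Node e a b)" "normalized (Node e a b)"
        "hd (leaves l) < hd (leaves (Node e a b))"
      and len: "length (leaves (Node e a b)) = length (leaves r)"
      and others: "\<And>c' d'. u c' + u d' = u e + u c \<Longrightarrow> (c', d') \<noteq> (e, c) \<Longrightarrow>
        P (pre @ postorder (Node d' l (Node c' a b)) @ post)" for c l e a b
  proof (rule jacobi_tree[OF F[OF tr] rd'[OF tr(1,2)]])
    have ab: "comb_shape a" "comb_shape b" "normalized a" "normalized b"
      using sh by (auto simp: comb_shape_Node item_ok_iff normalized_Node)
    have lens: "length (leaves a) < length (leaves r)" "length (leaves b) < length (leaves r)"
      unfolding len[symmetric] by simp_all
    have hd: "hd (leaves l) < hd (leaves a)" using sh(3) by simp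
    moreover have "hd (leaves a) \<le> hd (leaves b)"
      using sh(2) normalized_Node_less[OF ab(3,4)] by simp
    ultimately have hd': "hd (leaves l) < hd (leaves b)" by simp
    fix c' d' assume sum: "u c' + u d' = u e + u c"
    show "P (pre @ postorder (Node d' (Node c' l a) b) @ post)"
    proof (rule nest[OF ab(2,4) lens(2) hd'])
      show "red_nodes (Node d' (Node c' l a) b) = k"
        using tr(3) sum by (simp add: reds del: red_nodes.simps)
    qed (use tr(1,2) in auto)
    show "P (pre @ postorder (Node d' (Node c' l b) a) @ post)"
    proof (rule nest[OF ab(1,3) lens(1) hd])
      show "red_nodes (Node d' (Node c' l b) a) = k"
        using tr(3) sum by (simp add: reds del: red_nodes.simps)
    qed (use tr(1,2) in auto)
  qed (rule others)
  have comb: "P (pre @ postorder (Node c l r) @ post)"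
    if "distinct (leaves (Node c l r))" "labels (Node c l r) = S" "red_nodes (Node c l r) = k"
      "comb_shape l" "normalized l" "normalized r" "hd (leaves l) < hd (leaves r)"
      "item_ok (c, r)" for c l r
    using that normalized_Node_less[of l r c] by (intro H) (auto simp: combs_def comb_shape_Node)
  \<comment> \<open>Under a red root, a red right child gives the total 2, which is distributed in
    only one way; in all other cases the tree is already a comb.\<close>
  have red: "P (pre @ postorder (Node Red l s) @ post)"
    if tr: "distinct (leaves (Node Red l s))" "labels (Node Red l s) = S"
        "red_nodes (Node Red l s) = k"
      and sh: "comb_shape l" "normalized l" "comb_shape s" "normalized s"
        "hd (leaves l) < hd (leaves s)"
      and len: "length (leaves s) = length (leaves r)" for l s
  proof (cases "item_ok (Red, s)")
    case True
    then show ?thesis using that by (intro comb)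
  next
    case False
    then obtain a b where s: "s = Node Red a b"
      using sh(3) by (cases s; auto simp: item_ok_iff) (metis color.exhaust)+
    show ?thesis unfolding s
    proof (rule step[OF tr[unfolded s] sh(3-5)[unfolded s] len[unfolded s]])
      fix c' d' assume "u c' + u d' = u Red + u Red" "(c', d') \<noteq> (Red, Red)"
      then have False by (cases c'; cases d') auto
      then show "P (pre @ postorder (Node d' l (Node c' a b)) @ post)" ..
    qed
  qed
  show ?case
  proof (cases c)
    case Red
    then show ?thesis using less.prems by (intro red[of l r, folded Red]) auto
  next
    case Blue
    show ?thesis
    proof (cases r)
      case (Leaf z)
      then show ?thesis using less.prems by (intro comb) (auto simp: item_ok_iff)
    next
      case (Node e a b)
      show ?thesis unfolding Node
      proof (rule step)
        fix c' d' assume cd: "u c' + u d' = u e + u c" "(c', d') \<noteq> (e, c)"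
        \<comment> \<open>Below a blue root the total is \<open>u e\<close>. Another distribution
          exists only for \<open>e = Red\<close>, and it moves the red color up to the root.\<close>
        then have "e = Red \<and> c' = Blue \<and> d' = Red"
          using Blue by (cases c'; cases d'; cases e) auto
        then have e: "e = Red" "c' = Blue" "d' = Red" by auto
        have tr: "distinct (leaves (Node Red l (Node Blue a b)))"
          "labels (Node Red l (Node Blue a b)) = S" "red_nodes (Node Red l (Node Blue a b)) = k"
          using less.prems by (auto simp: Node Blue e)
        \<comment> \<open>After recoloring, the right child need not be a comb, as \<open>b\<close>
          need not be a leaf. Straightening it first keeps its number of leaves, and
          \<open>red\<close> becomes applicable.\<close>
        have "P (pre @ postorder (Node Red l (Node Blue a b)) @ post)"
        proof (rule straighten_node_right)
          fix r' assume r': "r' \<in> combs (labels (Node Blue a b)) (red_nodes (Node Blue a b))"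
          show "P (pre @ postorder (Node Red l r') @ post)"
          proof (rule red)
            have lab: "labels r' = labels r" and dist: "distinct (leaves r')"
              using r' by (auto simp: combs_def Node)
            have "hd (leaves r') = hd (leaves r)"
              using r' less.prems lab by (simp add: combs_def hd_leaves_normalized)
            then show "hd (leaves l) < hd (leaves r')" using less.prems by simp
            show "length (leaves r') = length (leaves r)"
              using lab dist less.prems(1) by (simp flip: distinct_card)
            show "distinct (leaves (Node Red l r'))" "labels (Node Red l r') = S"
              using lab dist less.prems(1,2) by auto
            show "red_nodes (Node Red l r') = k" using r' tr(3) by (simp add: combs_def)
          qed (use r' less.prems in \<open>auto simp: combs_def\<close>)
        next
          show "F (pre @ postorder (Node Red l (Node Blue a b)) @ post)" by (rule F[OF tr])
          show "ready (run (singles n) pre) (Node Red l (Node Blue a b))" by (rule rd'[OF tr(1,2)])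
        qed (rule IH, simp only: tr(2))
        then show "P (pre @ postorder (Node d' l (Node c' a b)) @ post)" by (simp add: e)
      qed (use less.prems in \<open>auto simp: Node\<close>)
    qed
  qed
qed

text \<open>Induction on the number of labels: both children may be replaced by combs and, by
  symmetry of the root, ordered by their minima; what is left is the situation of
  \<open>straighten_combs\<close>.\<close>

lemma straighten:
  assumes "F (pre @ postorder t @ post)" "ready (run (singles n) pre) t"
    and "\<And>w. w \<in> combs (labels t) (red_nodes t) \<Longrightarrow> P (pre @ postorder w @ post)"
  shows "P (pre @ postorder t @ post)"
  using assms
proof (induction "card (labels t)" arbitrary: pre post t rule: less_induct)
  case less
  show ?case
  proof (cases t)
    case (Leaf a)
    then show ?thesis by (intro less.prems(3)) (auto simp: combs_def)
  next
    case (Node c l r)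
    note IH = less.hyps[unfolded Node]
    have dist: "distinct (leaves (Node c l r))" using less.prems(2) by (simp add: Node ready_def)
    have OK_F: "F (pre @ postorder s @ post)"
      if "distinct (leaves s)" "labels s = labels (Node c l r)"
        "red_nodes s = red_nodes (Node c l r)" for s
      using full_tree_cong[OF less.prems(1,2)] that by (simp add: Node)
    have sing: "{a} \<in> run (singles n) pre" if "a \<in> labels (Node c l r)" for a
      using less.prems(2) that by (auto simp: Node ready_def)
    have rd: "ready (run (singles n) pre) s"
      if "distinct (leaves s)" "labels s = labels (Node c l r)" for s
      using that sing by (simp add: ready_def)
    have H: "P (pre @ postorder w @ post)"
      if "w \<in> combs (labels (Node c l r)) (red_nodes (Node c l r))" for w
      using less.prems(3) that by (simp add: Node)
    show ?thesis unfolding Node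
    proof (rule straighten_node)
      fix l' assume l': "l' \<in> combs (labels l) (red_nodes l)"
      have tl: "distinct (leaves (Node c l' r))" "labels (Node c l' r) = labels (Node c l r)"
        "red_nodes (Node c l' r) = red_nodes (Node c l r)"
        using l' dist by (auto simp: combs_def)
      show "P (pre @ postorder (Node c l' r) @ post)"
      proof (rule straighten_node_right)
        fix r' assume r': "r' \<in> combs (labels r) (red_nodes r)"
        have tr: "distinct (leaves (Node c l' r'))" "labels (Node c l' r') = labels (Node c l r)"
          "red_nodes (Node c l' r') = red_nodes (Node c l r)"
          using r' tl l' by (auto simp: combs_def)
        have tr': "distinct (leaves (Node c r' l'))" "labels (Node c r' l') = labels (Node c l r)"
          "red_nodes (Node c r' l') = red_nodes (Node c l r)"
          using tr by auto
        have sh: "comb_shape l'" "normalized l'" "comb_shape r'" "normalized r'"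
          using l' r' by (auto simp: combs_def)
        have dis: "labels l' \<inter> labels r' = {}" using tr(1) by simp
        then have "hd (leaves l') \<noteq> hd (leaves r')"
          using hd_leaves_in_labels[of l'] hd_leaves_in_labels[of r'] by (metis IntI emptyE)
        then consider "hd (leaves l') < hd (leaves r')" | "hd (leaves r') < hd (leaves l')"
          by linarith
        then show "P (pre @ postorder (Node c l' r') @ post)"
        proof cases
          case 1
          show ?thesis by (rule straighten_combs[OF IH H OK_F sing tr sh 1])
        next
          case 2
          have "P (pre @ postorder (Node c r' l') @ post)"
            by (rule straighten_combs[OF IH H OK_F sing tr' sh(3,4,1,2) 2])
          then show ?thesis
            using eqv_swap_children[OF dis] OK_F[OF tr'] by (rule eqvD[rotated 2])
        qed
      next
        show "F (pre @ postorder (Node c l' r) @ post)" by (rule OK_F[OF tl])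
        show "ready (run (singles n) pre) (Node c l' r)" by (rule rd[OF tl(1,2)])
      qed (rule IH, simp only: tl(2))
    next
      show "F (pre @ postorder (Node c l r) @ post)" using less.prems(1) by (simp only: Node)
      show "ready (run (singles n) pre) (Node c l r)" using less.prems(2) by (simp only: Node)
    qed (rule IH)
  qed
qed

text \<open>Up to commutations a merge sequence builds one tree for each current block. When two
  blocks are merged, their trees are moved to the end, past trees with other labels, and the new
  merge completes the postorder of a larger tree.\<close>

lemma ex_forest:
  assumes "valid (singles n) ms"
  shows "\<exists>ts. distinct (concat (map leaves ts)) \<and> labels ` set ts = run (singles n) ms \<and>
    (\<Sum>t\<leftarrow>ts. red_nodes t) = reds ms \<and>
    (\<forall>post. eqv (ms @ post) (concat (map postorder ts) @ post))"
  using assms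
proof (induction ms rule: rev_induct)
  case Nil
  have "concat (map postorder (map Leaf xs)) = []" for xs
    by (induction xs) auto
  then have "eqv ([] @ post) (concat (map postorder (map Leaf [1..<n + 1])) @ post)" for post
    by (simp only: append_Nil eqv_refl)
  moreover have "concat (map leaves (map Leaf xs)) = xs" for xs
    by (induction xs) auto
  moreover have "(\<Sum>t\<leftarrow>map Leaf xs. red_nodes t) = 0" for xs
    by (induction xs) auto
  ultimately show ?case
  proof (intro exI[of _ "map Leaf [1..<n + 1]"] conjI allI)
    show "labels ` set (map Leaf [1..<n + 1]) = run (singles n) []"
      by (force simp: singles_def)
  qed (simp_all del: map_map)
next
  case (snoc m ms)
  obtain c A B where m: "m = (c, A, B)" by (cases m)
  let ?Q = "run (singles n) ms"
  have v: "valid (singles n) ms" "A \<in> ?Q" "B \<in> ?Q" "A \<noteq> B"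
    using snoc.prems by (auto simp: m)
  then obtain ts where ts: "distinct (concat (map leaves ts))" "labels ` set ts = ?Q"
    "(\<Sum>t\<leftarrow>ts. red_nodes t) = reds ms"
    "\<And>post. eqv (ms @ post) (concat (map postorder ts) @ post)"
    using snoc.IH by blast
  have to_end: "\<exists>us. set ts = insert t (set us) \<and> distinct (concat (map leaves (us @ [t]))) \<and>
      (\<Sum>t\<leftarrow>us. red_nodes t) + red_nodes t = (\<Sum>t\<leftarrow>ts. red_nodes t) \<and>
      (\<forall>post. eqv (concat (map postorder ts) @ post) (concat (map postorder us) @ postorder t @ post))"
    if t_in: "t \<in> set ts" and dist: "distinct (concat (map leaves ts))" for t and ts :: "bctree list"
  proof -
    obtain us vs where uv: "ts = us @ t # vs" using split_list[OF t_in] by blast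
    have "touched (concat (map postorder vs)) \<subseteq> set (concat (map leaves vs))" for vs
      using touched_postorder by (induction vs) auto
    moreover have "labels t \<inter> set (concat (map leaves vs)) = {}"
      using dist by (auto simp: uv)
    ultimately have "touched (postorder t) \<inter> touched (concat (map postorder vs)) = {}"
      using touched_postorder[of t] by blast
    then have "eqv (concat (map postorder us) @ postorder t @ concat (map postorder vs) @ post)
        (concat (map postorder us) @ concat (map postorder vs) @ postorder t @ post)" for post
      by (rule eqv_swap)
    moreover have "distinct (concat (map leaves ((us @ vs) @ [t])))"
      using dist by (auto simp: uv)
    ultimately show ?thesis by (intro exI[of _ "us @ vs"]) (simp add: uv)
  qed
  obtain tA tB where tAB: "tA \<in> set ts" "labels tA = A" "tB \<in> set ts" "labels tB = B"
    using v(2,3) unfolding ts(2)[symmetric] by auto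
  obtain us where us: "set ts = insert tA (set us)" "distinct (concat (map leaves (us @ [tA])))"
    "(\<Sum>t\<leftarrow>us. red_nodes t) + red_nodes tA = (\<Sum>t\<leftarrow>ts. red_nodes t)"
    "\<And>post. eqv (concat (map postorder ts) @ post)
      (concat (map postorder us) @ postorder tA @ post)"
    using to_end[OF tAB(1) ts(1)] by blast
  have dist_us: "distinct (concat (map leaves us))" "A \<inter> set (concat (map leaves us)) = {}"
    using us(2) by (auto simp: tAB)
  have "tB \<in> set us" using tAB us(1) v(4) by auto
  then obtain vs where vs: "set us = insert tB (set vs)" "distinct (concat (map leaves (vs @ [tB])))"
    "(\<Sum>t\<leftarrow>vs. red_nodes t) + red_nodes tB = (\<Sum>t\<leftarrow>us. red_nodes t)"
    "\<And>post. eqv (concat (map postorder us) @ post)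
      (concat (map postorder vs) @ postorder tB @ post)"
    using to_end[OF _ dist_us(1)] by blast
  have dist_vs: "distinct (concat (map leaves vs))" "B \<inter> set (concat (map leaves vs)) = {}"
    using vs(2) by (auto simp: tAB)
  have A_vs: "A \<inter> set (concat (map leaves vs)) = {}" "A \<inter> B = {}"
    using dist_us(2) vs(1) tAB by auto
  \<comment> \<open>\<open>tA\<close> is moved to the end first and \<open>tB\<close> then directly
    before it, so \<open>tB\<close> becomes the left child and the last merge has to be
    flipped.\<close>
  let ?ts = "vs @ [Node c tB tA]"
  show ?case
  proof (intro exI[of _ ?ts] conjI allI)
    show "distinct (concat (map leaves ?ts))"
      using us(2) dist_vs A_vs vs(2) by (auto simp: tAB)
    have "labels t \<noteq> A \<and> labels t \<noteq> B" if "t \<in> set vs" for t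
    proof -
      have "labels t \<subseteq> set (concat (map leaves vs))" using that by auto
      then show ?thesis using A_vs(1) dist_vs(2) hd_leaves_in_labels[of t] by blast
    qed
    then have "?Q - {A, B} = labels ` set vs"
      using us(1) vs(1) tAB by (auto simp flip: ts(2))
    then show "labels ` set ?ts = run (singles n) (ms @ [m])"
      by (auto simp: m tAB)
    show "(\<Sum>t\<leftarrow>?ts. red_nodes t) = reds (ms @ [m])"
      using us(3) vs(3) ts(3) by (cases c) (auto simp: m)
    fix post
    have "eqv (ms @ (c, A, B) # post) (concat (map postorder ts) @ (c, A, B) # post)"
      by (rule ts)
    also have "eqv (concat (map postorder ts) @ (c, A, B) # post)
        (concat (map postorder us) @ postorder tA @ (c, A, B) # post)"
      by (rule us)
    also have "eqv (concat (map postorder us) @ postorder tA @ (c, A, B) # post)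
        (concat (map postorder vs) @ postorder tB @ postorder tA @ (c, A, B) # post)"
      by (rule vs)
    also have "eqv ((concat (map postorder vs) @ postorder tB @ postorder tA) @ (c, A, B) # post)
        ((concat (map postorder vs) @ postorder tB @ postorder tA) @ (c, B, A) # post)"
      by (rule eqv_flip)
    then have "eqv (concat (map postorder vs) @ postorder tB @ postorder tA @ (c, A, B) # post)
        (concat (map postorder ?ts) @ post)"
      by (simp add: tAB)
    finally show "eqv ((ms @ [m]) @ post) (concat (map postorder ?ts) @ post)"
      by (simp add: m)
  qed
qed

theorem closed_if_combs:
  assumes "\<And>t. t \<in> combs {1..n} i \<Longrightarrow> P (postorder t)" and "F ms"
  shows "P ms"
proof -
  obtain ts where ts: "distinct (concat (map leaves ts))" "labels ` set ts = {{1..n}}"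
    "(\<Sum>t\<leftarrow>ts. red_nodes t) = i" "\<And>post. eqv (ms @ post) (concat (map postorder ts) @ post)"
    using ex_forest[of ms] assms(2) by (auto simp: full_def)
  have "length ts = 1"
  proof (rule ccontr)
    assume "length ts \<noteq> 1"
    then obtain s t us where "ts = s # t # us"
      using ts(2) by (cases ts; cases "tl ts") auto
    then have "labels s \<inter> labels t = {}" "labels s = labels t" using ts(1,2) by auto
    then show False using hd_leaves_in_labels[of s] by blast
  qed
  then obtain t where t: "ts = [t]" by (auto simp: length_Suc_conv)
  have eqv: "eqv ms (postorder t)" using ts(4)[of "[]"] by (simp add: t)
  have F: "F (postorder t)" using eqv assms(2) by (simp add: eqv_def)
  have "P ([] @ postorder t @ [])"
  proof (rule straighten)
    show "F ([] @ postorder t @ [])" using F by simp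
    show "ready (run (singles n) []) t"
      using ts(1,2) by (auto simp: t ready_def singles_def)
    show "P ([] @ postorder w @ [])" if "w \<in> combs (labels t) (red_nodes t)" for w
      using assms(1)[of w] that ts(2,3) by (simp add: t)
  qed
  then show ?thesis using eqvD[OF eqv F] by simp
qed

end

section \<open>Maximal intervals\<close>

lemma subblocks_self:
  assumes "\<alpha> \<in> wpartitions n" "S \<in> blocks \<alpha>"
  shows "subblocks \<alpha> S = {S}"
proof
  show "subblocks \<alpha> S \<subseteq> {S}"
  proof
    fix T assume "T \<in> subblocks \<alpha> S"
    then have T: "T \<in> blocks \<alpha>" "T \<subseteq> S" by (auto simp: subblocks_def)
    obtain x where "x \<in> T" using wpartitionsD(5)[OF assms(1) T(1)] by auto
    then have "T = S"
      using partition_on_block_eq[OF wpartitionsD(1)[OF assms(1)] T(1) assms(2)] T(2) by auto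
    then show "T \<in> {S}" by simp
  qed
qed (use assms in \<open>auto simp: subblocks_def\<close>)

lemma finite_wpartitions: "finite (wpartitions n)"
proof (rule finite_subset)
  show "wpartitions n \<subseteq> Pow (Pow {1..n} \<times> {0..n})"
  proof clarify
    fix \<alpha> B v assume \<alpha>: "\<alpha> \<in> wpartitions n" and Bv: "(B, v) \<in> \<alpha>"
    have B: "B \<subseteq> {1..n}"
      using partition_onD1[OF wpartitionsD(1)[OF \<alpha>]] blocksI[OF Bv] by blast
    have "v = weight \<alpha> B" using weight_eq[OF wpartitionsD(2)[OF \<alpha>] Bv] by simp
    then have "v < card B" using weight_less[OF \<alpha> blocksI[OF Bv]] by simp
    also have "card B \<le> n" using card_mono[OF _ B] by simp
    finally show "B \<in> Pow {1..n} \<and> v \<in> {0..n}" using B by auto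
  qed
qed simp

lemma merge_merge_commute:
  assumes \<alpha>: "\<alpha> \<in> wpartitions n" and AB: "A \<in> blocks \<alpha>" "B \<in> blocks \<alpha>" "A \<noteq> B"
    and CD: "C \<in> blocks \<alpha>" "D \<in> blocks \<alpha>" "C \<noteq> D" and dis: "(A \<union> B) \<inter> (C \<union> D) = {}"
    and kj: "k \<le> 1" "j \<le> 1"
  shows "merge k A B (merge j C D \<alpha>) = merge j C D (merge k A B \<alpha>)"
proof -
  interpret ab: two_blocks n \<alpha> A B using \<alpha> AB by unfold_locales
  interpret cd: two_blocks n \<alpha> C D using \<alpha> CD by unfold_locales
  have ne: "A \<noteq> {}" "B \<noteq> {}" "C \<noteq> {}" "D \<noteq> {}" using wpartitionsD(5)[OF \<alpha>] AB CD by auto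
  have d: "A \<noteq> C" "A \<noteq> D" "B \<noteq> C" "B \<noteq> D" "A \<union> B \<noteq> C" "A \<union> B \<noteq> D" "C \<union> D \<noteq> A" "C \<union> D \<noteq> B"
    "A \<union> B \<noteq> C \<union> D"
    using ne dis by blast+
  have ABne: "A \<union> B \<notin> blocks \<alpha> - {A, B}" "C \<union> D \<notin> blocks \<alpha> - {C, D}"
    using ab.union_notin cd.union_notin by auto
  interpret ab': two_blocks n "merge j C D \<alpha>" A B
    using cd.merge_in[OF kj(2)] AB d by unfold_locales auto
  interpret cd': two_blocks n "merge k A B \<alpha>" C D
    using ab.merge_in[OF kj(1)] CD d by unfold_locales auto
  show ?thesis
  proof (rule wpartition_eqI[OF ab'.inj_merge cd'.inj_merge])
    show bl: "blocks (merge k A B (merge j C D \<alpha>)) = blocks (merge j C D (merge k A B \<alpha>))"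
      unfolding blocks_merge by (rule insert_Diff_swap) (use d in auto)
    fix S assume "S \<in> blocks (merge j C D (merge k A B \<alpha>))"
    then consider "S = C \<union> D" | "S = A \<union> B"
      | "S \<in> blocks \<alpha>" "S \<noteq> A" "S \<noteq> B" "S \<noteq> C" "S \<noteq> D" by auto
    then show "weight (merge k A B (merge j C D \<alpha>)) S = weight (merge j C D (merge k A B \<alpha>)) S"
    proof cases
      case 1
      then show ?thesis
        using d CD ab'.weight_merge(2)[of "C \<union> D" k]
        by (simp add: cd'.weight_merge(1) cd.weight_merge(1) ab.weight_merge(2))
    next
      case 2
      then show ?thesis
        using d AB cd'.weight_merge(2)[of "A \<union> B" j]
        by (simp add: ab'.weight_merge(1) ab.weight_merge(1) cd.weight_merge(2))
    next
      case 3
      then show ?thesis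
        by (simp add: ab'.weight_merge(2) ab.weight_merge(2) cd.weight_merge(2) cd'.weight_merge(2))
    qed
  qed
qed

lemma blocks_bot: "blocks (wp_bot n) = singles n"
  by (auto simp: blocks_def wp_bot_def singles_def image_image)

lemma mem_bot:
  assumes "A \<in> blocks (wp_bot n)"
  shows "(A, 0) \<in> wp_bot n" "card A = 1"
proof -
  have "A \<in> singles n" using assms by (simp add: blocks_bot)
  then show "(A, 0) \<in> wp_bot n" "card A = 1" by (auto simp: singles_def wp_bot_def)
qed

lemma bot_in: "wp_bot n \<in> wpartitions n"
proof (rule wpartitionsI)
  show "partition_on {1..n} (blocks (wp_bot n))"
    unfolding blocks_bot by (rule partition_on_singles)
  show inj: "inj_on fst (wp_bot n)" by (auto simp: wp_bot_def inj_on_def)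
  fix A assume "A \<in> blocks (wp_bot n)"
  then show "weight (wp_bot n) A < card A" using weight_eq[OF inj mem_bot(1)] mem_bot(2) by simp
qed

lemma card_bot: "card (wp_bot n) = n"
  unfolding wp_bot_def by (subst card_image) (auto simp: inj_on_def)

lemma total_weight_bot: "total_weight (wp_bot n) = 0"
  unfolding total_weight_def
proof (rule sum.neutral, rule ballI)
  fix A assume "A \<in> blocks (wp_bot n)"
  then have "(A, 0) \<in> wp_bot n" by (rule mem_bot)
  then show "weight (wp_bot n) A = 0"
    by (rule weight_eq[OF wpartitionsD(2)[OF bot_in]])
qed

text \<open>For \<open>n = 1\<close> bottom and top coincide; that degenerate interval is treated
  separately in \<open>wp_cohomology_basis\<close>.\<close>

locale weighted_interval =
  fixes n i :: nat
  assumes n2: "2 \<le> n" and i: "i \<le> n - 1"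
begin

abbreviation "lt \<equiv> wp_less n"
abbreviation "lo \<equiv> wp_bot n"
abbreviation "hi \<equiv> wp_top n i"

definition inside :: "wpartition set" where
  "inside = {z \<in> wpartitions n. lt lo z \<and> lt z hi}"

text \<open>The endpoints are removed by position, which suits computations with concatenated
  sequences; \<open>open_tree_chain_eq\<close> links this to the removal by value in
  \<open>open_tree_chain\<close>.\<close>

definition inner :: "step list \<Rightarrow> wpartition list" where
  "inner ms = butlast (tl (merge_chain lo ms))"

lemma blocks_top: "blocks hi = {{1..n}}"
  by (simp add: blocks_def wp_top_def)

lemma weight_top: "weight hi {1..n} = i"
  by (rule weight_eq) (simp_all add: wp_top_def)

lemma top_in: "hi \<in> wpartitions n"
proof (rule wpartitionsI)
  show "partition_on {1..n} (blocks hi)"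
    unfolding blocks_top using n2 by (intro partition_on_space) auto
  show "inj_on fst hi" by (simp add: wp_top_def)
  show "weight hi A < card A" if "A \<in> blocks hi" for A
    using that i n2 weight_top by (auto simp: blocks_top)
qed

lemma card_top: "card hi = 1"
  by (simp add: wp_top_def)

text \<open>An element with a single block is determined by its total weight, and that is the number
  of red steps.\<close>

lemma wrun_eq_top_iff:
  assumes "valid (singles n) ms"
  shows "wrun lo ms = hi \<longleftrightarrow> full n i ms"
proof -
  have v: "valid (blocks lo) ms" using assms by (simp add: blocks_bot)
  have bl: "blocks (wrun lo ms) = run (singles n) ms" by (simp add: blocks_wrun blocks_bot)
  have tw: "total_weight (wrun lo ms) = reds ms"
    using total_weight_wrun[OF bot_in v] by (simp add: total_weight_bot)
  show ?thesis
  proof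
    assume eq: "wrun lo ms = hi"
    have "total_weight hi = i"
      using weight_top by (simp add: total_weight_def blocks_top)
    then show "full n i ms" using assms bl tw by (simp add: full_def eq blocks_top)
  next
    assume F: "full n i ms"
    then have bl': "blocks (wrun lo ms) = {{1..n}}" using bl by (simp add: full_def)
    then have "weight (wrun lo ms) {1..n} = i"
      using tw F by (simp add: total_weight_def full_def)
    then show "wrun lo ms = hi"
      using bl' wpartitionsD(2)[OF wrun_in[OF bot_in v]] wpartitionsD(2)[OF top_in]
      using weight_top by (intro wpartition_eqI) (auto simp: blocks_top)
  qed
qed

lemma length_full: "full n i ms \<Longrightarrow> length ms = n - 1"
  using card_wrun[OF bot_in, of n ms] wrun_eq_top_iff[of ms]
  by (auto simp: full_def blocks_bot card_top card_bot)

lemma merge_chain_full: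
  assumes "full n i ms"
  shows "merge_chain lo ms = lo # inner ms @ [hi]"
proof -
  have ne: "tl (merge_chain lo ms) \<noteq> []"
    using length_full[OF assms] n2 by (auto simp: tl_Nil dest: arg_cong[where f = length])
  have "last (merge_chain lo ms) = hi"
    using assms wrun_eq_top_iff by (simp add: last_merge_chain full_def)
  then have "last (tl (merge_chain lo ms)) = hi" using ne by (simp add: last_tl)
  then have "tl (merge_chain lo ms) = inner ms @ [hi]"
    using ne append_butlast_last_id[OF ne] by (simp add: inner_def)
  then show ?thesis using merge_chain_Cons[of lo ms] by simp
qed

lemma inner_in_chains:
  assumes "full n i ms"
  shows "inner ms \<in> chains inside lt (int n - 3)"
proof -
  have "valid (blocks lo) ms" using assms by (simp add: full_def blocks_bot)
  from sorted_merge_chain[OF bot_in this]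
  have "sorted_wrt lt (lo # inner ms @ [hi])" "set (inner ms) \<subseteq> wpartitions n"
    unfolding merge_chain_full[OF assms] by auto
  moreover have "Suc (Suc (length (inner ms))) = Suc (n - 1)"
    using arg_cong[OF merge_chain_full[OF assms], of length] length_full[OF assms] by simp
  ultimately show ?thesis
    using n2 by (auto simp: chains_def inside_def sorted_wrt_append)
qed

lemma bot_less_top: "lt lo hi"
proof -
  have sub: "subblocks lo {1..n} = singles n"
    by (auto simp: subblocks_def blocks_bot singles_def)
  have w: "(\<Sum>A\<in>singles n. weight lo A) = 0"
    using total_weight_bot[of n] by (simp add: total_weight_def blocks_bot)
  have c: "card (singles n) = n"
    using card_blocks[OF bot_in, of n] by (simp add: blocks_bot card_bot)
  have "refines {1..n} (singles n) {{1..n}}"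
    using partition_on_singles[of n] n2 by (auto simp: refines_def singles_def intro!: partition_on_space)
  then have "wp_le n lo hi"
    using i n2 unfolding wp_le_iff[OF bot_in top_in]
    by (simp only: blocks_bot blocks_top sub w c weight_top ball_simps) simp
  moreover have "lo \<noteq> hi"
    using n2 card_bot[of n] card_top by auto
  ultimately show ?thesis by (simp add: wp_less_def)
qed

lemma sorted_extend:
  assumes "set c \<subseteq> inside" "sorted_wrt lt c"
  shows "sorted_wrt lt (lo # c @ [hi])" "set (lo # c @ [hi]) \<subseteq> wpartitions n"
proof -
  show "sorted_wrt lt (lo # c @ [hi])"
    using assms bot_less_top by (auto simp: sorted_wrt_append inside_def)
  show "set (lo # c @ [hi]) \<subseteq> wpartitions n"
    using assms bot_in top_in by (auto simp: inside_def)
qed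

text \<open>With its endpoints the chain has \<open>n\<close> elements and goes from
  \<open>n\<close> blocks down to one, so every step loses exactly one block.\<close>

lemma card_in_chain:
  assumes c: "c \<in> chains inside lt (int n - 3)" and k: "k < n"
  shows "card ((lo # c @ [hi]) ! k) = n - k"
proof -
  let ?xs = "lo # c @ [hi]"
  have c': "set c \<subseteq> inside" "sorted_wrt lt c" and len: "length c = n - 2"
    using c n2 by (auto simp: chains_def)
  note sorted = sorted_card[OF sorted_extend[OF c']]
  have "length ?xs = n" using len n2 by simp
  moreover have "?xs ! 0 = lo" "?xs ! (n - 1) = hi"
    using len n2 by (auto simp: nth_Cons' nth_append)
  moreover have "card (?xs ! k) + (k - 0) \<le> card (?xs ! 0)"
    using k calculation by (intro sorted) auto
  moreover have "card (?xs ! (n - 1)) + (n - 1 - k) \<le> card (?xs ! k)"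
    using k calculation by (intro sorted) auto
  ultimately show ?thesis using k by (simp add: card_bot card_top)
qed

lemma ex_full:
  assumes c: "c \<in> chains inside lt (int n - 3)"
  shows "\<exists>ms. full n i ms \<and> inner ms = c"
proof -
  have c': "set c \<subseteq> inside" "sorted_wrt lt c" and len: "length c = n - 2"
    using c n2 by (auto simp: chains_def)
  have "\<exists>ms. valid (blocks lo) ms \<and> merge_chain lo ms = lo # (c @ [hi])"
  proof (rule ex_merge_chain)
    show "card ((lo # c @ [hi]) ! k) = card ((lo # c @ [hi]) ! Suc k) + 1"
      if "k < length (c @ [hi])" for k
      using card_in_chain[OF c, of k] card_in_chain[OF c, of "Suc k"] that len n2 by simp
  qed (use sorted_extend[OF c'] in auto)
  then obtain ms where ms: "valid (singles n) ms" "merge_chain lo ms = lo # (c @ [hi])"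
    by (auto simp: blocks_bot)
  have "wrun lo ms = hi" using ms(2) last_merge_chain[of lo ms] by simp
  then have "full n i ms" using wrun_eq_top_iff[OF ms(1)] by simp
  moreover have "inner ms = c" using ms(2) by (simp add: inner_def butlast_append)
  ultimately show ?thesis by blast
qed

lemma gap_iff:
  assumes "k \<le> length c"
  shows "\<gamma> \<in> gap inside lt c k \<longleftrightarrow>
    \<gamma> \<in> inside \<and> lt ((lo # c @ [hi]) ! k) \<gamma> \<and> lt \<gamma> ((lo # c @ [hi]) ! Suc k)"
  using assms by (cases k) (auto simp: gap_def inside_def nth_append)

lemma gap_empty:
  assumes c: "set c \<subseteq> inside" "sorted_wrt lt c" and k: "k \<le> length c"
    and card: "card ((lo # c @ [hi]) ! k) \<le> card ((lo # c @ [hi]) ! Suc k) + 1"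
  shows "gap inside lt c k = {}"
proof -
  let ?xs = "lo # c @ [hi]"
  have False if \<gamma>: "\<gamma> \<in> gap inside lt c k" for \<gamma>
  proof -
    have "?xs ! k \<in> wpartitions n" "?xs ! Suc k \<in> wpartitions n"
      using sorted_extend(2)[OF c] nth_mem[of k ?xs] nth_mem[of "Suc k" ?xs] k
      unfolding length_Cons length_append by (simp_all only: subset_iff list.size add_0_right)
    moreover have "\<gamma> \<in> wpartitions n" "lt (?xs ! k) \<gamma>" "lt \<gamma> (?xs ! Suc k)"
      using iffD1[OF gap_iff[OF k] \<gamma>] unfolding inside_def by blast+
    ultimately have "card \<gamma> < card (?xs ! k)" "card (?xs ! Suc k) < card \<gamma>"
      by (blast intro: card_less_of_wp_less)+
    then show False using card by linarith
  qed
  then show ?thesis by blast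
qed

text \<open>No block number is skipped, so nothing fits in between. As a consequence every cochain
  of top degree is a cocycle.\<close>

lemma gap_empty_of_maximal:
  assumes c: "c \<in> chains inside lt (int n - 3)" and k: "k \<le> length c"
  shows "gap inside lt c k = {}"
proof (rule gap_empty[OF _ _ k])
  show "set c \<subseteq> inside" "sorted_wrt lt c" using c by (auto simp: chains_def)
  have "length c = n - 2" using c n2 by (auto simp: chains_def)
  then show "card ((lo # c @ [hi]) ! k) \<le> card ((lo # c @ [hi]) ! Suc k) + 1"
    using card_in_chain[OF c, of k] card_in_chain[OF c, of "Suc k"] k n2 by simp
qed

end

section \<open>Relations between maximal chains\<close>

lemma fscale_add_right: "fscale a (f + g) = fscale a f + fscale a g"
  by (rule poly_mapping_eqI) (simp add: lookup_add algebra_simps)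

lemma fscale_add_left: "fscale (a + b) f = fscale a f + fscale b f"
  by (rule poly_mapping_eqI) (simp add: lookup_add algebra_simps)

lemma fscale_fscale: "fscale a (fscale b f) = fscale (a * b) f"
  by (rule poly_mapping_eqI) (simp add: algebra_simps)

lemma fscale_1 [simp]: "fscale 1 f = f"
  by (rule poly_mapping_eqI) simp

lemma fscale_0 [simp]: "fscale a 0 = 0" "fscale 0 f = 0"
  by (rule poly_mapping_eqI, simp)+

lemma fscale_sum: "fscale a (\<Sum>x\<in>S. f x) = (\<Sum>x\<in>S. fscale a (f x))"
  by (induction S rule: infinite_finite_induct) (auto simp: fscale_add_right)

lemma fscale_single: "fscale a (Poly_Mapping.single c b) = Poly_Mapping.single c (a * b)"
  by (rule poly_mapping_eqI) (simp add: lookup_single when_def)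

lemma fscale_minus: "fscale (- 1) f = - f"
  by (rule poly_mapping_eqI) simp

lemma sum_single: "f = (\<Sum>c\<in>Poly_Mapping.keys f. Poly_Mapping.single c (Poly_Mapping.lookup f c))"
proof (rule poly_mapping_eqI)
  fix x
  have "(\<Sum>c\<in>Poly_Mapping.keys f. Poly_Mapping.lookup f c when c = x) = Poly_Mapping.lookup f x"
    by (simp add: when_def in_keys_iff)
  then show "Poly_Mapping.lookup f x = Poly_Mapping.lookup
      (\<Sum>c\<in>Poly_Mapping.keys f. Poly_Mapping.single c (Poly_Mapping.lookup f c)) x"
    by (simp add: lookup_sum lookup_single)
qed

lemma keys_fscale: "Poly_Mapping.keys (fscale a f) \<subseteq> Poly_Mapping.keys f"
  by (auto simp: in_keys_iff)

definition chain_coboundary ::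
  "'a set \<Rightarrow> ('a \<Rightarrow> 'a \<Rightarrow> bool) \<Rightarrow> 'a list \<Rightarrow> ('a list \<Rightarrow>\<^sub>0 'k::comm_ring_1)" where
  "chain_coboundary P lt c = (\<Sum>i\<le>length c. \<Sum>\<alpha>\<in>gap P lt c i.
     Poly_Mapping.single (take i c @ \<alpha> # drop i c) ((- 1) ^ i))"

lemma coboundary_eq:
  assumes "finite S" "Poly_Mapping.keys f \<subseteq> S"
  shows "coboundary P lt f = (\<Sum>c\<in>S. fscale (Poly_Mapping.lookup f c) (chain_coboundary P lt c))"
proof -
  have "coboundary P lt f =
      (\<Sum>c\<in>Poly_Mapping.keys f. fscale (Poly_Mapping.lookup f c) (chain_coboundary P lt c))"
    by (simp add: coboundary_def chain_coboundary_def fscale_sum fscale_single mult.commute)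
  also have "\<dots> = (\<Sum>c\<in>S. fscale (Poly_Mapping.lookup f c) (chain_coboundary P lt c))"
    using assms by (intro sum.mono_neutral_left) (auto simp: in_keys_iff)
  finally show ?thesis .
qed

lemma coboundary_add: "coboundary P lt (f + g) = coboundary P lt f + coboundary P lt g"
proof -
  let ?S = "Poly_Mapping.keys f \<union> Poly_Mapping.keys g"
  have "Poly_Mapping.keys (f + g) \<subseteq> ?S" by (rule keys_add)
  then show ?thesis
    by (simp add: coboundary_eq[of ?S] lookup_add fscale_add_left sum.distrib)
qed

lemma coboundary_fscale: "coboundary P lt (fscale a f) = fscale a (coboundary P lt f)"
  using keys_fscale[of a f]
  by (simp add: coboundary_eq[of "Poly_Mapping.keys f"] fscale_sum fscale_fscale)

lemma coboundary_0 [simp]: "coboundary P lt 0 = 0"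
  by (simp add: coboundary_def)

lemma coboundary_single: "coboundary P lt (Poly_Mapping.single c 1) = chain_coboundary P lt c"
  by (simp add: coboundary_eq[of "{c}"])

lemma cochains_closed:
  "0 \<in> cochains P lt r"
  "f \<in> cochains P lt r \<Longrightarrow> g \<in> cochains P lt r \<Longrightarrow> f + g \<in> cochains P lt r"
  "f \<in> cochains P lt r \<Longrightarrow> fscale a f \<in> cochains P lt r"
  using keys_add[of f g] keys_fscale[of a f] by (auto simp: cochains_def)

lemma coboundaries_closed:
  assumes "B = coboundary P lt ` cochains P lt r"
  shows "0 \<in> B" "f \<in> B \<Longrightarrow> g \<in> B \<Longrightarrow> f + g \<in> B" "f \<in> B \<Longrightarrow> fscale a f \<in> B"
proof -
  show "0 \<in> B" unfolding assms using cochains_closed(1) by (rule image_eqI[rotated]) simp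
  show "f + g \<in> B" if "f \<in> B" "g \<in> B"
    using that cochains_closed(2) unfolding assms by (auto simp flip: coboundary_add intro!: imageI)
  show "fscale a f \<in> B" if "f \<in> B"
    using that cochains_closed(3) unfolding assms by (auto simp flip: coboundary_fscale intro!: imageI)
qed

text \<open>A submodule above the coboundaries; the aim is that it contains all top cochains as soon
  as it contains the combs. It will be the set of sums of a combination of combs and a
  coboundary.\<close>

locale chain_module = weighted_interval +
  fixes M :: "(wpartition list \<Rightarrow>\<^sub>0 'k::comm_ring_1) set"
  assumes M_0: "0 \<in> M" and M_add: "\<And>f g. f \<in> M \<Longrightarrow> g \<in> M \<Longrightarrow> f + g \<in> M"
    and M_fscale: "\<And>a f. f \<in> M \<Longrightarrow> fscale a f \<in> M"
    and coboundaries: "coboundary inside lt ` cochains inside lt (int n - 4) \<subseteq> M"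
begin

lemma M_sum: "(\<And>x. x \<in> S \<Longrightarrow> f x \<in> M) \<Longrightarrow> (\<Sum>x\<in>S. f x) \<in> M"
  by (induction S rule: infinite_finite_induct) (auto simp: M_0 M_add)

lemma merge_chain_split:
  "merge_chain lo (pre @ m1 # m2 # post) =
    merge_chain lo pre @ wrun (wrun lo pre) [m1] # merge_chain (wrun (wrun lo pre) [m1, m2]) post"
proof -
  obtain c A B d C D where m: "m1 = (c, A, B)" "m2 = (d, C, D)" by (cases m1; cases m2)
  have "butlast (merge_chain lo pre) @ [wrun lo pre] = merge_chain lo pre"
    using append_butlast_last_id[of "merge_chain lo pre"] by (simp add: last_merge_chain)
  then have "butlast (merge_chain lo pre) @ wrun lo pre # ys = merge_chain lo pre @ ys" for ys
    by (metis append.assoc append_Cons append_Nil)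
  then show ?thesis by (simp add: m merge_chain_append)
qed

lemma inner_split:
  "inner (pre @ m1 # m2 # post) = tl (merge_chain lo pre) @ wrun (wrun lo pre) [m1] #
    butlast (merge_chain (wrun (wrun lo pre) [m1, m2]) post)"
  unfolding inner_def merge_chain_split by (simp add: butlast_append)

text \<open>Without its element after \<open>pre\<close> and \<open>m1\<close>, the chain has one
  gap left, the open interval from \<open>wrun lo pre\<close> to the element two merges above. Up to
  the common sign \<open>(- 1) ^ length pre\<close>, the coboundary of the shortened chain is the
  sum of all maximal chains through this interval, and it lies in \<open>M\<close>.\<close>

lemma local_relation:
  assumes F: "full n i (pre @ m1 # m2 # post)"
    and others: "\<And>m1' m2'. valid (run (singles n) pre) [m1', m2'] \<Longrightarrow>
      wrun (wrun lo pre) [m1', m2'] = wrun (wrun lo pre) [m1, m2] \<Longrightarrow>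
      wrun (wrun lo pre) [m1'] \<noteq> wrun (wrun lo pre) [m1] \<Longrightarrow>
      Poly_Mapping.single (inner (pre @ m1' # m2' # post)) 1 \<in> M"
  shows "Poly_Mapping.single (inner (pre @ m1 # m2 # post)) 1 \<in> M"
proof -
  let ?\<alpha> = "wrun lo pre"
  let ?\<gamma>0 = "wrun ?\<alpha> [m1]" and ?\<beta> = "wrun ?\<alpha> [m1, m2]"
  obtain us where mc: "merge_chain lo pre = lo # us" using merge_chain_Cons[of lo pre] by blast
  define vs where "vs = butlast (merge_chain ?\<beta> post)"
  define c where "c = us @ vs"
  let ?k = "length pre"
  let ?ins = "\<lambda>\<gamma>. us @ \<gamma> # vs"
  have inner0: "inner (pre @ m1 # m2 # post) = ?ins ?\<gamma>0"
    unfolding inner_split by (simp add: mc vs_def)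
  have chain: "?ins ?\<gamma>0 \<in> chains inside lt (int n - 3)"
    using inner_in_chains[OF F] by (simp only: inner0)
  have len: "length c + 3 = n"
    using chain n2 by (simp add: chains_def c_def)
  have c: "c \<in> chains inside lt (int n - 4)" "set c \<subseteq> inside" "sorted_wrt lt c"
    using chain by (auto simp: chains_def c_def sorted_wrt_append)
  have \<gamma>0: "?\<gamma>0 \<in> inside" using chain by (auto simp: chains_def)
  have v: "valid (singles n) pre" "valid (run (singles n) pre) [m1, m2]"
    using F by (cases m1; cases m2; simp add: full_def)+
  have \<alpha>: "?\<alpha> \<in> wpartitions n" using wrun_in[OF bot_in] v(1) by (simp add: blocks_bot)
  have bl: "blocks ?\<alpha> = run (singles n) pre" by (simp add: blocks_wrun blocks_bot)
  have \<beta>: "?\<beta> \<in> wpartitions n" using wrun_in[OF \<alpha>] v(2) by (simp only: bl)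
  have card\<beta>: "card ?\<beta> + 2 = card ?\<alpha>" using card_wrun[OF \<alpha>, of "[m1, m2]"] v(2) bl by simp
  let ?xs = "lo # us @ vs @ [hi]"
  have "merge_chain lo (pre @ m1 # m2 # post) = lo # ?ins ?\<gamma>0 @ [hi]"
    using merge_chain_full[OF F] by (simp only: inner0)
  then have vs: "merge_chain ?\<beta> post = vs @ [hi]"
    unfolding merge_chain_split mc by simp
  have len_us: "length us = ?k" using arg_cong[OF mc, of length] by simp
  \<comment> \<open>The block numbers along the shortened chain are read off from the full chain:
    same index before the removed element, index shifted by one after it.\<close>
  have nth_low: "?xs ! j = (lo # ?ins ?\<gamma>0 @ [hi]) ! j" if "j \<le> ?k" for j
    using that len_us by (auto simp: nth_append nth_Cons')
  have nth_high: "?xs ! j = (lo # ?ins ?\<gamma>0 @ [hi]) ! Suc j" if "j > ?k" for j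
  proof -
    have "?xs ! j = (vs @ [hi]) ! (j - Suc ?k)"
      using that nth_append[of "lo # us" "vs @ [hi]" j] len_us by simp
    moreover have "(lo # ?ins ?\<gamma>0 @ [hi]) ! Suc j = (vs @ [hi]) ! (j - Suc ?k)"
      using that nth_append[of "lo # us" "?\<gamma>0 # vs @ [hi]" "Suc j"]
      by (simp add: len_us Suc_diff_Suc[symmetric] Suc_diff_le)
    ultimately show ?thesis by simp
  qed
  have at_k: "?xs ! ?k = ?\<alpha>" "?xs ! Suc ?k = ?\<beta>"
  proof -
    have "?xs ! ?k = merge_chain lo pre ! ?k"
      unfolding mc using nth_append[of "lo # us" "vs @ [hi]" ?k] len_us by simp
    then show "?xs ! ?k = ?\<alpha>" by (simp add: merge_chain_nth)
    have "?xs ! Suc ?k = merge_chain ?\<beta> post ! 0"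
      unfolding vs using nth_append[of "lo # us" "vs @ [hi]" "Suc ?k"] len_us by simp
    then show "?xs ! Suc ?k = ?\<beta>" by (simp add: merge_chain_nth)
  qed
  have gap0: "gap inside lt c j = {}" if j: "j \<le> length c" "j \<noteq> ?k" for j
  proof (rule gap_empty[OF c(2,3) j(1)])
    have "card ((lo # ?ins ?\<gamma>0 @ [hi]) ! j) = n - j" if "j < n" for j
      by (rule card_in_chain[OF chain that])
    then have card: "card ((lo # ?ins ?\<gamma>0 @ [hi]) ! l) = n - l" if "l < n" for l using that .
    have eq: "lo # c @ [hi] = ?xs" by (simp add: c_def)
    have "j < ?k \<or> ?k < j" using j(2) by linarith
    then obtain l where l: "Suc l < n" "?xs ! j = (lo # ?ins ?\<gamma>0 @ [hi]) ! l"
      "?xs ! Suc j = (lo # ?ins ?\<gamma>0 @ [hi]) ! Suc l"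
    proof
      assume "j < ?k"
      then show thesis using j(1) len nth_low[of j] nth_low[of "Suc j"] by (intro that[of j]) auto
    next
      assume "?k < j"
      then show thesis
        using j(1) len nth_high[of j] nth_high[of "Suc j"] by (intro that[of "Suc j"]) auto
    qed
    then show "card ((lo # c @ [hi]) ! j) \<le> card ((lo # c @ [hi]) ! Suc j) + 1"
      unfolding eq l(2,3) using card[of l] card[of "Suc l"] by linarith
  qed
  have k: "?k \<le> length c" by (simp add: c_def len_us)
  have gapk: "\<gamma> \<in> gap inside lt c ?k \<longleftrightarrow> \<gamma> \<in> inside \<and> lt ?\<alpha> \<gamma> \<and> lt \<gamma> ?\<beta>" for \<gamma>
    unfolding gap_iff[OF k] using at_k by (simp add: c_def)
  have take_drop: "take ?k c @ \<gamma> # drop ?k c = ?ins \<gamma>" for \<gamma> by (simp add: c_def len_us)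
  have fin: "finite (gap inside lt c ?k)"
    by (rule finite_subset[OF _ finite_wpartitions[of n]]) (auto simp: gap_def inside_def)
  have in0: "?\<gamma>0 \<in> gap inside lt c ?k"
  proof -
    obtain a A B d C D where m: "m1 = (a, A, B)" "m2 = (d, C, D)" by (cases m1; cases m2)
    have "sorted_wrt lt (merge_chain ?\<alpha> [m1, m2])"
      using sorted_merge_chain[OF \<alpha>] v(2) by (simp only: bl)
    then show ?thesis unfolding gapk using \<gamma>0 by (simp add: m)
  qed
  have other_in: "Poly_Mapping.single (?ins \<gamma>) 1 \<in> M"
    if \<gamma>: "\<gamma> \<in> gap inside lt c ?k" "\<gamma> \<noteq> ?\<gamma>0" for \<gamma>
  proof -
    have \<gamma>': "\<gamma> \<in> wpartitions n" "lt ?\<alpha> \<gamma>" "lt \<gamma> ?\<beta>"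
      using iffD1[OF gapk \<gamma>(1)] by (auto simp: inside_def)
    have "card \<gamma> < card ?\<alpha>" "card ?\<beta> < card \<gamma>"
      using card_less_of_wp_less \<alpha> \<beta> \<gamma>' by blast+
    then have cards: "card ?\<alpha> = card \<gamma> + 1" "card \<gamma> = card ?\<beta> + 1" using card\<beta> by auto
    obtain a A B where m1': "A \<in> blocks ?\<alpha>" "B \<in> blocks ?\<alpha>" "A \<noteq> B" "\<gamma> = merge (u a) A B ?\<alpha>"
      by (rule covering_is_merge[OF \<alpha> \<gamma>'(1,2) cards(1)])
    obtain d C D where m2': "C \<in> blocks \<gamma>" "D \<in> blocks \<gamma>" "C \<noteq> D" "?\<beta> = merge (u d) C D \<gamma>"
      by (rule covering_is_merge[OF \<gamma>'(1) \<beta> \<gamma>'(3) cards(2)])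
    have 1: "wrun ?\<alpha> [(a, A, B)] = \<gamma>" "wrun ?\<alpha> [(a, A, B), (d, C, D)] = ?\<beta>"
      using m1'(4) m2'(4) by simp_all
    have "Poly_Mapping.single (inner (pre @ (a, A, B) # (d, C, D) # post)) 1 \<in> M"
    proof (rule others)
      show "valid (run (singles n) pre) [(a, A, B), (d, C, D)]"
        using m1' m2' by (simp add: bl[symmetric])
    qed (use 1 \<gamma>(2) in auto)
    then show ?thesis unfolding inner_split 1 by (simp add: mc vs_def)
  qed
  have "chain_coboundary inside lt c =
      (\<Sum>j\<le>length c. if j = ?k then (\<Sum>\<gamma>\<in>gap inside lt c ?k.
        Poly_Mapping.single (?ins \<gamma>) ((- 1) ^ ?k)) else (0 :: _ \<Rightarrow>\<^sub>0 'k))"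
    unfolding chain_coboundary_def by (intro sum.cong) (auto simp: gap0 take_drop)
  also have "\<dots> = (\<Sum>\<gamma>\<in>gap inside lt c ?k. Poly_Mapping.single (?ins \<gamma>) ((- 1) ^ ?k))"
    using k by simp
  also have "\<dots> = fscale ((- 1) ^ ?k) (\<Sum>\<gamma>\<in>gap inside lt c ?k. Poly_Mapping.single (?ins \<gamma>) 1)"
    by (simp add: fscale_sum fscale_single)
  \<comment> \<open>The sign squares to one, so a second multiplication removes it.\<close>
  finally have "fscale ((- 1) ^ ?k) (chain_coboundary inside lt c) =
      (\<Sum>\<gamma>\<in>gap inside lt c ?k. Poly_Mapping.single (?ins \<gamma>) (1 :: 'k))"
    by (simp add: fscale_fscale flip: power_add mult_2)
  also have "\<dots> = Poly_Mapping.single (?ins ?\<gamma>0) 1 +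
      (\<Sum>\<gamma>\<in>gap inside lt c ?k - {?\<gamma>0}. Poly_Mapping.single (?ins \<gamma>) 1)"
    using fin in0 by (rule sum.remove)
  finally have "Poly_Mapping.single (?ins ?\<gamma>0) 1 =
      fscale ((- 1) ^ ?k) (chain_coboundary inside lt c) +
      fscale (- 1) (\<Sum>\<gamma>\<in>gap inside lt c ?k - {?\<gamma>0}. Poly_Mapping.single (?ins \<gamma>) (1 :: 'k))"
    by (simp add: fscale_minus)
  moreover have "Poly_Mapping.single c (1 :: 'k) \<in> cochains inside lt (int n - 4)"
    using c(1) by (simp add: cochains_def)
  then have "coboundary inside lt (Poly_Mapping.single c (1 :: 'k)) \<in> M"
    by (rule subsetD[OF coboundaries imageI])
  then have "chain_coboundary inside lt c \<in> M"
    by (simp only: coboundary_single)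
  moreover have "(\<Sum>\<gamma>\<in>gap inside lt c ?k - {?\<gamma>0}. Poly_Mapping.single (?ins \<gamma>) 1) \<in> M"
    using other_in by (intro M_sum) auto
  ultimately show ?thesis unfolding inner0 by (simp only: M_add M_fscale)
qed

lemma inner_cong:
  assumes "wrun (wrun lo pre) [m1] = wrun (wrun lo pre) [m1']"
    and "wrun (wrun lo pre) [m1, m2] = wrun (wrun lo pre) [m1', m2']"
  shows "inner (pre @ m1 # m2 # post) = inner (pre @ m1' # m2' # post)"
  unfolding inner_split assms ..

lemma inner_flip: "inner (pre @ (c, A, B) # post) = inner (pre @ (c, B, A) # post)"
  by (simp add: inner_def merge_chain_append merge_commute[of "u c" A B])

text \<open>Serves to find all chains through a rank two interval from its top alone: the pair
  merged first lies below one block \<open>T\<close> of the top, and if the pair fills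
  \<open>T\<close>, the weight of \<open>T\<close> reveals the color.\<close>

lemma merged_pair_below:
  assumes \<alpha>: "\<alpha> \<in> wpartitions n" and v: "valid (blocks \<alpha>) [(a, E, G), m]"
  obtains T where "T \<in> blocks (wrun \<alpha> [(a, E, G), m])" "E \<in> subblocks \<alpha> T" "G \<in> subblocks \<alpha> T"
    "E \<union> G \<subseteq> T"
    "T = E \<union> G \<Longrightarrow> weight (wrun \<alpha> [(a, E, G), m]) T = weight \<alpha> E + weight \<alpha> G + u a"
proof -
  interpret two_blocks n \<alpha> E G using \<alpha> v by (intro two_blocksI)
  let ?\<gamma> = "merge (u a) E G \<alpha>" and ?\<beta> = "wrun \<alpha> [(a, E, G), m]"
  have \<gamma>: "?\<gamma> \<in> wpartitions n" by (rule merge_in[OF u_le_1])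
  obtain d C D where m: "m = (d, C, D)" by (cases m)
  interpret \<gamma>: two_blocks n ?\<gamma> C D using \<gamma> v by unfold_locales (simp_all add: m)
  have \<beta>: "?\<beta> = merge (u d) C D ?\<gamma>" by (simp add: m)
  have "?\<beta> \<in> wpartitions n" unfolding \<beta> by (rule \<gamma>.merge_in[OF u_le_1])
  have le: "wp_le n ?\<gamma> ?\<beta>"
    using \<gamma>.wp_less_merge[OF u_le_1, of d] unfolding \<beta> wp_less_def by blast
  have EG: "E \<union> G \<in> blocks ?\<gamma>" by simp
  obtain T where T: "T \<in> blocks ?\<beta>" "E \<union> G \<subseteq> T"
    using \<gamma>.refines_merge[of "u d"] EG unfolding \<beta> refines_def by blast
  show ?thesis
  proof (rule that)
    show "E \<in> subblocks \<alpha> T" "G \<in> subblocks \<alpha> T" using AB T by (auto simp: subblocks_def)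
    assume TEG: "T = E \<union> G"
    then have "subblocks ?\<gamma> T = {T}" using subblocks_self[OF \<gamma>] EG by simp
    then have "weight ?\<beta> T = weight ?\<gamma> T"
      using le T(1) unfolding wp_le_iff[OF \<gamma> \<open>?\<beta> \<in> wpartitions n\<close>] by fastforce
    then show "weight ?\<beta> T = weight \<alpha> E + weight \<alpha> G + u a"
      by (simp add: TEG weight_merge)
  qed (use T in auto)
qed

text \<open>The interval above two disjoint pairs has just two middle elements: both new blocks are
  visible in the top, and their weights fix the color of either pair.\<close>

lemma comm_relation:
  assumes F: "full n i (pre @ (c, A, B) # (d, C, D) # post)" and dis: "(A \<union> B) \<inter> (C \<union> D) = {}"
    and swapped: "Poly_Mapping.single (inner (pre @ (d, C, D) # (c, A, B) # post)) 1 \<in> M"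
  shows "Poly_Mapping.single (inner (pre @ (c, A, B) # (d, C, D) # post)) 1 \<in> M"
proof (rule local_relation[OF F])
  fix m1' m2'
  let ?\<alpha> = "wrun lo pre" and ?Q = "run (singles n) pre"
  assume v: "valid ?Q [m1', m2']"
    and \<beta>: "wrun ?\<alpha> [m1', m2'] = wrun ?\<alpha> [(c, A, B), (d, C, D)]"
    and ne: "wrun ?\<alpha> [m1'] \<noteq> wrun ?\<alpha> [(c, A, B)]"
  have bl: "blocks ?\<alpha> = ?Q" by (simp add: blocks_wrun blocks_bot)
  have "valid (singles n) pre" using F by (simp add: full_def)
  then have \<alpha>: "?\<alpha> \<in> wpartitions n" using wrun_in[OF bot_in] by (simp add: blocks_bot)
  have AB: "A \<in> blocks ?\<alpha>" "B \<in> blocks ?\<alpha>" "A \<noteq> B" "C \<noteq> D"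
    and CD': "C \<in> insert (A \<union> B) (blocks ?\<alpha> - {A, B})" "D \<in> insert (A \<union> B) (blocks ?\<alpha> - {A, B})"
    using F unfolding bl by (auto simp: full_def)
  have nonempty: "A \<noteq> {}" "B \<noteq> {}" using wpartitionsD(5)[OF \<alpha>] AB by auto
  have CD: "C \<in> blocks ?\<alpha>" "D \<in> blocks ?\<alpha>" "C \<noteq> A" "C \<noteq> B" "D \<noteq> A" "D \<noteq> B"
    using CD' dis nonempty by blast+
  interpret ab: two_blocks n ?\<alpha> A B using \<alpha> AB by unfold_locales
  interpret cd: two_blocks n ?\<alpha> C D using \<alpha> CD AB by unfold_locales
  interpret cd': two_blocks n "merge (u c) A B ?\<alpha>" C D
    using ab.merge_in[OF u_le_1] CD AB by unfold_locales auto
  have "C \<noteq> {}" using wpartitionsD(5)[OF \<alpha>] CD by auto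
  then have AB_CD: "A \<union> B \<noteq> C" "A \<union> B \<noteq> D" using dis wpartitionsD(5)[OF \<alpha> CD(2)] by blast+
  obtain a E G where m1': "m1' = (a, E, G)" by (cases m1')
  obtain T where T: "T \<in> blocks (wrun ?\<alpha> [m1', m2'])" "E \<in> subblocks ?\<alpha> T" "G \<in> subblocks ?\<alpha> T"
    "E \<union> G \<subseteq> T"
    "T = E \<union> G \<Longrightarrow> weight (wrun ?\<alpha> [m1', m2']) T = weight ?\<alpha> E + weight ?\<alpha> G + u a"
    using merged_pair_below[OF \<alpha>, of a E G m2'] v unfolding bl m1' by blast
  have EG: "E \<noteq> G" using v by (simp add: m1')
  have "T \<in> {C \<union> D, A \<union> B} \<or> T \<in> blocks ?\<alpha>"
    using T(1) unfolding \<beta> by auto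
  \<comment> \<open>Two different blocks of \<open>?\<alpha>\<close> lie below \<open>T\<close>, so
    \<open>T\<close> must have arisen from a merge.\<close>
  moreover have "T \<notin> blocks ?\<alpha>"
    using T(2,3) EG subblocks_self[OF \<alpha>, of T] by auto
  ultimately consider "T = A \<union> B" | "T = C \<union> D" by blast
  then show "Poly_Mapping.single (inner (pre @ m1' # m2' # post)) 1 \<in> M"
  proof cases
    case 1
    then have EG': "E = A \<and> G = B \<or> E = B \<and> G = A"
      using T(2,3) EG unfolding 1 ab.subblocks_merge(1) by auto
    have "weight (wrun ?\<alpha> [(c, A, B), (d, C, D)]) T = weight ?\<alpha> A + weight ?\<alpha> B + u c"
      using cd'.weight_merge(2)[of "A \<union> B"] AB_CD by (simp add: 1 ab.weight_merge)
    moreover have "T = E \<union> G" using EG' 1 by auto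
    ultimately have "u a = u c" using T(5) EG' unfolding \<beta> by auto
    then have "wrun ?\<alpha> [m1'] = wrun ?\<alpha> [(c, A, B)]"
      using EG' merge_commute by (auto simp: m1')
    with ne show ?thesis by contradiction
  next
    case 2
    then have EG': "E = C \<and> G = D \<or> E = D \<and> G = C"
      using T(2,3) EG unfolding 2 cd.subblocks_merge(1) by auto
    have "weight (wrun ?\<alpha> [(c, A, B), (d, C, D)]) T = weight ?\<alpha> C + weight ?\<alpha> D + u d"
      using cd'.weight_merge(1) CD by (simp add: 2 ab.weight_merge(2))
    moreover have "T = E \<union> G" using EG' 2 by auto
    ultimately have "u a = u d" using T(5) EG' unfolding \<beta> by auto
    then have "wrun ?\<alpha> [m1'] = wrun ?\<alpha> [(d, C, D)]"
      using EG' merge_commute by (auto simp: m1')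
    moreover have "wrun ?\<alpha> [m1', m2'] = wrun ?\<alpha> [(d, C, D), (c, A, B)]"
      unfolding \<beta> using merge_merge_commute[OF \<alpha> AB(1-3) CD(1,2) AB(4) dis u_le_1 u_le_1, of c d]
      by simp
    ultimately have "inner (pre @ m1' # m2' # post) = inner (pre @ (d, C, D) # (c, A, B) # post)"
      by (rule inner_cong)
    then show ?thesis using swapped by simp
  qed
qed

text \<open>The first merge of a chain through this interval joins two of the three blocks, and the
  second one must add the third. Comparing the weight of the common union fixes only the sum of the
  two colors.\<close>

lemma jacobi_relation:
  assumes F: "full n i (pre @ (c, A, B) # (d, A \<union> B, C) # post)" and dis: "C \<inter> (A \<union> B) = {}"
    and others: "\<And>c' d' E G H. (E, G, H) \<in> {(A, B, C), (A, C, B), (B, C, A)} \<Longrightarrow>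
      u c' + u d' = u c + u d \<Longrightarrow> (c', E, G) \<noteq> (c, A, B) \<Longrightarrow>
      Poly_Mapping.single (inner (pre @ (c', E, G) # (d', E \<union> G, H) # post)) 1 \<in> M"
  shows "Poly_Mapping.single (inner (pre @ (c, A, B) # (d, A \<union> B, C) # post)) 1 \<in> M"
proof (rule local_relation[OF F])
  fix m1' m2'
  let ?\<alpha> = "wrun lo pre" and ?Q = "run (singles n) pre" and ?T = "A \<union> B \<union> C"
  let ?\<beta> = "wrun ?\<alpha> [(c, A, B), (d, A \<union> B, C)]"
  assume v: "valid ?Q [m1', m2']" and \<beta>: "wrun ?\<alpha> [m1', m2'] = ?\<beta>"
    and ne: "wrun ?\<alpha> [m1'] \<noteq> wrun ?\<alpha> [(c, A, B)]"
  have bl: "blocks ?\<alpha> = ?Q" by (simp add: blocks_wrun blocks_bot)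
  have "valid (singles n) pre" using F by (simp add: full_def)
  then have \<alpha>: "?\<alpha> \<in> wpartitions n" using wrun_in[OF bot_in] by (simp add: blocks_bot)
  have AB: "A \<in> blocks ?\<alpha>" "B \<in> blocks ?\<alpha>" "A \<noteq> B"
    and C': "C \<in> insert (A \<union> B) (blocks ?\<alpha> - {A, B})" "A \<union> B \<noteq> C"
    using F unfolding bl by (auto simp: full_def)
  have C: "C \<in> blocks ?\<alpha>" "C \<noteq> A" "C \<noteq> B" using C' by auto
  have nonempty: "A \<noteq> {}" "B \<noteq> {}" "C \<noteq> {}" using wpartitionsD(5)[OF \<alpha>] AB C by auto
  have eqI: "S = S'" if "S \<in> blocks ?\<alpha>" "S' \<in> blocks ?\<alpha>" "S \<inter> S' \<noteq> {}" for S S'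
    using partition_on_block_eq[OF wpartitionsD(1)[OF \<alpha>] that(1,2)] that(3) by blast
  have sub_T: "subblocks ?\<alpha> ?T = {A, B, C}"
  proof
    show "subblocks ?\<alpha> ?T \<subseteq> {A, B, C}"
    proof
      fix S assume "S \<in> subblocks ?\<alpha> ?T"
      then have S: "S \<in> blocks ?\<alpha>" "S \<subseteq> ?T" by (auto simp: subblocks_def)
      then have "S \<inter> A \<noteq> {} \<or> S \<inter> B \<noteq> {} \<or> S \<inter> C \<noteq> {}"
        using wpartitionsD(5)[OF \<alpha> S(1)] by blast
      then show "S \<in> {A, B, C}" using eqI[OF S(1)] AB C by blast
    qed
  qed (use AB C in \<open>auto simp: subblocks_def\<close>)
  interpret ab: two_blocks n ?\<alpha> A B using \<alpha> AB by unfold_locales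
  interpret abc: two_blocks n "merge (u c) A B ?\<alpha>" "A \<union> B" C
    using ab.merge_in[OF u_le_1] C C' by unfold_locales auto
  have weight_T: "weight ?\<beta> ?T = weight ?\<alpha> A + weight ?\<alpha> B + weight ?\<alpha> C + u c + u d"
    using abc.weight_merge(1) C by (simp add: ab.weight_merge)
  obtain a E G where m1': "m1' = (a, E, G)" by (cases m1')
  obtain d' H K where m2': "m2' = (d', H, K)" by (cases m2')
  have EG: "E \<noteq> G" "E \<in> blocks ?\<alpha>" "G \<in> blocks ?\<alpha>" using v unfolding bl by (simp_all add: m1')
  obtain T where T: "T \<in> blocks ?\<beta>" "E \<in> subblocks ?\<alpha> T" "G \<in> subblocks ?\<alpha> T"
    using merged_pair_below[OF \<alpha>, of a E G m2'] v unfolding bl m1' \<beta>[unfolded m1'] by metis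
  have "T = ?T \<or> T \<in> blocks ?\<alpha>"
    using T(1) by auto
  moreover have "T \<notin> blocks ?\<alpha>"
    using T(2,3) EG subblocks_self[OF \<alpha>, of T] by auto
  ultimately have "T = ?T" by blast
  with T(2,3) have "E \<in> subblocks ?\<alpha> ?T" "G \<in> subblocks ?\<alpha> ?T" by simp_all
  then have EG_in: "E \<in> {A, B, C}" "G \<in> {A, B, C}" unfolding sub_T .
  \<comment> \<open>\<open>E0\<close> and \<open>G0\<close> are the first pair in the order used by
    \<open>others\<close>, and \<open>V\<close> is the third block.\<close>
  obtain E0 G0 V where V: "(E0, G0, V) \<in> {(A, B, C), (A, C, B), (B, C, A)}"
    "E = E0 \<and> G = G0 \<or> E = G0 \<and> G = E0"
    using EG_in EG(1) by auto
  have V_in: "V \<in> blocks ?\<alpha>" "V \<noteq> E" "V \<noteq> G" and T_eq: "E \<union> G \<union> V = ?T"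
    and wsum: "weight ?\<alpha> E + weight ?\<alpha> G + weight ?\<alpha> V = weight ?\<alpha> A + weight ?\<alpha> B + weight ?\<alpha> C"
    using V AB C by auto
  let ?\<gamma> = "merge (u a) E G ?\<alpha>"
  interpret eg: two_blocks n ?\<alpha> E G using \<alpha> EG by unfold_locales
  have \<gamma>: "?\<gamma> \<in> wpartitions n" by (rule eg.merge_in[OF u_le_1])
  have HK: "H \<in> blocks ?\<gamma>" "K \<in> blocks ?\<gamma>" "H \<noteq> K"
    using v unfolding bl[symmetric] by (simp_all add: m1' m2')
  interpret hk: two_blocks n ?\<gamma> H K using \<gamma> HK by unfold_locales
  have \<beta>': "?\<beta> = merge (u d') H K ?\<gamma>" unfolding \<beta>[symmetric] by (simp add: m1' m2')
  have EG_V: "E \<union> G \<noteq> V" "(E \<union> G) \<inter> V = {}"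
    using eqI[OF EG(2) V_in(1)] eqI[OF EG(3) V_in(1)] V_in(2,3) wpartitionsD(5)[OF \<alpha> EG(2)]
    by blast+
  have V\<gamma>: "V \<in> blocks ?\<gamma>" "E \<union> G \<in> blocks ?\<gamma>" using V_in by auto
  have V_ne: "V \<noteq> {}" using wpartitionsD(5)[OF \<alpha> V_in(1)] .
  \<comment> \<open>The union of all three blocks can only come from the second merge, which
    identifies \<open>H\<close> and \<open>K\<close>.\<close>
  have "?T \<notin> blocks ?\<gamma>"
  proof
    assume "?T \<in> blocks ?\<gamma>"
    then have "?T = V"
      using partition_on_block_eq[OF wpartitionsD(1)[OF \<gamma>] _ V\<gamma>(1)] V_ne T_eq by blast
    then show False using EG_V T_eq wpartitionsD(5)[OF \<alpha> EG(2)] by blast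
  qed
  moreover have "?T \<in> blocks ?\<beta>" by (simp add: Un_commute)
  ultimately have HK_T: "H \<union> K = ?T" unfolding \<beta>' by auto
  have "V \<in> subblocks ?\<gamma> (H \<union> K)" "E \<union> G \<in> subblocks ?\<gamma> (H \<union> K)"
    using V\<gamma> T_eq unfolding subblocks_def HK_T by blast+
  then have HK': "H = E \<union> G \<and> K = V \<or> H = V \<and> K = E \<union> G"
    using EG_V(1) unfolding hk.subblocks_merge(1) by auto
  have "weight ?\<beta> ?T = weight ?\<gamma> H + weight ?\<gamma> K + u d'"
    unfolding HK_T[symmetric] \<beta>' by (rule hk.weight_merge(1))
  also have "\<dots> = weight ?\<alpha> E + weight ?\<alpha> G + weight ?\<alpha> V + u a + u d'"
    using HK' eg.weight_merge(1)[of "u a"] eg.weight_merge(2)[OF V_in, of "u a"] by auto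
  finally have sum: "u a + u d' = u c + u d" using weight_T wsum by simp
  have 1: "wrun ?\<alpha> [m1'] = wrun ?\<alpha> [(a, E0, G0)]"
    using V(2) merge_commute by (auto simp: m1')
  have "E \<union> G = E0 \<union> G0" using V(2) by auto
  then have 2: "wrun ?\<alpha> [m1', m2'] = wrun ?\<alpha> [(a, E0, G0), (d', E0 \<union> G0, V)]"
    using 1 HK' merge_commute[of "u d'"] by (auto simp: m2' m1')
  have "(a, E0, G0) \<noteq> (c, A, B)" using ne 1 by auto
  then have "Poly_Mapping.single (inner (pre @ (a, E0, G0) # (d', E0 \<union> G0, V) # post)) 1 \<in> M"
    by (rule others[OF V(1) sum])
  then show "Poly_Mapping.single (inner (pre @ m1' # m2' # post)) 1 \<in> M"
    using inner_cong[OF 1 2] by simp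
qed

lemma single_chain_in:
  assumes "\<And>t. t \<in> combs {1..n} i \<Longrightarrow> Poly_Mapping.single (inner (postorder t)) 1 \<in> M"
    and "c \<in> chains inside lt (int n - 3)"
  shows "Poly_Mapping.single c 1 \<in> M"
proof -
  interpret closed_under_relations n i "\<lambda>ms. Poly_Mapping.single (inner ms) (1 :: 'k) \<in> M"
  proof
    show "Poly_Mapping.single (inner (pre @ (c, A, B) # post)) 1 \<in> M"
      if "Poly_Mapping.single (inner (pre @ (c, B, A) # post)) 1 \<in> M" for pre c A B post
      using that inner_flip[of pre c A B post] by simp
  qed (fact comm_relation jacobi_relation)+
  obtain ms where "full n i ms" "inner ms = c" using ex_full[OF assms(2)] by blast
  then show ?thesis using closed_if_combs[OF assms(1)] by blast
qed

lemma cochains_subset: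
  assumes "\<And>t. t \<in> combs {1..n} i \<Longrightarrow> Poly_Mapping.single (inner (postorder t)) 1 \<in> M"
  shows "cochains inside lt (int n - 3) \<subseteq> M"
proof
  fix f :: "wpartition list \<Rightarrow>\<^sub>0 'k" assume f: "f \<in> cochains inside lt (int n - 3)"
  have "f = (\<Sum>c\<in>Poly_Mapping.keys f. fscale (Poly_Mapping.lookup f c) (Poly_Mapping.single c 1))"
    by (simp add: fscale_single flip: sum_single)
  also have "\<dots> \<in> M"
    using f single_chain_in[OF assms] by (intro M_sum M_fscale) (auto simp: cochains_def)
  finally show "f \<in> M" .
qed

end

section \<open>Boolean sublattices and their fundamental cycles\<close>

lemma infix_left:
  assumes "p @ xs @ q = us @ vs" "xs \<noteq> []" "set xs \<inter> set vs = {}"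
  shows "\<exists>q'. us = p @ xs @ q'"
proof -
  obtain ys where ys: "p = us @ ys \<and> ys @ xs @ q = vs \<or> p @ ys = us \<and> xs @ q = ys @ vs"
    using assms(1) by (auto simp: append_eq_append_conv2)
  have "\<not> ys @ xs @ q = vs" using assms(2,3) by (cases xs) auto
  then have 1: "p @ ys = us" "xs @ q = ys @ vs" using ys by auto
  obtain zs where zs: "xs = ys @ zs \<and> zs @ q = vs \<or> xs @ zs = ys \<and> q = zs @ vs"
    using 1(2) by (auto simp: append_eq_append_conv2)
  have "zs = []" if "xs = ys @ zs" "zs @ q = vs"
    using assms(3) that by (cases zs) auto
  then have "\<exists>zs. ys = xs @ zs" using zs by auto
  then show ?thesis using 1(1) by auto
qed

lemma infix_right:
  assumes "p @ xs @ q = us @ vs" "xs \<noteq> []" "set xs \<inter> set us = {}"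
  shows "\<exists>p'. vs = p' @ xs @ q"
proof -
  have "rev q @ rev xs @ rev p = rev vs @ rev us"
    using arg_cong[OF assms(1), of rev] by simp
  then obtain q' where "rev vs = rev q @ rev xs @ q'"
    using infix_left[of "rev q" "rev xs" "rev p" "rev vs" "rev us"] assms(2,3) by auto
  then have "vs = rev q' @ xs @ q" by (metis append.assoc rev_append rev_rev_ident)
  then show ?thesis ..
qed

text \<open>At the root the labels of one child form an initial segment of \<open>w\<close>. If it
  is the left child, both halves are compared recursively; if it is the right child, the tree starts
  with the minimum whereas \<open>w\<close> starts with a larger label.\<close>

lemma lex_words:
  assumes "normalized t" "distinct (leaves t)" "distinct w" "set w = labels t"
    and "\<And>s. s \<in> subtrees t \<Longrightarrow> \<exists>p v q. w = p @ v @ q \<and> set v = labels s"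
  shows "leaves t = w \<or> (leaves t, w) \<in> lex less_than"
  using assms
proof (induction t arbitrary: w)
  case (Leaf a)
  then have "length w = 1" using distinct_card[of w] by simp
  then obtain y where "w = [y]" by (auto simp: length_Suc_conv)
  then show ?case using Leaf.prems(4) by simp
next
  case (Node c l r)
  let ?L = "labels l" and ?R = "labels r"
  have dis: "?L \<inter> ?R = {}" using Node.prems(2) by simp
  have root: "t \<in> subtrees t" for t by (cases t) auto
  obtain p v q where v: "w = p @ v @ q" "set v = ?L"
    using Node.prems(5)[of l] root[of l] by auto
  obtain p' v' q' where v': "w = p' @ v' @ q'" "set v' = ?R"
    using Node.prems(5)[of r] root[of r] by auto
  have set_w: "set w = ?L \<union> ?R" using Node.prems(4) by simp
  have ne: "v \<noteq> []" "v' \<noteq> []" using v(2) v'(2) by auto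
  have pq: "set p \<union> set q = ?R"
  proof -
    have "(set p \<union> set q) \<inter> ?L = {}" using Node.prems(3) v by auto
    then show ?thesis using set_w dis v by auto
  qed
  have pq': "set p' \<union> set q' = ?L"
  proof -
    have "(set p' \<union> set q') \<inter> ?R = {}" using Node.prems(3) v' by auto
    then show ?thesis using set_w dis v' by auto
  qed
  \<comment> \<open>Otherwise \<open>w\<close> begins and ends with labels of \<open>r\<close>;
    these are contiguous, so no room would be left for \<open>l\<close>.\<close>
  have "p = [] \<or> q = []"
  proof (rule ccontr)
    assume "\<not> (p = [] \<or> q = [])"
    then have pq_ne: "p \<noteq> []" "q \<noteq> []" by auto
    have "hd w \<in> set p" "last w \<in> set q"
      using pq_ne by (auto simp: v(1) last_append)
    then have "hd w \<in> ?R" "last w \<in> ?R" using pq by auto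
    moreover have "hd w \<in> ?L" if "p' \<noteq> []" using that pq' by (simp add: v'(1)) (metis Un_iff hd_in_set)
    moreover have "last w \<in> ?L" if "q' \<noteq> []"
      using that pq' by (simp add: v'(1) last_append) (metis Un_iff last_in_set)
    ultimately have "p' = []" "q' = []" using dis by auto
    then have "?L = {}" using pq' by simp
    then show False by simp
  qed
  then obtain v1 where w: "w = v @ v1 \<or> w = v1 @ v" "set v1 = ?R"
    using v pq by (metis append.left_neutral append.right_neutral sup_bot.left_neutral
        sup_bot.right_neutral set_empty)
  have dist: "distinct v" "distinct v1" using w(1) Node.prems(3) by auto
  from w(1) show ?case
  proof
    assume eq: "w = v @ v1"
    have left: "leaves l = v \<or> (leaves l, v) \<in> lex less_than"
    proof (rule Node.IH(1))
      fix s assume s: "s \<in> subtrees l"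
      then obtain p1 x q1 where x: "w = p1 @ x @ q1" "set x = labels s"
        using Node.prems(5)[of s] by auto
      have "labels s \<subseteq> ?L" using s
        by (induction l) auto
      then have "set x \<inter> set v1 = {}" "x \<noteq> []" using x dis w(2) by auto
      then obtain q2 where "v = p1 @ x @ q2"
        using infix_left[of p1 x q1 v v1] x(1) eq by auto
      then show "\<exists>p v' q. v = p @ v' @ q \<and> set v' = labels s" using x by blast
    qed (use Node.prems v dist in \<open>auto simp: normalized_Node\<close>)
    have right: "leaves r = v1 \<or> (leaves r, v1) \<in> lex less_than"
    proof (rule Node.IH(2))
      fix s assume s: "s \<in> subtrees r"
      then obtain p1 x q1 where x: "w = p1 @ x @ q1" "set x = labels s"
        using Node.prems(5)[of s] by auto
      have "labels s \<subseteq> ?R" using s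
        by (induction r) auto
      then have "set x \<inter> set v = {}" "x \<noteq> []" using x dis v(2) by auto
      then obtain p2 where "v1 = p2 @ x @ q1"
        using infix_right[of p1 x q1 v v1] x(1) eq by auto
      then show "\<exists>p v' q. v1 = p @ v' @ q \<and> set v' = labels s" using x by blast
    qed (use Node.prems w dist in \<open>auto simp: normalized_Node\<close>)
    have "length (leaves l) = length v" "length (leaves r) = length v1"
      using Node.prems(2) dist v(2) w(2) by (metis distinct_append distinct_card leaves.simps(2))+
    then show ?thesis
      using left right by (auto simp: eq lex_append_iff)
  next
    assume eq: "w = v1 @ v"
    obtain a v2 where a: "v1 = a # v2" using w(2) by (cases v1) auto
    have min: "hd (leaves l) = Min (?L \<union> ?R)" using Node.prems(1) by (simp add: normalized_Node)
    obtain b l2 where b: "leaves l = b # l2" by (cases "leaves l") auto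
    have "a \<in> ?R" using w(2) a by auto
    then have "b \<le> a" using min Min_le[of "?L \<union> ?R" a] by (simp add: b)
    moreover have "b \<noteq> a" using dis \<open>a \<in> ?R\<close> b by auto
    ultimately have "(b, a) \<in> less_than" by simp
    moreover have "length (leaves (Node c l r)) = length w"
      using Node.prems(2-4) by (metis distinct_card)
    ultimately show ?thesis by (simp add: eq a b)
  qed
qed

lemma card_Int_remove:
  assumes "finite A" "x \<in> A"
  shows "card (R \<inter> A) = card (R \<inter> (A - {x})) + (if x \<in> R then 1 else 0)"
proof (cases "x \<in> R")
  case True
  then have "R \<inter> A = insert x (R \<inter> (A - {x}))" using assms by auto
  then show ?thesis using assms True by simp
next
  case False
  then have "R \<inter> A = R \<inter> (A - {x})" by auto
  then show ?thesis using False by simp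
qed

text \<open>One of the two leaders also leads the union. The other one, the loser, is no longer
  exempt and counts if it lies in \<open>R\<close>.\<close>

lemma weight_union:
  assumes "L \<inter> S = {}" "L \<noteq> {}" "S \<noteq> {}" "L \<union> S \<subseteq> set \<pi>"
  shows "card (R \<inter> (L \<union> S - {leader \<pi> (L \<union> S)})) =
    card (R \<inter> (L - {leader \<pi> L})) + card (R \<inter> (S - {leader \<pi> S})) +
    (if loser \<pi> L S \<in> R then 1 else 0)"
proof -
  have fin: "finite L" "finite S" using assms(4) finite_subset[OF _ finite_set] by blast+
  have lead: "leader \<pi> L \<in> L" "leader \<pi> S \<in> S" "leader \<pi> (L \<union> S) \<in> L \<union> S"
    using assms leader_in[of L \<pi>] leader_in[of S \<pi>] leader_in[of "L \<union> S" \<pi>] by auto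
  have un: "card (R \<inter> (L \<union> S)) = card (R \<inter> L) + card (R \<inter> S)"
    using fin assms(1) by (simp add: Int_Un_distrib card_Un_disjoint disjoint_iff)
  have "leader \<pi> (L \<union> S) = leader \<pi> L \<and> loser \<pi> L S = leader \<pi> S \<or>
      leader \<pi> (L \<union> S) = leader \<pi> S \<and> loser \<pi> L S = leader \<pi> L"
  proof (cases "leader \<pi> (L \<union> S) \<in> L")
    case True
    then show ?thesis
      using leader_mono[of L "L \<union> S" \<pi>] assms(4) by (simp add: loser_def)
  next
    case False
    then have "leader \<pi> (L \<union> S) \<in> S" using lead by auto
    then have "leader \<pi> S = leader \<pi> (L \<union> S)"
      using leader_mono[of S "L \<union> S" \<pi>] assms(4) by simp
    moreover have "leader \<pi> (L \<union> S) \<noteq> leader \<pi> L" using lead(1) False by auto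
    ultimately show ?thesis by (simp add: loser_def)
  qed
  then show ?thesis
    using card_Int_remove[OF fin(1) lead(1)] card_Int_remove[OF fin(2) lead(2)] card_Int_remove[OF _ lead(3)] fin un by auto
qed

section \<open>The Boolean sublattice of segment partitions\<close>

locale word_cycle = weighted_interval +
  fixes w \<pi> :: "nat list" and R :: "nat set"
  assumes w: "distinct w" "set w = {1..n}" and \<pi>: "set \<pi> = {1..n}"
    and R: "R \<subseteq> {1..n} - {hd \<pi>}" "card R = i"
begin

text \<open>Positions count from 0, and \<open>t \<in> C\<close> means that the gap between
  positions \<open>t\<close> and \<open>Suc t\<close> is closed. Thus blocks grow with
  \<open>C\<close>, and the subsets of \<open>{..<n - 1}\<close> form the Boolean lattice. The block
  of \<open>j\<close> consists of the positions reachable from \<open>j\<close>, in either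
  direction, through closed gaps.\<close>

definition cut_block :: "nat set \<Rightarrow> nat \<Rightarrow> nat set" where
  "cut_block C j = {k. k < n \<and> {min j k..<max j k} \<subseteq> C}"

definition segment :: "nat set \<Rightarrow> nat \<Rightarrow> nat set" where
  "segment C j = (!) w ` cut_block C j"

definition segments :: "nat set \<Rightarrow> nat set set" where
  "segments C = segment C ` {..<n}"

text \<open>The exemption of the leader keeps the weight below \<open>card B\<close>. The full block
  is led by \<open>hd \<pi>\<close>, which lies outside \<open>R\<close>, so its weight is
  \<open>card R = i\<close>.\<close>

definition weighted :: "nat set set \<Rightarrow> wpartition" where
  "weighted P = (\<lambda>B. (B, card (R \<inter> (B - {leader \<pi> B})))) ` P"

definition W :: "nat set \<Rightarrow> wpartition" where
  "W C = weighted (segments C)"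

lemma length_w: "length w = n"
  using distinct_card[OF w(1)] w(2) by simp

lemma blocks_weighted [simp]: "blocks (weighted P) = P"
  by (auto simp: weighted_def blocks_def image_image)

lemma inj_weighted: "inj_on fst (weighted P)"
  by (auto simp: weighted_def inj_on_def)

lemma weight_weighted: "B \<in> P \<Longrightarrow> weight (weighted P) B = card (R \<inter> (B - {leader \<pi> B}))"
  by (rule weight_eq[OF inj_weighted]) (simp add: weighted_def)

lemma weighted_in:
  assumes "partition_on {1..n} P"
  shows "weighted P \<in> wpartitions n"
proof (rule wpartitionsI)
  show "partition_on {1..n} (blocks (weighted P))" using assms by simp
  show "inj_on fst (weighted P)" by (rule inj_weighted)
  fix B assume "B \<in> blocks (weighted P)"
  then have B: "B \<in> P" by simp
  then have sub: "B \<subseteq> {1..n}" and ne: "B \<noteq> {}"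
    using partition_onD1[OF assms] partition_onD3[OF assms] by auto
  have fin: "finite B" using finite_subset[OF sub] by simp
  have "card (R \<inter> (B - {leader \<pi> B})) \<le> card (B - {leader \<pi> B})"
    using fin by (intro card_mono) auto
  also have "\<dots> < card B"
    using fin leader_in[of B \<pi>] sub ne \<pi> by (intro psubset_card_mono) auto
  finally show "weight (weighted P) B < card B" using B by (simp add: weight_weighted)
qed

text \<open>When blocks are united to \<open>B\<close>, all their leaders except that of
  \<open>B\<close> become countable. The increase is the number of those in \<open>R\<close>, hence
  between 0 and the number of blocks minus one, as the order requires.\<close>

lemma weighted_mono:
  assumes ref: "refines {1..n} P Q"
  shows "wp_le n (weighted P) (weighted Q)"
proof -
  have P: "partition_on {1..n} P" and Q: "partition_on {1..n} Q"
    using ref by (auto simp: refines_def)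
  have "(\<Sum>A\<in>subblocks (weighted P) B. weight (weighted P) A) \<le> weight (weighted Q) B \<and>
      weight (weighted Q) B <
        (\<Sum>A\<in>subblocks (weighted P) B. weight (weighted P) A) + card (subblocks (weighted P) B)"
    if B: "B \<in> Q" for B
  proof -
    let ?S = "subblocks (weighted P) B"
    have S: "?S = {A \<in> P. A \<subseteq> B}" by (simp add: subblocks_def)
    have part: "partition_on B ?S" unfolding S by (rule refines_obtains_subset[OF ref B])
    have sub: "B \<subseteq> {1..n}" "B \<noteq> {}"
      using partition_onD1[OF Q] partition_onD3[OF Q] B by auto
    have finB: "finite B" using finite_subset[OF sub(1)] by simp
    have fin: "finite ?S" by (rule finite_elements[OF finB part])
    let ?i = "\<lambda>A. if leader \<pi> A \<in> R then 1 else 0 :: nat"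
    have A: "finite A" "A \<noteq> {}" "A \<subseteq> set \<pi>" "leader \<pi> A \<in> A" if "A \<in> ?S" for A
    proof -
      show "A \<noteq> {}" using that partition_onD3[OF part] by auto
      show "finite A" using that finB by (auto simp: S intro: finite_subset)
      show "A \<subseteq> set \<pi>" using that sub \<pi> by (auto simp: S)
      then show "leader \<pi> A \<in> A" using \<open>A \<noteq> {}\<close> by (rule leader_in)
    qed
    have lB: "leader \<pi> B \<in> B" using sub \<pi> by (intro leader_in) auto
    then obtain A0 where A0: "A0 \<in> ?S" "leader \<pi> B \<in> A0"
      using partition_onD1[OF part] by auto
    have l0: "leader \<pi> A0 = leader \<pi> B"
      using A0 A(3)[OF A0(1)] by (intro leader_mono) (auto simp: S)
    have "card (R \<inter> B) = (\<Sum>A\<in>?S. card (R \<inter> A))"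
    proof -
      have "R \<inter> B = (\<Union>A\<in>?S. R \<inter> A)" using partition_onD1[OF part] by auto
      moreover have "\<forall>A\<in>?S. \<forall>A'\<in>?S. A \<noteq> A' \<longrightarrow> (R \<inter> A) \<inter> (R \<inter> A') = {}"
        using disjointD[OF partition_onD2[OF part]] by blast
      ultimately show ?thesis using fin A(1) by (simp only:) (intro card_UN_disjoint, auto)
    qed
    also have "\<dots> = (\<Sum>A\<in>?S. card (R \<inter> (A - {leader \<pi> A})) + ?i A)"
      using card_Int_remove[OF A(1) A(4)] by (intro sum.cong refl) simp
    also have "\<dots> = (\<Sum>A\<in>?S. weight (weighted P) A) + (\<Sum>A\<in>?S. ?i A)"
      unfolding sum.distrib by (auto simp: S weight_weighted intro!: sum.cong)
    also have "(\<Sum>A\<in>?S. ?i A) = ?i A0 + (\<Sum>A\<in>?S - {A0}. ?i A)"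
      using fin A0(1) by (rule sum.remove)
    finally have "weight (weighted Q) B = (\<Sum>A\<in>?S. weight (weighted P) A) + (\<Sum>A\<in>?S - {A0}. ?i A)"
      using card_Int_remove[OF finB lB] l0 B by (simp add: weight_weighted)
    moreover have "(\<Sum>A\<in>?S - {A0}. ?i A) \<le> card (?S - {A0})"
      using sum_bounded_above[of "?S - {A0}" ?i 1] by simp
    moreover have "card (?S - {A0}) < card ?S"
      using fin A0(1) by (rule card_Diff1_less)
    ultimately show ?thesis by linarith
  qed
  then show ?thesis
    unfolding wp_le_iff[OF weighted_in[OF P] weighted_in[OF Q]] using ref by simp
qed

lemma cut_block_refl: "j < n \<Longrightarrow> j \<in> cut_block C j"
  by (simp add: cut_block_def)

lemma cut_block_eq:
  assumes "k \<in> cut_block C j"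
  shows "cut_block C k = cut_block C j"
proof -
  have jk: "{min j k..<max j k} \<subseteq> C" using assms by (simp add: cut_block_def)
  have "{min j l..<max j l} \<subseteq> {min j k..<max j k} \<union> {min k l..<max k l}" for l
    by (auto simp: min_def max_def split: if_splits)
  moreover have "{min k l..<max k l} \<subseteq> {min j k..<max j k} \<union> {min j l..<max j l}" for l
    by (auto simp: min_def max_def split: if_splits)
  ultimately show ?thesis using jk unfolding cut_block_def by blast
qed

lemma nth_w_inj: "j < n \<Longrightarrow> k < n \<Longrightarrow> w ! j = w ! k \<longleftrightarrow> j = k"
  using nth_eq_iff_index_eq[OF w(1)] by (simp add: length_w)

lemma mem_segment: "k < n \<Longrightarrow> w ! k \<in> segment C j \<longleftrightarrow> k \<in> cut_block C j"
  by (auto simp: segment_def cut_block_def nth_w_inj)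

lemma segment_eq: "k \<in> cut_block C j \<Longrightarrow> segment C k = segment C j"
  by (simp add: segment_def cut_block_eq)

lemma partition_segments: "partition_on {1..n} (segments C)"
proof (rule partition_onI)
  have range_w: "{1..n} = (!) w ` {..<n}"
    using w(2) length_w by (auto simp: set_conv_nth)
  show "\<Union>(segments C) = {1..n}"
  proof
    show "\<Union>(segments C) \<subseteq> {1..n}"
      unfolding range_w by (auto simp: segments_def segment_def cut_block_def)
    show "{1..n} \<subseteq> \<Union>(segments C)"
      unfolding range_w using mem_segment cut_block_refl by (auto simp: segments_def)
  qed
  show "{} \<notin> segments C"
    using cut_block_refl by (auto simp: segments_def segment_def)
  fix p q assume pq: "p \<in> segments C" "q \<in> segments C" "p \<noteq> q"
  show "disjnt p q"
  proof (rule ccontr)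
    assume "\<not> disjnt p q"
    then obtain x where x: "x \<in> p" "x \<in> q" by (auto simp: disjnt_def)
    obtain j k where jk: "p = segment C j" "q = segment C k" using pq by (auto simp: segments_def)
    obtain l where l: "l < n" "x = w ! l" using x(1) jk(1) by (auto simp: segment_def cut_block_def)
    then have "segment C l = p" "segment C l = q"
      using x mem_segment[OF l(1)] segment_eq unfolding jk l(2) by metis+
    with pq(3) show False by simp
  qed
qed

lemma W_in: "W C \<in> wpartitions n"
  unfolding W_def by (rule weighted_in[OF partition_segments])

lemma W_mono:
  assumes "C \<subseteq> C'"
  shows "wp_le n (W C) (W C')"
proof -
  have "segment C j \<subseteq> segment C' j" for j
    using assms by (auto simp: segment_def cut_block_def)
  then have "refines {1..n} (segments C) (segments C')"
    using partition_segments by (auto simp: refines_def segments_def)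
  then show ?thesis unfolding W_def by (rule weighted_mono)
qed

text \<open>Recovers the closed gaps from the partition, which makes \<open>W\<close> injective on
  subsets of \<open>{..<n - 1}\<close>.\<close>

lemma mem_cuts_iff:
  assumes "Suc t < n"
  shows "t \<in> C \<longleftrightarrow> (\<exists>B\<in>blocks (W C). w ! t \<in> B \<and> w ! Suc t \<in> B)"
proof -
  have "(\<exists>B\<in>blocks (W C). w ! t \<in> B \<and> w ! Suc t \<in> B) \<longleftrightarrow>
      (\<exists>j<n. t \<in> cut_block C j \<and> Suc t \<in> cut_block C j)"
    using assms mem_segment[of t] mem_segment[of "Suc t"] by (auto simp: W_def segments_def)
  also have "\<dots> \<longleftrightarrow> Suc t \<in> cut_block C t"
    using cut_block_eq cut_block_refl[of t] assms by auto
  also have "\<dots> \<longleftrightarrow> t \<in> C"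
    using assms by (simp add: cut_block_def)
  finally show ?thesis ..
qed

lemma W_inject:
  assumes "W C = W C'" "C \<subseteq> {..<n - 1}" "C' \<subseteq> {..<n - 1}"
  shows "C = C'"
proof -
  have "t \<in> C \<longleftrightarrow> t \<in> C'" if "Suc t < n" for t
    using mem_cuts_iff[OF that, of C] mem_cuts_iff[OF that, of C'] assms(1) by simp
  moreover have "Suc t < n" if "t \<in> C \<union> C'" for t
    using that assms(2,3) by auto
  ultimately show ?thesis by blast
qed

lemma W_less: "C \<subset> C' \<Longrightarrow> C' \<subseteq> {..<n - 1} \<Longrightarrow> lt (W C) (W C')"
  using W_mono[of C C'] W_inject[of C C'] by (auto simp: wp_less_def)

lemma W_empty: "W {} = lo"
proof -
  have "cut_block {} j = {j}" if "j < n" for j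
    using that by (auto simp: cut_block_def min_def max_def split: if_splits)
  then have "segments {} = (\<lambda>j. {w ! j}) ` {..<n}"
    by (auto simp: segments_def segment_def)
  also have "\<dots> = (\<lambda>x. {x}) ` {1..n}"
    using w(2) length_w by (auto simp: set_conv_nth)
  finally have "segments {} = (\<lambda>x. {x}) ` {1..n}" .
  moreover have "leader \<pi> {x} = x" if "x \<in> {1..n}" for x
    using leader_in[of "{x}" \<pi>] that \<pi> by auto
  ultimately show ?thesis by (auto simp: W_def weighted_def wp_bot_def image_image intro!: image_cong)
qed

lemma W_full: "W {..<n - 1} = hi"
proof -
  have "cut_block {..<n - 1} j = {..<n}" if "j < n" for j
    using that by (auto simp: cut_block_def)
  then have "segments {..<n - 1} = (\<lambda>j. (!) w ` {..<n}) ` {..<n}"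
    unfolding segments_def segment_def by (intro image_cong) auto
  then have "segments {..<n - 1} = {(!) w ` {..<n}}"
    using n2 by (simp add: image_constant_conv lessThan_empty_iff)
  also have "(!) w ` {..<n} = {1..n}"
    using w(2) length_w by (auto simp: set_conv_nth)
  finally have seg: "segments {..<n - 1} = {{1..n}}" .
  obtain a \<pi>' where a: "\<pi> = a # \<pi>'" using \<pi> n2 by (cases \<pi>) auto
  then have "a \<in> {1..n}" unfolding \<pi>[symmetric] by simp
  then have "leader \<pi> {1..n} = hd \<pi>" by (simp add: a leader_Cons)
  then have "R \<inter> ({1..n} - {leader \<pi> {1..n}}) = R" using R by auto
  then show ?thesis using R(2) unfolding W_def seg weighted_def wp_top_def by simp
qed

text \<open>The gaps in the order in which a planar tree closes them, \<open>j\<close> being the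
  position of its first leaf. The root closes the gap after the last leaf of \<open>l\<close>, whose
  position is \<open>j + length (leaves l) - 1\<close>.\<close>

fun cuts :: "bctree \<Rightarrow> nat \<Rightarrow> nat list" where
  "cuts (Leaf a) j = []"
| "cuts (Node c l r) j =
     cuts l j @ cuts r (j + length (leaves l)) @ [j + length (leaves l) - 1]"

fun W_chain :: "nat set \<Rightarrow> nat list \<Rightarrow> wpartition list" where
  "W_chain C [] = [W C]"
| "W_chain C (t # ts) = W C # W_chain (insert t C) ts"

lemma W_chain_append:
  "W_chain C (ts @ ts') = butlast (W_chain C ts) @ W_chain (C \<union> set ts) ts'"
proof -
  have ne: "W_chain C ts \<noteq> []" for C ts by (cases ts) auto
  show ?thesis by (induction ts arbitrary: C) (auto simp: ne)
qed

lemma last_W_chain: "last (W_chain C ts) = W (C \<union> set ts)"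
proof -
  have ne: "W_chain C ts \<noteq> []" for C ts by (cases ts) auto
  show ?thesis by (induction ts arbitrary: C) (auto simp: ne)
qed

lemma W_chain_eq: "W_chain C ts = map (\<lambda>k. W (C \<union> set (take k ts))) [0..<Suc (length ts)]"
proof (induction ts arbitrary: C)
  case (Cons t ts)
  have "[0..<Suc (length (t # ts))] = 0 # map Suc [0..<Suc (length ts)]"
    by (simp add: upt_conv_Cons map_Suc_upt del: upt_Suc)
  then show ?case by (simp add: Cons comp_def del: upt_Suc)
qed simp

lemma set_cuts: "set (cuts t j) = {j..<j + length (leaves t) - 1}"
proof (induction t arbitrary: j)
  case (Node c l r)
  obtain p q where "length (leaves l) = Suc p" "length (leaves r) = Suc q"
    by (metis leaves_nonempty length_0_conv not0_implies_Suc)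
  then show ?case by (auto simp: Node)
qed auto

lemma length_cuts: "length (cuts t j) + 1 = length (leaves t)"
  by (induction t arbitrary: j) (auto simp: Suc_eq_plus1[symmetric] simp del: Suc_eq_plus1)

lemma distinct_cuts: "distinct (cuts t j)"
  using card_distinct[of "cuts t j"] length_cuts[of t j] by (simp add: set_cuts)

text \<open>Walking along closed gaps cannot leave the range, as the gaps at its two borders are
  open or absent; the disjunctions cover the ends of the word.\<close>

lemma cut_block_interval:
  assumes C: "{a..<b - 1} \<subseteq> C" "a = 0 \<or> a - 1 \<notin> C" "b = n \<or> b - 1 \<notin> C" and b: "b \<le> n"
    and j: "a \<le> j" "j < b"
  shows "cut_block C j = {a..<b}"
proof
  show "cut_block C j \<subseteq> {a..<b}"
  proof
    fix k assume k: "k \<in> cut_block C j"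
    have "a \<le> k"
    proof (rule ccontr)
      assume "\<not> a \<le> k"
      then have "a - 1 \<in> {min j k..<max j k}" "a \<noteq> 0" using j by auto
      then show False using k C(2) by (auto simp: cut_block_def)
    qed
    moreover have "k < b"
    proof (rule ccontr)
      assume "\<not> k < b"
      then have "b - 1 \<in> {min j k..<max j k}" "b \<noteq> n" using j k by (auto simp: cut_block_def)
      then show False using k C(3) by (auto simp: cut_block_def)
    qed
    ultimately show "k \<in> {a..<b}" by simp
  qed
  show "{a..<b} \<subseteq> cut_block C j"
    using C(1) b j by (fastforce simp: cut_block_def min_def max_def split: if_splits)
qed

lemma cut_block_insert_other:
  assumes C: "{a..<b - 1} \<subseteq> insert t C" "a = 0 \<or> a - 1 \<notin> insert t C" "b = n \<or> b - 1 \<notin> insert t C"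
    and b: "b \<le> n" and t: "a \<le> t" "Suc t < b" and j: "j < n" "j < a \<or> b \<le> j"
  shows "cut_block (insert t C) j = cut_block C j"
proof
  show "cut_block (insert t C) j \<subseteq> cut_block C j"
  proof
    fix k assume k: "k \<in> cut_block (insert t C) j"
    have "t \<notin> {min j k..<max j k}"
    proof
      assume "t \<in> {min j k..<max j k}"
      then have "a - 1 \<in> {min j k..<max j k} \<and> a \<noteq> 0 \<or> b - 1 \<in> {min j k..<max j k} \<and> b \<noteq> n"
        using j t by (auto simp: min_def max_def split: if_splits)
      then show False using k C(2,3) unfolding cut_block_def by blast
    qed
    then show "k \<in> cut_block C j" using k unfolding cut_block_def by blast
  qed
qed (auto simp: cut_block_def)

text \<open>Closing the gap \<open>b - 1\<close> joins two adjacent segments and leaves the others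
  alone. By \<open>weight_union\<close>, the weight prescribed for the union is the one produced by
  a merge of color \<open>c\<close>.\<close>

lemma merge_W:
  assumes C: "{a..<b - 1} \<subseteq> C" "{b..<d - 1} \<subseteq> C" "a = 0 \<or> a - 1 \<notin> C" "b - 1 \<notin> C"
      "d = n \<or> d - 1 \<notin> C"
    and abd: "a < b" "b < d" "d \<le> n"
    and c: "c = Red \<longleftrightarrow> loser \<pi> ((!) w ` {a..<b}) ((!) w ` {b..<d}) \<in> R"
  shows "merge (u c) ((!) w ` {a..<b}) ((!) w ` {b..<d}) (W C) = W (insert (b - 1) C)"
proof -
  let ?L = "(!) w ` {a..<b}" and ?S = "(!) w ` {b..<d}" and ?C = "insert (b - 1) C"
  let ?rest = "segment C ` ({..<n} - {a..<d})"
  have L: "cut_block C j = {a..<b}" if "a \<le> j" "j < b" for j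
    using C abd that by (intro cut_block_interval) auto
  have S: "cut_block C j = {b..<d}" if "b \<le> j" "j < d" for j
    using C abd that by (intro cut_block_interval) auto
  have Cd: "{a..<d - 1} \<subseteq> ?C" "a = 0 \<or> a - 1 \<notin> ?C" "d = n \<or> d - 1 \<notin> ?C"
  proof -
    have "{a..<d - 1} = {a..<b - 1} \<union> {b - 1} \<union> {b..<d - 1}" using abd by auto
    then show "{a..<d - 1} \<subseteq> ?C" using C(1,2) by blast
    show "a = 0 \<or> a - 1 \<notin> ?C" "d = n \<or> d - 1 \<notin> ?C" using C(3,5) abd by auto
  qed
  have LS: "cut_block ?C j = {a..<d}" if "a \<le> j" "j < d" for j
    using Cd abd that by (intro cut_block_interval) auto
  have other: "cut_block ?C j = cut_block C j" if "j < n" "j < a \<or> d \<le> j" for j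
    using Cd abd that by (intro cut_block_insert_other[of a d]) auto
  have split: "{..<n} = {a..<b} \<union> {b..<d} \<union> ({..<n} - {a..<d})"
    "{..<n} = {a..<d} \<union> ({..<n} - {a..<d})" using abd by auto
  have imgs: "segment C ` {a..<b} = {?L}" "segment C ` {b..<d} = {?S}"
    "segment ?C ` {a..<d} = {(!) w ` {a..<d}}" "segment ?C ` ({..<n} - {a..<d}) = ?rest"
  proof -
    have "segment C ` {a..<b} = (\<lambda>j. ?L) ` {a..<b}" "segment C ` {b..<d} = (\<lambda>j. ?S) ` {b..<d}"
      "segment ?C ` {a..<d} = (\<lambda>j. (!) w ` {a..<d}) ` {a..<d}"
      by (intro image_cong; simp add: segment_def L S LS del: One_nat_def)+
    then show "segment C ` {a..<b} = {?L}" "segment C ` {b..<d} = {?S}"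
      "segment ?C ` {a..<d} = {(!) w ` {a..<d}}"
      using abd by (simp_all add: image_constant_conv)
    show "segment ?C ` ({..<n} - {a..<d}) = ?rest"
      by (intro image_cong) (auto simp: segment_def other simp del: One_nat_def)
  qed
  have seg: "segments C = {?L, ?S} \<union> ?rest"
    unfolding segments_def by (subst split(1)) (simp only: image_Un imgs insert_is_Un[of ?L "{?S}"])
  have ad: "(!) w ` {a..<d} = ?L \<union> ?S"
  proof -
    have "{a..<d} = {a..<b} \<union> {b..<d}" using abd by auto
    then show ?thesis by (simp only: image_Un)
  qed
  have seg': "segments ?C = insert (?L \<union> ?S) ?rest"
    unfolding segments_def by (subst split(2)) (simp only: image_Un imgs ad insert_is_Un[of "?L \<union> ?S" ?rest])
  have rest_ne: "B \<noteq> ?L \<and> B \<noteq> ?S" if B: "B \<in> ?rest" for B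
  proof -
    obtain j where j: "j < n" "j < a \<or> d \<le> j" "B = segment C j" using B by fastforce
    then have "w ! j \<in> B" using mem_segment cut_block_refl by simp
    moreover have "w ! j \<notin> ?L" "w ! j \<notin> ?S"
      using j(1,2) abd nth_w_inj by auto
    ultimately show ?thesis by auto
  qed
  have LS_dis: "?L \<inter> ?S = {}" using abd nth_w_inj by auto
  have sub: "?L \<union> ?S \<subseteq> set \<pi>"
    using abd w(2) \<pi> length_w by (auto simp flip: w(2))
  have weights: "weight (W C) ?L = card (R \<inter> (?L - {leader \<pi> ?L}))"
    "weight (W C) ?S = card (R \<inter> (?S - {leader \<pi> ?S}))"
    unfolding W_def by (rule weight_weighted; simp add: seg)+
  have uc: "u c = (if loser \<pi> ?L ?S \<in> R then 1 else 0)"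
    using c by (cases c) auto
  have total: "weight (W C) ?L + weight (W C) ?S + u c =
      card (R \<inter> (?L \<union> ?S - {leader \<pi> (?L \<union> ?S)}))"
    using weight_union[OF LS_dis _ _ sub, of R] abd unfolding weights uc by simp
  have old: "{(B, v) \<in> W C. B \<noteq> ?L \<and> B \<noteq> ?S} = weighted ?rest"
    using rest_ne unfolding W_def seg weighted_def by auto
  have "merge (u c) ?L ?S (W C) = weighted ?rest \<union> {(?L \<union> ?S, weight (W C) ?L + weight (W C) ?S + u c)}"
    unfolding merge_def old ..
  also have "\<dots> = W ?C"
    unfolding total by (simp add: W_def seg' weighted_def del: One_nat_def)
  finally show ?thesis .
qed

text \<open>Every node of a planar tree that obeys the rule closes one gap, so its chain never
  leaves the sublattice. In the induction the gaps inside the subtree start out open, and those at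
  its borders are open or absent.\<close>

lemma merge_chain_W:
  assumes "take (length (leaves t)) (drop a w) = leaves t" "a + length (leaves t) \<le> n"
    and "C \<inter> {a..<a + length (leaves t) - 1} = {}" "a = 0 \<or> a - 1 \<notin> C"
    and "a + length (leaves t) = n \<or> a + length (leaves t) - 1 \<notin> C" and "obeys \<pi> R t"
  shows "merge_chain (W C) (postorder t) = W_chain C (cuts t a)"
  using assms
proof (induction t arbitrary: a C)
  case (Node c l r)
  let ?l = "length (leaves l)" and ?r = "length (leaves r)"
  have pos: "0 < ?l" "0 < ?r" by simp_all
  have tk: "take (?l + ?r) (drop a w) = leaves l @ leaves r" using Node.prems(1) by simp
  have tl: "take ?l (drop a w) = leaves l"
    using arg_cong[OF tk, of "take ?l"] by simp
  have tr: "take ?r (drop (a + ?l) w) = leaves r"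
    using arg_cong[OF tk, of "drop ?l"] by (simp add: drop_take add.commute)
  \<comment> \<open>The closed gaps after the left subtree and after both subtrees; the gap
    \<open>?b - 1\<close> between the two is still open and belongs to the root.\<close>
  let ?Cl = "C \<union> {a..<a + ?l - 1}" and ?b = "a + ?l" and ?d = "a + ?l + ?r"
  let ?Cr = "?Cl \<union> {?b..<?d - 1}"
  have notin: "t \<notin> C" if "a \<le> t" "t < ?d - 1" for t
    using Node.prems(3) that by auto
  have nb: "?b - 1 \<notin> C" using pos by (intro notin) linarith+
  have 1: "merge_chain (W C) (postorder l) = W_chain C (cuts l a)"
  proof (rule Node.IH(1))
    show "C \<inter> {a..<?b - 1} = {}" using notin by auto
  qed (use Node.prems tl nb in auto)
  have run1: "wrun (W C) (postorder l) = W ?Cl"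
    using last_merge_chain[of "W C" "postorder l"] unfolding 1 last_W_chain set_cuts ..
  have 2: "merge_chain (W ?Cl) (postorder r) = W_chain ?Cl (cuts r ?b)"
  proof (rule Node.IH(2))
    show "?Cl \<inter> {?b..<?b + ?r - 1} = {}" using notin by auto
    show "?b = 0 \<or> ?b - 1 \<notin> ?Cl" using nb by auto
    show "?b + ?r = n \<or> ?b + ?r - 1 \<notin> ?Cl" using Node.prems(5) by (auto simp: add.assoc)
  qed (use Node.prems tr in auto)
  have run2: "wrun (W ?Cl) (postorder r) = W ?Cr"
    using last_merge_chain[of "W ?Cl" "postorder r"] unfolding 2 last_W_chain set_cuts ..
  have labels_nth: "set (take m (drop j w)) = (!) w ` {j..<j + m}" if "j + m \<le> n" for j m
  proof -
    have "take m (drop j w) = map ((!) w) [j..<j + m]"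
      using that length_w by (intro nth_equalityI) auto
    then show ?thesis by simp
  qed
  have lab: "labels l = (!) w ` {a..<?b}" "labels r = (!) w ` {?b..<?d}"
    using labels_nth[of a ?l] labels_nth[of ?b ?r] Node.prems(2) tl tr by simp_all
  have 3: "merge (u c) (labels l) (labels r) (W ?Cr) = W (insert (?b - 1) ?Cr)"
    unfolding lab
  proof (rule merge_W)
    show "a = 0 \<or> a - 1 \<notin> ?Cr" using Node.prems(4) pos by auto
    have neg: "\<not> ?b \<le> ?b - 1" using pos by linarith
    show "?b - 1 \<notin> ?Cr"
      by (simp only: Un_iff atLeastLessThan_iff nb neg less_irrefl simp_thms)
    show "?d = n \<or> ?d - 1 \<notin> ?Cr" using Node.prems(5) by (auto simp: add.assoc)
    show "c = Red \<longleftrightarrow> loser \<pi> ((!) w ` {a..<?b}) ((!) w ` {?b..<?d}) \<in> R"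
      using Node.prems(6) unfolding obeys.simps lab by simp
  qed (use Node.prems(2) pos in auto)
  show ?case
    by (simp add: merge_chain_append W_chain_append 1 2 run1 run2 set_cuts 3
        del: One_nat_def)
qed simp

text \<open>The sets have sizes 1 to \<open>n - 2\<close>; the empty and the full set give the
  endpoints of the interval and are left out.\<close>

definition perm_chain :: "(nat \<Rightarrow> nat) \<Rightarrow> wpartition list" where
  "perm_chain p = map (\<lambda>k. W (p ` {..k})) [0..<n - 2]"

lemma length_perm_chain [simp]: "length (perm_chain p) = n - 2"
  by (simp add: perm_chain_def)

lemma nth_perm_chain: "k < n - 2 \<Longrightarrow> perm_chain p ! k = W (p ` {..k})"
  by (simp add: perm_chain_def)

lemma W_inside:
  assumes "C \<subset> {..<n - 1}" "C \<noteq> {}"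
  shows "W C \<in> inside"
  using W_less[of "{}" C] W_less[OF assms(1) order_refl] assms W_in
  unfolding W_empty W_full inside_def by auto

lemma perm_prefix:
  assumes p: "p permutes {..<n - 1}" and "k < n - 2"
  shows "p ` {..k} \<subset> {..<n - 1}"
proof -
  have "{..k} \<subseteq> {..<n - 1}" "n - 2 \<in> {..<n - 1}" "n - 2 \<notin> {..k}"
    using assms(2) n2 by auto
  then have "{..k} \<subset> {..<n - 1}" by blast
  then have "p ` {..k} \<subset> p ` {..<n - 1}"
    by (rule image_strict_mono[OF permutes_inj_on[OF p]])
  then show ?thesis using permutes_image[OF p] by simp
qed

lemma perm_chain_in_chains:
  assumes p: "p permutes {..<n - 1}"
  shows "perm_chain p \<in> chains inside lt (int n - 3)"
proof -
  have "W (p ` {..k}) \<in> inside" if "k < n - 2" for k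
    using perm_prefix[OF p that] by (intro W_inside) auto
  then have "set (perm_chain p) \<subseteq> inside" by (auto simp: perm_chain_def)
  moreover have "sorted_wrt lt (perm_chain p)"
  proof -
    have "lt (W (p ` {..j})) (W (p ` {..k}))" if "j < k" "k < n - 2" for j k
    proof (rule W_less)
      have "{..j} \<subset> {..k}" using that by auto
      then show "p ` {..j} \<subset> p ` {..k}"
        by (rule image_strict_mono[OF permutes_inj_on[OF p]])
      show "p ` {..k} \<subseteq> {..<n - 1}" using perm_prefix[OF p that(2)] by blast
    qed
    then show ?thesis by (simp add: sorted_wrt_iff_nth_less nth_perm_chain)
  qed
  ultimately show ?thesis using n2 by (auto simp: chains_def)
qed

text \<open>By injectivity of \<open>W\<close> the chain determines the images of all initial
  segments, and consecutive ones differ by one value of the permutation.\<close>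

lemma perm_chain_inject:
  assumes p: "p permutes {..<n - 1}" and q: "q permutes {..<n - 1}"
    and eq: "perm_chain p = perm_chain q"
  shows "p = q"
proof -
  have prefix: "p ` {..<k} = q ` {..<k}" if "k \<le> n - 1" for k
  proof -
    have "k = 0 \<or> k = n - 1 \<or> k = Suc (k - 1) \<and> k - 1 < n - 2" using that by arith
    then consider "k = 0" | "k = n - 1" | "k = Suc (k - 1)" "k - 1 < n - 2" by blast
    then show ?thesis
    proof cases
      case 2
      then show ?thesis using permutes_image[OF p] permutes_image[OF q] by simp
    next
      case 3
      define j where "j = k - 1"
      have 3: "k = Suc j" "j < n - 2" using 3 by (simp_all add: j_def)
      have "W (p ` {..j}) = W (q ` {..j})"
        using arg_cong[OF eq, of "\<lambda>c. c ! j"] 3 by (simp add: nth_perm_chain)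
      then have "p ` {..j} = q ` {..j}"
        using perm_prefix[OF p 3(2)] perm_prefix[OF q 3(2)] by (intro W_inject) auto
      then show ?thesis using 3 by (simp add: lessThan_Suc_atMost)
    qed simp
  qed
  have diff: "r ` {..<Suc k} - r ` {..<k} = {r k}" if "r permutes {..<n - 1}" for r k
    using permutes_inj[OF that] by (auto simp: inj_eq less_Suc_eq)
  show ?thesis
  proof
    fix k
    show "p k = q k"
    proof (cases "k < n - 1")
      case True
      then have "{p k} = {q k}"
        using prefix[of k] prefix[of "Suc k"] diff[OF p, of k] diff[OF q, of k] by simp
      then show ?thesis by simp
    qed (use p q in \<open>simp add: permutes_def\<close>)
  qed
qed

text \<open>The fundamental cycle of the Boolean lattice of cut sets, as a functional on maximal chains.\<close>

definition cycle :: "wpartition list \<Rightarrow> int" where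
  "cycle c = (\<Sum>p | p permutes {..<n - 1}. if c = perm_chain p then sign p else 0)"

lemma cycle_perm_chain:
  assumes "p permutes {..<n - 1}"
  shows "cycle (perm_chain p) = sign p"
proof -
  have "cycle (perm_chain p) = (\<Sum>q | q permutes {..<n - 1}. if q = p then sign p else 0)"
    unfolding cycle_def using perm_chain_inject[OF _ assms] by (intro sum.cong) auto
  also have "\<dots> = sign p" using assms by (simp add: finite_permutations)
  finally show ?thesis .
qed

lemma cycle_nonzeroD:
  assumes "cycle c \<noteq> 0"
  obtains p where "p permutes {..<n - 1}" "c = perm_chain p"
proof (rule ccontr)
  assume "\<not> thesis"
  then have "c \<noteq> perm_chain p" if "p permutes {..<n - 1}" for p
    using that \<open>\<And>p. p permutes {..<n - 1} \<Longrightarrow> c = perm_chain p \<Longrightarrow> thesis\<close> by blast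
  then have "cycle c = 0" unfolding cycle_def by (intro sum.neutral) auto
  with assms show False by contradiction
qed

text \<open>Composing a permutation with the transposition of \<open>j\<close> and
  \<open>Suc j\<close> changes its chain only at position \<open>j\<close> and reverses the sign. So
  the sum equals its own negative, and being an integer it is zero; this is why \<open>cycle\<close>
  takes integer values, as the conclusion would fail in characteristic 2.\<close>

lemma cycle_gap:
  assumes c: "c \<in> chains inside lt (int n - 4)" and j: "j \<le> length c"
  shows "(\<Sum>\<alpha>\<in>gap inside lt c j. cycle (take j c @ \<alpha> # drop j c)) = 0"
proof -
  let ?G = "gap inside lt c j" and ?ins = "\<lambda>\<alpha>. take j c @ \<alpha> # drop j c"
  let ?A = "\<lambda>p. \<exists>\<alpha>\<in>?G. ?ins \<alpha> = perm_chain p"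
  let ?Ps = "{p. p permutes {..<n - 1}}"
  let ?\<tau> = "transpose j (Suc j)"
  have len: "length c + 3 = n" using c n2 by (auto simp: chains_def)
  then have \<tau>: "?\<tau> permutes {..<n - 1}" using j by (intro permutes_swap_id) auto
  have fin: "finite ?G"
    by (rule finite_subset[OF _ finite_wpartitions[of n]]) (auto simp: gap_def inside_def)
  \<comment> \<open>A permutation accounts for at most one filling of the gap, since its chain
    determines the entry at \<open>j\<close>.\<close>
  have inner_sum: "(\<Sum>\<alpha>\<in>?G. if ?ins \<alpha> = perm_chain p then sign p else 0) =
      (if ?A p then sign p else 0)" for p
  proof (cases "?A p")
    case True
    then obtain \<alpha>0 where \<alpha>0: "\<alpha>0 \<in> ?G" "?ins \<alpha>0 = perm_chain p" by blast
    have "?ins \<alpha> = perm_chain p \<longleftrightarrow> \<alpha> = \<alpha>0" for \<alpha>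
      unfolding \<alpha>0(2)[symmetric] by simp
    then show ?thesis using True \<alpha>0(1) fin by simp
  qed auto
  have S: "(\<Sum>\<alpha>\<in>?G. cycle (?ins \<alpha>)) = (\<Sum>p\<in>?Ps. if ?A p then sign p else 0)"
    unfolding cycle_def by (subst sum.swap) (simp add: inner_sum)
  have A_swap: "?A (p \<circ> ?\<tau>)" if p: "p permutes {..<n - 1}" and A: "?A p" for p
  proof -
    obtain \<alpha> where \<alpha>: "?ins \<alpha> = perm_chain p" using A by blast
    have q: "p \<circ> ?\<tau> permutes {..<n - 1}" by (rule permutes_compose[OF \<tau> p])
    define \<alpha>' where "\<alpha>' = perm_chain (p \<circ> ?\<tau>) ! j"
    \<comment> \<open>The transposition fixes \<open>{..k}\<close> pointwise for
      \<open>k < j\<close> and as a set for \<open>k > j\<close>.\<close>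
    have same: "perm_chain (p \<circ> ?\<tau>) ! k = perm_chain p ! k" if "k < n - 2" "k \<noteq> j" for k
    proof -
      have "?\<tau> ` {..k} = {..k}"
      proof (cases "k < j")
        case True
        then show ?thesis by (auto simp: transpose_def image_iff)
      next
        case False
        then have "?\<tau> permutes {..k}" using that(2) by (intro permutes_swap_id) auto
        then show ?thesis by (rule permutes_image)
      qed
      then have "(p \<circ> ?\<tau>) ` {..k} = p ` {..k}" by (simp only: image_comp[symmetric])
      then show ?thesis using that(1) by (simp only: nth_perm_chain)
    qed
    have eq: "?ins \<alpha>' = perm_chain (p \<circ> ?\<tau>)"
    proof (rule nth_equalityI)
      show "length (?ins \<alpha>') = length (perm_chain (p \<circ> ?\<tau>))" using len j by simp
      fix k assume "k < length (?ins \<alpha>')"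
      then have k: "k < n - 2" using len j by simp
      show "?ins \<alpha>' ! k = perm_chain (p \<circ> ?\<tau>) ! k"
      proof (cases "k = j")
        case True
        then show ?thesis using j by (simp add: nth_append \<alpha>'_def)
      next
        case False
        have "?ins \<alpha>' ! k = ?ins \<alpha> ! k" using False j by (auto simp: nth_append nth_Cons')
        then show ?thesis using same[OF k False] \<alpha> by simp
      qed
    qed
    have "?ins \<alpha>' \<in> chains inside lt (int n - 3)"
      unfolding eq by (rule perm_chain_in_chains[OF q])
    then have \<alpha>'_in: "\<alpha>' \<in> inside" and sorted: "sorted_wrt lt (?ins \<alpha>')"
      by (auto simp: chains_def)
    have "lt (c ! (j - 1)) \<alpha>'" if "0 < j"
    proof -
      have "c ! (j - 1) \<in> set (take j c)" using that j by (auto simp: in_set_conv_nth intro!: exI[of _ "j - 1"])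
      then show ?thesis using sorted by (simp add: sorted_wrt_append)
    qed
    moreover have "lt \<alpha>' (c ! j)" if "j < length c"
    proof -
      have "c ! j \<in> set (drop j c)" using that by (simp add: Cons_nth_drop_Suc[symmetric])
      then show ?thesis using sorted by (simp add: sorted_wrt_append)
    qed
    ultimately have "\<alpha>' \<in> ?G" using \<alpha>'_in by (simp add: gap_def)
    then show ?thesis using eq by blast
  qed
  have A_iff: "?A (p \<circ> ?\<tau>) \<longleftrightarrow> ?A p" if p: "p permutes {..<n - 1}" for p
  proof -
    have "(p \<circ> ?\<tau>) \<circ> ?\<tau> = p" by (simp add: comp_assoc)
    then show ?thesis
      using A_swap[OF p] A_swap[OF permutes_compose[OF \<tau> p]] by auto
  qed
  have "(\<Sum>p\<in>?Ps. if ?A p then sign p else 0) =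
      (\<Sum>p\<in>?Ps. if ?A (p \<circ> ?\<tau>) then sign (p \<circ> ?\<tau>) else 0)"
    by (rule sum_permutations_compose_right[OF \<tau>])
  also have "\<dots> = (\<Sum>p\<in>?Ps. - (if ?A p then sign p else 0))"
  proof (rule sum.cong[OF refl])
    fix p assume "p \<in> ?Ps"
    then have p: "p permutes {..<n - 1}" by simp
    have "permutation p" "permutation ?\<tau>" using p \<tau> by (auto simp: permutation_permutes)
    then have "sign (p \<circ> ?\<tau>) = - sign p" by (simp add: sign_compose sign_swap_id)
    then show "(if ?A (p \<circ> ?\<tau>) then sign (p \<circ> ?\<tau>) else 0) = - (if ?A p then sign p else 0)"
      using A_iff[OF p] by simp
  qed
  also have "\<dots> = - (\<Sum>p\<in>?Ps. if ?A p then sign p else 0)" by (simp add: sum_negf)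
  finally show ?thesis unfolding S by simp
qed

definition cycle_functional :: "(wpartition list \<Rightarrow>\<^sub>0 'k::comm_ring_1) \<Rightarrow> 'k" where
  "cycle_functional f = (\<Sum>c\<in>Poly_Mapping.keys f. Poly_Mapping.lookup f c * of_int (cycle c))"

lemma cycle_functional_eq:
  assumes "finite S" "Poly_Mapping.keys f \<subseteq> S"
  shows "cycle_functional f = (\<Sum>c\<in>S. Poly_Mapping.lookup f c * of_int (cycle c))"
  unfolding cycle_functional_def
  using assms by (intro sum.mono_neutral_left) (auto simp: in_keys_iff)

lemma cycle_functional_add: "cycle_functional (f + g) = cycle_functional f + cycle_functional g"
proof -
  let ?S = "Poly_Mapping.keys f \<union> Poly_Mapping.keys g"
  have "Poly_Mapping.keys (f + g) \<subseteq> ?S" by (rule keys_add)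
  then show ?thesis
    by (simp add: cycle_functional_eq[of ?S] lookup_add algebra_simps sum.distrib)
qed

lemma cycle_functional_fscale: "cycle_functional (fscale a f) = a * cycle_functional f"
  using keys_fscale[of a f]
  by (simp add: cycle_functional_eq[of "Poly_Mapping.keys f"] sum_distrib_left mult.assoc)

lemma cycle_functional_0: "cycle_functional 0 = 0"
  by (simp add: cycle_functional_def)

lemma cycle_functional_sum: "cycle_functional (\<Sum>x\<in>S. f x) = (\<Sum>x\<in>S. cycle_functional (f x))"
  by (induction S rule: infinite_finite_induct)
    (auto simp: cycle_functional_add cycle_functional_0)

lemma cycle_functional_single: "cycle_functional (Poly_Mapping.single c b) = b * of_int (cycle c)"
  by (simp add: cycle_functional_eq[of "{c}"])

text \<open>Each gap of each chain contributes zero by \<open>cycle_gap\<close>. The functional is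
  therefore well defined on cohomology classes.\<close>

lemma cycle_functional_coboundary:
  assumes "f \<in> coboundary inside lt ` cochains inside lt (int n - 4)"
  shows "cycle_functional f = 0"
proof -
  obtain g where g: "g \<in> cochains inside lt (int n - 4)" "f = coboundary inside lt g"
    using assms by blast
  have "cycle_functional (chain_coboundary inside lt c :: _ \<Rightarrow>\<^sub>0 'a) = 0"
    if c: "c \<in> chains inside lt (int n - 4)" for c
  proof -
    have "cycle_functional (chain_coboundary inside lt c :: _ \<Rightarrow>\<^sub>0 'a) =
        (\<Sum>j\<le>length c. (- 1) ^ j *
          of_int (\<Sum>\<alpha>\<in>gap inside lt c j. cycle (take j c @ \<alpha> # drop j c)))"
      by (simp add: chain_coboundary_def cycle_functional_sum cycle_functional_single
          sum_distrib_left)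
    also have "\<dots> = 0" using cycle_gap[OF c] by (intro sum.neutral) simp
    finally show ?thesis .
  qed
  then have "cycle_functional (fscale (Poly_Mapping.lookup g c) (chain_coboundary inside lt c)) = 0"
    if "c \<in> Poly_Mapping.keys g" for c
    using that g(1) by (auto simp: cycle_functional_fscale cochains_def)
  then show ?thesis
    unfolding g(2) coboundary_eq[OF finite_keys order_refl] cycle_functional_sum
    by (intro sum.neutral) simp
qed

end

section \<open>Independence of the combs\<close>

lemma finite_trees: "finite S \<Longrightarrow> finite {t. length (leaves t) \<le> m \<and> labels t \<subseteq> S}"
proof (induction m)
  case 0
  have "{t. length (leaves t) \<le> 0 \<and> labels t \<subseteq> S} = {}" by auto
  then show ?case by simp
next
  case (Suc m)
  let ?T = "{t. length (leaves t) \<le> m \<and> labels t \<subseteq> S}"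
  have "finite (UNIV :: color set)"
    by (rule finite_subset[of _ "{Blue, Red}"]) (auto intro: color.exhaust)
  then have fin: "finite (Leaf ` S \<union> (\<lambda>(c, l, r). Node c l r) ` (UNIV \<times> ?T \<times> ?T))"
    using Suc by simp
  have mem: "t \<in> Leaf ` S \<union> (\<lambda>(c, l, r). Node c l r) ` (UNIV \<times> ?T \<times> ?T)"
    if "length (leaves t) \<le> Suc m" "labels t \<subseteq> S" for t
  proof (cases t)
    case (Node c l r)
    obtain p q where "length (leaves l) = Suc p" "length (leaves r) = Suc q"
      by (metis leaves_nonempty length_0_conv not0_implies_Suc)
    then have "(c, l, r) \<in> UNIV \<times> ?T \<times> ?T" using that Node by auto
    then have "(\<lambda>(c, l, r). Node c l r) (c, l, r) \<in> (\<lambda>(c, l, r). Node c l r) ` (UNIV \<times> ?T \<times> ?T)"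
      by (rule imageI)
    then show ?thesis unfolding Node by simp
  qed (use that in auto)
  show ?case by (rule finite_subset[OF _ fin]) (use mem in blast)
qed

lemma finite_combs: "finite S \<Longrightarrow> finite (combs S k)"
  by (rule finite_subset[OF _ finite_trees[of S "card S"]])
    (auto simp: combs_def simp flip: distinct_card)

lemma Comb2_eq: "Comb2 n i = combs {1..n} i"
  by (auto simp: Comb2_def BT_def combs_def bicolored_comb_iff permutations_of_set_def)

lemma full_postorder:
  assumes "distinct (leaves t)" "labels t = {1..n}" "red_nodes t = i"
  shows "full n i (postorder t)"
proof -
  have "ready (singles n) t" using assms by (auto simp: ready_def singles_def)
  from run_postorder[OF partition_on_singles this]
  have r: "valid (singles n) (postorder t)"
    "run (singles n) (postorder t) = insert {1..n} {B \<in> singles n. B \<inter> {1..n} = {}}"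
    using assms(2) by simp_all
  have e: "{B \<in> singles n. B \<inter> {1..n} = {}} = {}" by (auto simp: singles_def)
  have "run (singles n) (postorder t) = {{1..n}}" unfolding r(2) e ..
  then show ?thesis using r(1) assms(3) by (simp add: full_def)
qed

text \<open>As soon as the root of a subtree has been processed, its labels form a block whose
  weight is its number of red nodes. The chain thus remembers all subtrees together with their red
  counts.\<close>

lemma subtree_blocks:
  assumes "\<alpha> \<in> wpartitions n" "distinct (leaves t)" "\<forall>a\<in>labels t. ({a}, 0) \<in> \<alpha>"
  shows "wrun \<alpha> (postorder t) \<in> wpartitions n \<and> (labels t, red_nodes t) \<in> wrun \<alpha> (postorder t) \<and>
    (\<forall>(S, v)\<in>\<alpha>. S \<inter> labels t = {} \<longrightarrow> (S, v) \<in> wrun \<alpha> (postorder t)) \<and>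
    (\<forall>s\<in>subtrees t. \<exists>\<beta>\<in>set (merge_chain \<alpha> (postorder t)). (labels s, red_nodes s) \<in> \<beta>)"
  using assms
proof (induction t arbitrary: \<alpha>)
  case (Node c l r)
  let ?L = "labels l" and ?R = "labels r"
  have dis: "?L \<inter> ?R = {}" using Node.prems(2) by simp
  define \<beta> where "\<beta> = wrun \<alpha> (postorder l)"
  define \<gamma> where "\<gamma> = wrun \<beta> (postorder r)"
  have l: "\<beta> \<in> wpartitions n" "(?L, red_nodes l) \<in> \<beta>"
    "\<And>S v. (S, v) \<in> \<alpha> \<Longrightarrow> S \<inter> ?L = {} \<Longrightarrow> (S, v) \<in> \<beta>"
    "\<And>s. s \<in> subtrees l \<Longrightarrow> \<exists>\<beta>\<in>set (merge_chain \<alpha> (postorder l)). (labels s, red_nodes s) \<in> \<beta>"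
    using Node.IH(1)[OF Node.prems(1)] Node.prems(2,3) unfolding \<beta>_def by auto
  have "({a}, 0) \<in> \<beta>" if "a \<in> ?R" for a
    using Node.prems(3) dis that by (intro l(3)) auto
  then have r: "\<gamma> \<in> wpartitions n" "(?R, red_nodes r) \<in> \<gamma>"
    "\<And>S v. (S, v) \<in> \<beta> \<Longrightarrow> S \<inter> ?R = {} \<Longrightarrow> (S, v) \<in> \<gamma>"
    "\<And>s. s \<in> subtrees r \<Longrightarrow> \<exists>\<gamma>\<in>set (merge_chain \<beta> (postorder r)). (labels s, red_nodes s) \<in> \<gamma>"
    using Node.IH(2)[OF l(1)] Node.prems(2) unfolding \<gamma>_def by auto
  have L\<gamma>: "(?L, red_nodes l) \<in> \<gamma>" by (rule r(3)[OF l(2) dis])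
  have neLR: "?L \<noteq> ?R" using dis hd_leaves_in_labels[of l] by blast
  interpret two_blocks n \<gamma> ?L ?R
    using r(1) blocksI[OF L\<gamma>] blocksI[OF r(2)] neLR by unfold_locales
  have w: "weight \<gamma> ?L = red_nodes l" "weight \<gamma> ?R = red_nodes r"
    using weight_eq[OF wpartitionsD(2)[OF r(1)]] L\<gamma> r(2) by auto
  let ?\<delta> = "merge (u c) ?L ?R \<gamma>"
  have run: "wrun \<alpha> (postorder (Node c l r)) = ?\<delta>"
    by (simp add: \<beta>_def \<gamma>_def)
  have red: "red_nodes (Node c l r) = red_nodes l + red_nodes r + u c" by (cases c) auto
  have top: "(labels (Node c l r), red_nodes (Node c l r)) \<in> ?\<delta>"
    unfolding red by (simp add: merge_def w)
  have mc: "set (merge_chain \<alpha> (xs @ ys)) = set (merge_chain \<alpha> xs) \<union> set (merge_chain (wrun \<alpha> xs) ys)"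
    for \<alpha> xs ys
  proof -
    have "set (merge_chain \<alpha> xs) = insert (wrun \<alpha> xs) (set (butlast (merge_chain \<alpha> xs)))"
      using append_butlast_last_id[of "merge_chain \<alpha> xs"] last_merge_chain[of \<alpha> xs]
      by (metis insert_is_Un merge_chain_nonempty set_append list.simps(15) empty_set sup_commute)
    moreover have "wrun \<alpha> xs \<in> set (merge_chain (wrun \<alpha> xs) ys)"
      using hd_in_set[of "merge_chain (wrun \<alpha> xs) ys"] by simp
    ultimately show ?thesis by (auto simp: merge_chain_append)
  qed
  have set_mc: "set (merge_chain \<alpha> (postorder (Node c l r))) =
      set (merge_chain \<alpha> (postorder l)) \<union> set (merge_chain \<beta> (postorder r)) \<union> {\<gamma>, ?\<delta>}"
    by (simp add: mc \<beta>_def \<gamma>_def insert_commute Un_assoc)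
  show ?case
  proof (intro conjI)
    show "wrun \<alpha> (postorder (Node c l r)) \<in> wpartitions n"
      unfolding run by (rule merge_in[OF u_le_1])
    show "(labels (Node c l r), red_nodes (Node c l r)) \<in> wrun \<alpha> (postorder (Node c l r))"
      unfolding run by (rule top)
    show "\<forall>(S, v)\<in>\<alpha>. S \<inter> labels (Node c l r) = {} \<longrightarrow> (S, v) \<in> wrun \<alpha> (postorder (Node c l r))"
    proof (clarify)
      fix S v assume S: "(S, v) \<in> \<alpha>" "S \<inter> labels (Node c l r) = {}"
      then have "(S, v) \<in> \<gamma>" by (intro r(3) l(3)) auto
      moreover have "S \<noteq> {}" using wpartitionsD(5)[OF Node.prems(1) blocksI[OF S(1)]] .
      then have "S \<noteq> ?L" "S \<noteq> ?R" using S(2) by auto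
      ultimately show "(S, v) \<in> wrun \<alpha> (postorder (Node c l r))"
        unfolding run by (simp add: merge_def)
    qed
    show "\<forall>s\<in>subtrees (Node c l r).
        \<exists>\<beta>\<in>set (merge_chain \<alpha> (postorder (Node c l r))). (labels s, red_nodes s) \<in> \<beta>"
    proof
      fix s assume "s \<in> subtrees (Node c l r)"
      then consider "s = Node c l r" | "s \<in> subtrees l" | "s \<in> subtrees r" by auto
      then show "\<exists>\<beta>\<in>set (merge_chain \<alpha> (postorder (Node c l r))). (labels s, red_nodes s) \<in> \<beta>"
      proof cases
        case 1
        then show ?thesis using top unfolding set_mc by blast
      next
        case 2
        then show ?thesis using l(4) unfolding set_mc by blast
      next
        case 3
        then show ?thesis using r(4) unfolding set_mc by blast
      qed
    qed
  qed
qed auto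

context word_cycle
begin

text \<open>The gaps closed by \<open>t\<close>, in order, form a permutation; the chain of
  \<open>t\<close> is the chain of this permutation, and the value is its sign.\<close>

lemma cycle_self:
  assumes "leaves t = w" "obeys \<pi> R t" "red_nodes t = i"
  shows "cycle (inner (postorder t)) \<in> {1, - 1}"
proof -
  let ?cs = "cuts t 0"
  have lt: "length (leaves t) = n" using assms(1) length_w by simp
  have len: "length ?cs = n - 1" using length_cuts[of t 0] lt by linarith
  have set_cs: "set ?cs = {..<n - 1}" unfolding set_cuts lt by (simp add: lessThan_atLeast0)
  define p where "p k = (if k < n - 1 then ?cs ! k else k)" for k
  have p: "p permutes {..<n - 1}"
  proof (rule bij_imp_permutes)
    have "bij_betw ((!) ?cs) {..<n - 1} {..<n - 1}"
      using distinct_cuts len set_cs by (intro bij_betw_nth) simp_all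
    then show "bij_betw p {..<n - 1} {..<n - 1}"
      by (rule bij_betw_cong[THEN iffD1, rotated]) (simp add: p_def)
  qed (simp add: p_def)
  have mc: "merge_chain lo (postorder t) = W_chain {} ?cs"
    unfolding W_empty[symmetric]
  proof (rule merge_chain_W)
    show "take (length (leaves t)) (drop 0 w) = leaves t" using assms(1) by simp
  qed (use lt assms(2) in simp_all)
  have "inner (postorder t) = perm_chain p"
  proof (rule nth_equalityI)
    show "length (inner (postorder t)) = length (perm_chain p)"
      unfolding inner_def mc W_chain_eq using len n2 by (simp del: upt_Suc)
    fix k assume "k < length (inner (postorder t))"
    then have k: "k < n - 2"
      unfolding inner_def mc W_chain_eq using len n2 by (simp del: upt_Suc)
    have "Suc k < n" using k by simp
    then have "[0..<n] ! Suc k = Suc k" by (subst nth_upt) auto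
    then have "inner (postorder t) ! k = W (set (take (Suc k) ?cs))"
      unfolding inner_def mc W_chain_eq using k len n2
      by (simp add: nth_butlast nth_tl del: upt_Suc)
    also have "set (take (Suc k) ?cs) = p ` {..k}"
    proof -
      have "set (take (Suc k) ?cs) = (!) ?cs ` {..<Suc k}"
        using nth_image[of "Suc k" ?cs] k len by (simp add: lessThan_atLeast0)
      also have "\<dots> = p ` {..k}"
        unfolding lessThan_Suc_atMost using k by (intro image_cong) (auto simp: p_def)
      finally show ?thesis .
    qed
    finally show "inner (postorder t) ! k = perm_chain p ! k"
      using k by (simp add: nth_perm_chain)
  qed
  then show ?thesis using cycle_perm_chain[OF p] sign_cases[of p] by auto
qed

text \<open>A nonzero value places the whole chain in the sublattice. By
  \<open>subtree_blocks\<close>, the labels of each subtree are then a segment of \<open>w\<close>,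
  which yields the comparison of words, and its red count is the prescribed weight, which yields the
  colors.\<close>

lemma cycle_detect:
  assumes t: "t \<in> combs {1..n} i" and nz: "cycle (inner (postorder t)) \<noteq> 0"
  shows "leaves t = w \<or> (leaves t, w) \<in> lex less_than" "obeys \<pi> R t"
proof -
  have tD: "distinct (leaves t)" "labels t = {1..n}" "red_nodes t = i" "normalized t"
    using t by (auto simp: combs_def)
  have F: "full n i (postorder t)" by (rule full_postorder[OF tD(1-3)])
  obtain p where p: "inner (postorder t) = perm_chain p" using nz by (rule cycle_nonzeroD)
  have W_range: "\<beta> \<in> range W" if "\<beta> \<in> set (merge_chain lo (postorder t))" for \<beta>
    using that W_empty W_full unfolding merge_chain_full[OF F] p
    by (auto simp: perm_chain_def)
  have sub: "\<exists>C. (labels s, red_nodes s) \<in> W C" if "s \<in> subtrees t" for s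
  proof -
    have "\<forall>a\<in>labels t. ({a}, 0) \<in> lo" using tD(2) by (auto simp: wp_bot_def)
    from subtree_blocks[OF bot_in tD(1) this] that
    obtain \<beta> where "\<beta> \<in> set (merge_chain lo (postorder t))" "(labels s, red_nodes s) \<in> \<beta>" by blast
    then show ?thesis using W_range by blast
  qed
  have weight_s: "red_nodes s = card (R \<inter> (labels s - {leader \<pi> (labels s)}))"
    if "s \<in> subtrees t" for s
    using sub[OF that] by (auto simp: W_def weighted_def)
  have contiguous: "\<exists>p v q. w = p @ v @ q \<and> set v = labels s" if st: "s \<in> subtrees t" for s
  proof -
    obtain C j where j: "j < n" "labels s = (!) w ` cut_block C j"
      using sub[OF st] by (auto simp: W_def weighted_def segments_def segment_def)
    let ?K = "cut_block C j"
    have K: "finite ?K" "?K \<noteq> {}" "?K \<subseteq> {..<n}"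
      using cut_block_refl[OF j(1), of C] by (auto simp: cut_block_def)
    have convex: "x \<in> ?K" if "k \<in> ?K" "l \<in> ?K" "k \<le> x" "x \<le> l" for k l x
    proof -
      have "{min j x..<max j x} \<subseteq> {min j k..<max j k} \<union> {min j l..<max j l}"
        using that(3,4) by (auto simp: min_def max_def split: if_splits)
      moreover have "x < n" using that(2,4) by (auto simp: cut_block_def)
      ultimately show ?thesis using that(1,2) unfolding cut_block_def by blast
    qed
    have K_eq: "?K = {Min ?K..<Suc (Max ?K)}"
    proof
      show "?K \<subseteq> {Min ?K..<Suc (Max ?K)}"
        using Min_le[OF K(1)] Max_ge[OF K(1)] by (auto simp: less_Suc_eq_le)
      show "{Min ?K..<Suc (Max ?K)} \<subseteq> ?K"
        using convex[OF Min_in[OF K(1,2)] Max_in[OF K(1,2)]] by (auto simp: less_Suc_eq_le)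
    qed
    define a b where "a = Min ?K" and "b = Suc (Max ?K)"
    have "Min ?K \<le> Max ?K" by (rule Min_le[OF K(1) Max_in[OF K(1,2)]])
    moreover have "Max ?K < n" using Max_in[OF K(1,2)] K(3) by blast
    ultimately have ab: "a < b" "b \<le> n" by (simp_all add: a_def b_def)
    have "take (b - a) (drop a w) = map ((!) w) [a..<b]"
      using ab length_w by (intro nth_equalityI) auto
    then have "set (take (b - a) (drop a w)) = labels s"
      unfolding j(2) using K_eq unfolding a_def[symmetric] b_def[symmetric] by simp
    moreover have "w = take a w @ take (b - a) (drop a w) @ drop (b - a) (drop a w)"
      by (simp only: append_take_drop_id)
    ultimately show ?thesis by blast
  qed
  show "leaves t = w \<or> (leaves t, w) \<in> lex less_than"
    using contiguous tD w by (intro lex_words) auto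
  have "obeys \<pi> R s" if "distinct (leaves s)" "labels s \<subseteq> set \<pi>"
    "\<And>s'. s' \<in> subtrees s \<Longrightarrow> red_nodes s' = card (R \<inter> (labels s' - {leader \<pi> (labels s')}))" for s
    using that
  proof (induction s)
    case (Node c l r)
    have root: "t \<in> subtrees t" for t by (cases t) auto
    have *: "red_nodes (Node c l r) = card (R \<inter> (labels l \<union> labels r - {leader \<pi> (labels l \<union> labels r)}))"
      "red_nodes l = card (R \<inter> (labels l - {leader \<pi> (labels l)}))"
      "red_nodes r = card (R \<inter> (labels r - {leader \<pi> (labels r)}))"
      using Node.prems(3)[of "Node c l r"] Node.prems(3)[of l] Node.prems(3)[of r] root by auto
    \<comment> \<open>The red counts of the node and of its two children are all prescribed;
      \<open>weight_union\<close> isolates the contribution of the node itself.\<close>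
    have "(if c = Red then 1 else 0) = (if loser \<pi> (labels l) (labels r) \<in> R then 1 else 0 :: nat)"
      using * weight_union[of "labels l" "labels r" \<pi> R] Node.prems(1,2) by simp
    then have "c = Red \<longleftrightarrow> loser \<pi> (labels l) (labels r) \<in> R" by (auto split: if_splits)
    then show ?case using Node by auto
  qed simp
  then show "obeys \<pi> R t" using weight_s tD \<pi> by simp
qed

end

text \<open>Each node contributes the loser's membership in \<open>R\<close>. For a comb and its
  separating data this gives \<open>card R = i\<close>, as \<open>word_cycle\<close>
  demands.\<close>

lemma obeys_red_nodes:
  assumes "obeys \<pi> R t" "distinct (leaves t)" "labels t \<subseteq> set \<pi>"
  shows "red_nodes t = card (R \<inter> (labels t - {leader \<pi> (labels t)}))"
  using assms
proof (induction t)
  case (Leaf a)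
  then have "leader \<pi> {a} = a" using leader_in[of "{a}" \<pi>] by auto
  then show ?case by simp
next
  case (Node c l r)
  have "card (R \<inter> (labels l \<union> labels r - {leader \<pi> (labels l \<union> labels r)})) =
      card (R \<inter> (labels l - {leader \<pi> (labels l)})) +
      card (R \<inter> (labels r - {leader \<pi> (labels r)})) +
      (if loser \<pi> (labels l) (labels r) \<in> R then 1 else 0)"
    using Node.prems by (intro weight_union) auto
  then show ?case using Node by auto
qed

section \<open>The well-founded order behind the triangular matrix\<close>

definition shape_key :: "bctree \<Rightarrow> nat list \<times> color list \<times> nat list" where
  "shape_key t = (leaves t, node_colors t, rev (right_sizes t))"

text \<open>Words come first because \<open>cycle_detect\<close> yields no comparison of shapes
  between different words. The bound \<open>x \<le> n\<close> makes the reversed order on sizes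
  well-founded.\<close>

definition comb_less :: "nat \<Rightarrow> (bctree \<times> bctree) set" where
  "comb_less n = inv_image
     (lex less_than <*lex*> lex blue_red <*lex*> lex {(x, y). y < x \<and> x \<le> n}) shape_key"

lemma wf_comb_less: "wf (comb_less n)"
proof -
  have "blue_red \<subseteq> measure (\<lambda>c. if c = Blue then 0 else 1)" by (auto simp: blue_red_def)
  then have "wf blue_red" by (rule wf_subset[rotated]) simp
  moreover have "{(x, y). y < x \<and> x \<le> n} \<subseteq> measure (\<lambda>x. n - x)" by auto
  then have "wf {(x, y). y < x \<and> x \<le> n}" by (rule wf_subset[rotated]) simp
  ultimately show ?thesis unfolding comb_less_def by (intro wf_inv_image wf_lex_prod wf_lex) auto
qed

lemma lex_nat_greater_bounded:
  "(xs, ys) \<in> lex nat_greater \<Longrightarrow> set xs \<subseteq> {..n} \<Longrightarrow> (xs, ys) \<in> lex {(x, y). y < x \<and> x \<le> n}"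
proof (induction xs arbitrary: ys)
  case (Cons x xs)
  then show ?case by (cases ys) (auto simp: nat_greater_def)
qed auto

lemma right_sizes_le: "set (right_sizes t) \<subseteq> {..length (leaves t)}"
  by (induction t) auto

lemma comb_lessI:
  assumes "length (leaves s) = n"
    and "(leaves s, leaves t) \<in> lex less_than \<or> leaves s = leaves t \<and> (s, t) \<in> shape_less"
  shows "(s, t) \<in> comb_less n"
proof -
  have "set (rev (right_sizes s)) \<subseteq> {..n}" using right_sizes_le[of s] assms(1) by simp
  from lex_nat_greater_bounded[OF _ this, of "rev (right_sizes t)"] show ?thesis
    using assms(2) unfolding comb_less_def shape_key_def shape_less_def by auto
qed

context weighted_interval
begin

text \<open>The cycle functional chosen for \<open>t\<close> kills the coboundary. Any other comb
  has value 0 or precedes \<open>t\<close>, in which case its coefficient is 0 by induction. What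
  remains is \<open>a t\<close> times a sign.\<close>

lemma combs_independent:
  fixes a :: "bctree \<Rightarrow> 'k::comm_ring_1"
  assumes "(\<Sum>t\<in>combs {1..n} i. fscale (a t) (Poly_Mapping.single (inner (postorder t)) 1)) \<in>
      coboundary inside lt ` cochains inside lt (int n - 4)" (is "?f \<in> _")
    and "t \<in> combs {1..n} i"
  shows "a t = 0"
  using wf_comb_less[of n] assms(2)
proof (induction t rule: wf_induct_rule)
  case (less t)
  have t: "distinct (leaves t)" "labels t = {1..n}" "red_nodes t = i" "comb_shape t"
    using less.prems by (auto simp: combs_def)
  obtain \<pi> R where sep_data: "set \<pi> = labels t" "hd \<pi> = hd (leaves t)" "R \<subseteq> labels t - {hd (leaves t)}"
    "obeys \<pi> R t"
    and sep: "\<And>s. comb_shape s \<Longrightarrow> leaves s = leaves t \<Longrightarrow> obeys \<pi> R s \<Longrightarrow>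
      s = t \<or> (s, t) \<in> shape_less"
    using exists_separating[OF t(4,1)] by blast
  have "leader \<pi> (labels t) = hd \<pi>"
    unfolding sep_data(1)[symmetric] leader_def by simp
  then have "R \<inter> (labels t - {leader \<pi> (labels t)}) = R" using sep_data(2,3) by auto
  then have "card R = i" using obeys_red_nodes[OF sep_data(4) t(1)] sep_data(1) t(3) by simp
  then interpret word_cycle n i "leaves t" \<pi> R
    using t sep_data by unfold_locales auto
  have zero: "a s * of_int (cycle (inner (postorder s))) = 0"
    if s: "s \<in> combs {1..n} i" "s \<noteq> t" for s
  proof (cases "cycle (inner (postorder s)) = 0")
    case False
    have "leaves s = leaves t \<or> (leaves s, leaves t) \<in> lex less_than" "obeys \<pi> R s"
      using cycle_detect[OF s(1) False] by auto
    moreover have "comb_shape s" using s(1) by (simp add: combs_def)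
    ultimately have "(leaves s, leaves t) \<in> lex less_than \<or>
        leaves s = leaves t \<and> (s, t) \<in> shape_less"
      using sep s(2) by blast
    moreover have "length (leaves s) = n"
      using s(1) by (auto simp: combs_def simp flip: distinct_card)
    ultimately have "(s, t) \<in> comb_less n" by (intro comb_lessI)
    then show ?thesis using less.IH s(1) by simp
  qed simp
  have "0 = cycle_functional ?f" using cycle_functional_coboundary[OF assms(1)] by simp
  also have "\<dots> = (\<Sum>s\<in>combs {1..n} i. a s * of_int (cycle (inner (postorder s))))"
    by (simp add: cycle_functional_sum cycle_functional_fscale cycle_functional_single)
  also have "\<dots> = a t * of_int (cycle (inner (postorder t)))"
    using zero by (subst sum.remove[OF finite_combs less.prems]) (auto intro: sum.neutral)
  finally have "a t * of_int (cycle (inner (postorder t))) = 0" by simp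
  then show "a t = 0" using cycle_self[OF refl sep_data(4) t(3)] by auto
qed

text \<open>The sums of a combination of combs and a coboundary form a submodule to which
  \<open>cochains_subset\<close> applies.\<close>

lemma combs_span:
  fixes f :: "wpartition list \<Rightarrow>\<^sub>0 'k::comm_ring_1"
  assumes "f \<in> cochains inside lt (int n - 3)"
  shows "\<exists>a. \<exists>b\<in>coboundary inside lt ` cochains inside lt (int n - 4).
    f = (\<Sum>t\<in>combs {1..n} i. fscale (a t) (Poly_Mapping.single (inner (postorder t)) 1)) + b"
proof -
  define B where "B = (coboundary inside lt ` cochains inside lt (int n - 4) :: (_ \<Rightarrow>\<^sub>0 'k) set)"
  note B = coboundaries_closed[OF B_def]
  let ?I = "combs {1..n} i"
  let ?e = "\<lambda>t. Poly_Mapping.single (inner (postorder t)) (1 :: 'k)"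
  define M where "M = {(\<Sum>t\<in>?I. fscale (a t) (?e t)) + b | a b. b \<in> B}"
  have M_I: "(\<Sum>t\<in>?I. fscale (a t) (?e t)) + b \<in> M" if "b \<in> B" for a b
    unfolding M_def using that by blast
  interpret chain_module n i M
  proof
    show "0 \<in> M" using M_I[OF B(1), of "\<lambda>_. 0"] by simp
    fix f g assume "f \<in> M" "g \<in> M"
    then obtain a b a' b' where f: "f = (\<Sum>t\<in>?I. fscale (a t) (?e t)) + b" "b \<in> B"
      and g: "g = (\<Sum>t\<in>?I. fscale (a' t) (?e t)) + b'" "b' \<in> B" unfolding M_def by blast
    have "f + g = (\<Sum>t\<in>?I. fscale (a t + a' t) (?e t)) + (b + b')"
      by (simp add: f g fscale_add_left sum.distrib)
    then show "f + g \<in> M" using M_I[OF B(2)[OF f(2) g(2)], of "\<lambda>t. a t + a' t"] by simp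
  next
    fix k f assume "f \<in> M"
    then obtain a b where f: "f = (\<Sum>t\<in>?I. fscale (a t) (?e t)) + b" "b \<in> B"
      unfolding M_def by blast
    have "fscale k f = (\<Sum>t\<in>?I. fscale (k * a t) (?e t)) + fscale k b"
      by (simp add: f fscale_add_right fscale_sum fscale_fscale)
    then show "fscale k f \<in> M" using M_I[OF B(3)[OF f(2)], of "\<lambda>t. k * a t"] by simp
  next
    have "b \<in> M" if "b \<in> B" for b using M_I[OF that, of "\<lambda>_. 0"] by simp
    then show "coboundary inside lt ` cochains inside lt (int n - 4) \<subseteq> M"
      unfolding B_def[symmetric] by blast
  qed
  have "?e t \<in> M" if t: "t \<in> ?I" for t
  proof -
    have "(\<Sum>s\<in>?I. fscale (if s = t then 1 else 0) (?e s)) = (\<Sum>s\<in>?I. if s = t then ?e s else 0)"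
      by (intro sum.cong) auto
    also have "\<dots> = ?e t" using t finite_combs[of "{1..n}" i] by simp
    finally show ?thesis using M_I[OF B(1), of "\<lambda>s. if s = t then 1 else 0"] by simp
  qed
  then have "f \<in> M" using cochains_subset assms by blast
  then show ?thesis unfolding M_def B_def by blast
qed

lemma open_tree_chain_eq:
  assumes "t \<in> combs {1..n} i"
  shows "open_tree_chain n i t = inner (postorder t)"
proof -
  have F: "full n i (postorder t)" using assms by (intro full_postorder) (auto simp: combs_def)
  have "set (inner (postorder t)) \<subseteq> inside" using inner_in_chains[OF F] by (simp add: chains_def)
  then have "filter (\<lambda>\<alpha>. \<alpha> \<notin> {lo, hi}) (inner (postorder t)) = inner (postorder t)"
    by (auto simp: filter_id_conv inside_def wp_less_def)
  then show ?thesis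
    unfolding open_tree_chain_def tree_chain_def merge_chain_full[OF F] by simp
qed

end

text \<open>Keeps cosets out of the combinatorial part: only computations with representatives
  modulo \<open>B\<close> remain.\<close>

lemma module_basis_quotient:
  fixes Z B :: "('b \<Rightarrow>\<^sub>0 'k::comm_ring_1) set"
  assumes Z: "0 \<in> Z" "\<And>x y. x \<in> Z \<Longrightarrow> y \<in> Z \<Longrightarrow> x + y \<in> Z" "\<And>a x. x \<in> Z \<Longrightarrow> fscale a x \<in> Z"
    and B: "0 \<in> B" "\<And>x y. x \<in> B \<Longrightarrow> y \<in> B \<Longrightarrow> x + y \<in> B" "\<And>a x. x \<in> B \<Longrightarrow> fscale a x \<in> B"
    and I: "finite I" and e: "\<And>t. t \<in> I \<Longrightarrow> e t \<in> Z"
    and indep: "\<And>a t. (\<Sum>t\<in>I. fscale (a t) (e t)) \<in> B \<Longrightarrow> t \<in> I \<Longrightarrow> a t = 0"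
    and span: "\<And>z. z \<in> Z \<Longrightarrow> \<exists>a. \<exists>b\<in>B. z = (\<Sum>t\<in>I. fscale (a t) (e t)) + b"
    and b: "\<And>t. t \<in> I \<Longrightarrow> b t = e t +o B"
  shows "module_basis (ring_of_type_algebra :: 'k ring) (quotient_module Z B) I b"
proof -
  define Q where "Q = quotient_module Z B"
  have carrier: "carrier Q = (\<lambda>z. z +o B) ` Z" and Qadd: "S \<oplus>\<^bsub>Q\<^esub> T = S + T"
    and Qzero: "\<zero>\<^bsub>Q\<^esub> = B" and Qsmult: "c \<odot>\<^bsub>Q\<^esub> S = fscale c ` S + B" for S T c
    by (simp_all add: Q_def quotient_module_def)
  interpret module "ring_of_type_algebra :: 'k ring" Q
    unfolding Q_def by (rule quotient_module_module[OF Z B])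
  have BB: "B + B = B"
    using B(2) set_zero_plus2[OF B(1), of B] by (auto elim!: set_plus_elim)
  have coset_0: "x +o B = B \<longleftrightarrow> x \<in> B" for x
  proof
    assume "x +o B = B"
    moreover have "x + 0 \<in> x +o B" using B(1) by (rule set_plus_intro2)
    ultimately show "x \<in> B" by simp
  next
    assume x: "x \<in> B"
    have "y \<in> x +o B" if "y \<in> B" for y
    proof -
      have "x + (y + fscale (- 1) x) \<in> x +o B"
        using B(2)[OF that B(3)[OF x]] by (rule set_plus_intro2)
      then show ?thesis by (simp add: fscale_minus)
    qed
    then show "x +o B = B" using B(2)[OF x] by (auto simp: elt_set_plus_def)
  qed
  have smult: "c \<odot>\<^bsub>Q\<^esub> (x +o B) = fscale c x +o B" for c x
  proof -
    have "fscale c ` (x +o B) = fscale c x +o fscale c ` B"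
      by (fastforce simp: elt_set_plus_def image_iff fscale_add_right)
    moreover have "fscale c ` B + B = B"
      using B set_zero_plus2[of "fscale c ` B" B] image_eqI[of 0 "fscale c" 0 B]
      by (auto elim!: set_plus_elim)
    ultimately show ?thesis by (simp only: Qsmult set_plus_rearrange3)
  qed
  have mem: "x +o B \<in> carrier Q" if "x \<in> Z" for x
    unfolding carrier using that by (rule imageI)
  have sum_Z: "(\<Sum>t\<in>J. fscale (a t) (e t)) \<in> Z" if "J \<subseteq> I" for J a
    using finite_subset[OF that I] that
    by (induction J rule: finite_induct) (auto intro: Z e)
  have comb: "(\<Oplus>\<^bsub>Q\<^esub>t\<in>J. a t \<odot>\<^bsub>Q\<^esub> b t) = (\<Sum>t\<in>J. fscale (a t) (e t)) +o B"
    if "J \<subseteq> I" for J a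
    using finite_subset[OF that I] that
  proof (induction J rule: finite_induct)
    case empty
    then show ?case by (simp add: Qzero)
  next
    case (insert t J)
    have abt: "a s \<odot>\<^bsub>Q\<^esub> b s = fscale (a s) (e s) +o B" if "s \<in> I" for s
      using that by (simp add: b smult)
    have "a s \<odot>\<^bsub>Q\<^esub> b s \<in> carrier Q" if "s \<in> I" for s
      using that by (simp add: abt mem Z e)
    then have "(\<Oplus>\<^bsub>Q\<^esub>s\<in>insert t J. a s \<odot>\<^bsub>Q\<^esub> b s) = a t \<odot>\<^bsub>Q\<^esub> b t \<oplus>\<^bsub>Q\<^esub> (\<Oplus>\<^bsub>Q\<^esub>s\<in>J. a s \<odot>\<^bsub>Q\<^esub> b s)"
      using insert by (intro finsum_insert) auto
    also have "\<dots> = (fscale (a t) (e t) +o B) + ((\<Sum>s\<in>J. fscale (a s) (e s)) +o B)"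
      using insert by (simp add: Qadd abt)
    also have "\<dots> = (fscale (a t) (e t) + (\<Sum>s\<in>J. fscale (a s) (e s))) +o B"
      by (simp only: set_plus_rearrange BB)
    finally show ?case using insert by simp
  qed
  show ?thesis
    unfolding module_basis_def Q_def[symmetric]
  proof (intro conjI ballI impI)
    show "finite I" by (rule I)
    show "b \<in> I \<rightarrow> carrier Q" using b e mem by auto
    show "a t = \<zero>\<^bsub>ring_of_type_algebra\<^esub>"
      if "(\<Oplus>\<^bsub>Q\<^esub>t\<in>I. a t \<odot>\<^bsub>Q\<^esub> b t) = \<zero>\<^bsub>Q\<^esub>" "t \<in> I" for a t
      using that indep[of a t] by (simp add: comb Qzero coset_0 ring_of_type_algebra_def)
    fix y assume "y \<in> carrier Q"
    then obtain z where z: "z \<in> Z" "y = z +o B" unfolding carrier by blast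
    obtain a c where ac: "c \<in> B" "z = (\<Sum>t\<in>I. fscale (a t) (e t)) + c" using span[OF z(1)] by blast
    have "y = (\<Sum>t\<in>I. fscale (a t) (e t)) +o B"
      using coset_0[of c] ac set_plus_rearrange2[of "\<Sum>t\<in>I. fscale (a t) (e t)" c B] z(2) by simp
    then show "\<exists>a\<in>I \<rightarrow> carrier ring_of_type_algebra. y = (\<Oplus>\<^bsub>Q\<^esub>t\<in>I. a t \<odot>\<^bsub>Q\<^esub> b t)"
      by (intro bexI[of _ a]) (auto simp: comb ring_of_type_algebra_def)
  qed
qed

text \<open>Valid over every commutative ring, since the only scalars that have to be inverted are
  signs.\<close>

lemma wp_cohomology_basis:
  assumes "1 \<le> n" "i \<le> n - 1"
  shows "module_basis (ring_of_type_algebra :: 'k::comm_ring_1 ring)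
    (wp_cohomology n i (int n - 3)) (Comb2 n i)
    (\<lambda>t. chain_class (wp_cohomology n i (int n - 3)) (open_tree_chain n i t))"
proof (cases "n = 1")
  case True
  then have i: "i = 0" using assms(2) by simp
  have bt: "wp_bot 1 = wp_top 1 0" by (simp add: wp_bot_def wp_top_def)
  \<comment> \<open>For \<open>n = 1\<close> the degree is \<open>- 2\<close>, the one in which the
    degenerate interval has a free module of rank one.\<close>
  have H: "wp_cohomology n i (int n - 3) =
      quotient_module {f :: wpartition list \<Rightarrow>\<^sub>0 'k. Poly_Mapping.keys f \<subseteq> {[]}} {0}"
    by (simp add: wp_cohomology_def interval_cohomology_def True i bt[simplified])
  have I: "Comb2 n i = {Leaf 1}"
    unfolding Comb2_eq True i
  proof
    show "combs {1..1} 0 \<subseteq> {Leaf 1}"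
    proof
      fix t assume "t \<in> combs {1..1} 0"
      then have t: "distinct (leaves t)" "labels t = {1}" by (auto simp: combs_def)
      then have "length (leaves t) = 1" using distinct_card[of "leaves t"] by simp
      then obtain a where "leaves t = [a]" by (auto simp: length_Suc_conv)
      then show "t \<in> {Leaf 1}" using t(2) leaves_eq_singleton by auto
    qed
  qed (auto simp: combs_def)
  have otc: "open_tree_chain n i (Leaf 1) = []"
    by (simp add: open_tree_chain_def tree_chain_def True)
  show ?thesis
    unfolding H
  proof (rule module_basis_quotient[where e = "\<lambda>_. Poly_Mapping.single [] 1"])
    fix z :: "wpartition list \<Rightarrow>\<^sub>0 'k" assume z: "z \<in> {f. Poly_Mapping.keys f \<subseteq> {[]}}"
    have "z = fscale (Poly_Mapping.lookup z []) (Poly_Mapping.single [] 1)"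
      using z by (intro poly_mapping_eqI) (auto simp: lookup_single when_def in_keys_iff)
    then show "\<exists>a. \<exists>b\<in>{0}. z = (\<Sum>t\<in>Comb2 n i. fscale (a t) (Poly_Mapping.single [] 1)) + b"
      unfolding I by (intro exI[of _ "\<lambda>_. Poly_Mapping.lookup z []"]) simp
  next
    fix a t assume "(\<Sum>t\<in>Comb2 n i. fscale (a t) (Poly_Mapping.single [] (1 :: 'k)) :: wpartition list \<Rightarrow>\<^sub>0 'k) \<in> {0}"
      "t \<in> Comb2 n i"
    then have "Poly_Mapping.lookup (Poly_Mapping.single [] (a t) :: wpartition list \<Rightarrow>\<^sub>0 'k) [] = 0"
      by (simp add: I fscale_single)
    then show "a t = 0" by (simp add: lookup_single)
  next
    fix x y :: "wpartition list \<Rightarrow>\<^sub>0 'k"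
    assume "x \<in> {f. Poly_Mapping.keys f \<subseteq> {[]}}" "y \<in> {f. Poly_Mapping.keys f \<subseteq> {[]}}"
    then show "x + y \<in> {f. Poly_Mapping.keys f \<subseteq> {[]}}" using keys_add[of x y] by blast
  next
    fix a and x :: "wpartition list \<Rightarrow>\<^sub>0 'k" assume "x \<in> {f. Poly_Mapping.keys f \<subseteq> {[]}}"
    then show "fscale a x \<in> {f. Poly_Mapping.keys f \<subseteq> {[]}}" using keys_fscale[of a x] by blast
  qed (auto simp: I otc otc[simplified] chain_class_def quotient_module_def)
next
  case False
  then interpret weighted_interval n i using assms by unfold_locales auto
  define Z where "Z = {f \<in> cochains inside lt (int n - 3). coboundary inside lt f = (0 :: _ \<Rightarrow>\<^sub>0 'k)}"
  define B where "B = (coboundary inside lt ` cochains inside lt (int n - 4) :: (_ \<Rightarrow>\<^sub>0 'k) set)"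
  note B_closed = coboundaries_closed[OF B_def]
  have ne: "lo \<noteq> hi" using bot_less_top by (simp add: wp_less_def)
  have H: "wp_cohomology n i (int n - 3) = quotient_module Z B"
    using ne by (simp add: wp_cohomology_def interval_cohomology_def reduced_cohomology_def
        inside_def Z_def B_def)
  \<comment> \<open>All gaps of a top chain are empty, so every top cochain is a cocycle.\<close>
  have "coboundary inside lt f = 0" if "f \<in> cochains inside lt (int n - 3)" for f :: "_ \<Rightarrow>\<^sub>0 'k"
    using that gap_empty_of_maximal
    by (auto simp: coboundary_def cochains_def subset_iff intro!: sum.neutral)
  then have Z: "Z = cochains inside lt (int n - 3)" by (auto simp: Z_def)
  have e: "Poly_Mapping.single (inner (postorder t)) (1 :: 'k) \<in> cochains inside lt (int n - 3)"
    if "t \<in> combs {1..n} i" for t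
    using that inner_in_chains[OF full_postorder[of t n i]] by (auto simp: combs_def cochains_def)
  show ?thesis
    unfolding H Comb2_eq Z
  proof (rule module_basis_quotient[where e = "\<lambda>t. Poly_Mapping.single (inner (postorder t)) 1"])
    show "finite (combs {1..n} i)" by (rule finite_combs) simp
    show "a t = 0" if "(\<Sum>t\<in>combs {1..n} i.
        fscale (a t) (Poly_Mapping.single (inner (postorder t)) 1)) \<in> B" "t \<in> combs {1..n} i" for a t
      using combs_independent that unfolding B_def by blast
    show "\<exists>a. \<exists>b\<in>B. z = (\<Sum>t\<in>combs {1..n} i.
        fscale (a t) (Poly_Mapping.single (inner (postorder t)) 1)) + b"
      if "z \<in> cochains inside lt (int n - 3)" for z
      using combs_span[OF that] unfolding B_def .
    show "chain_class (quotient_module (cochains inside lt (int n - 3)) B) (open_tree_chain n i t) =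
        Poly_Mapping.single (inner (postorder t)) 1 +o B" if "t \<in> combs {1..n} i" for t
      using that by (simp add: chain_class_def quotient_module_def open_tree_chain_eq)
  qed (use cochains_closed B_closed e in auto)
qed

theorem theorem5p3:
  fixes n i :: nat
  assumes "1 \<le> n" and "i \<le> n - 1"
  shows
    "module_basis (ring_of_type_algebra :: int ring)
       (wp_cohomology n i (int n - 3)) (Comb2 n i)
       (\<lambda>t. chain_class (wp_cohomology n i (int n - 3)) (open_tree_chain n i t)) \<and>
     module_basis (ring_of_type_algebra :: 'k::field ring)
       (wp_cohomology n i (int n - 3)) (Comb2 n i)
       (\<lambda>t. chain_class (wp_cohomology n i (int n - 3)) (open_tree_chain n i t))"
  using assms by (intro conjI wp_cohomology_basis)

end
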